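(* Let $\Omega \subset \mathbb{R}^n$ be a domain with smooth boundary, let $f:\mathbb{R}_{\geq 0}\to\mathbb{R}_{\geq 0}$ satisfy $f>0$, $f'\geq 0$ and $$ \max_{t>0} f'(t) < \frac{2n\,\omega_n^{2/n}}{|\Omega|^{2/n}}, $$ where $\omega_n$ is the volume of the unit ball in $\mathbb{R}^n$. Then the solution $u$ of $$ -\Delta u = f(u)\ \text{ in } \Omega, \qquad u = 0\ \text{ on } \partial\Omega, $$ satisfies $u^* \leq v$, where $v$ is the solution on the ball $B$ with the same measure as $\Omega$, that is, the solution of $$ -\Delta v = f(v)\ \text{ in } B, \qquad v = 0\ \text{ on } \partial B. $$
   Context: Here $|\cdot|$ denotes Lebesgue measure on $\mathbb{R}^n$, and $B\subset\mathbb{R}^n$ is the ball centered at the origin with $|B|=|\Omega|$. The function $u^*$ is the symmetric decreasing rearrangement of $u$: the radially symmetric, radially non-increasing function on $B$ that is equimeasurable with $u$, so that for every $t\geq 0$ the set $\{x\in B: u^*(x)>t\}$ is a ball centered at the origin (possibly empty) with measure $|\{x\in\Omega: u(x)>t\}|$. The inequality $u^*\leq v$ is meant pointwise in $B$. *)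

theory Defs
  imports "HOL-Analysis.Analysis"
begin

text \<open>
  On an open set \<open>S\<close>, \<open>Ck_on k S g\<close> says that \<open>g\<close> is of class \<open>C\<^sup>k\<close> on \<open>S\<close>; the partial derivatives
  are the values of the Frechet derivative on the standard basis vectors.
\<close>

definition partial_deriv :: "'a::euclidean_space \<Rightarrow> ('a \<Rightarrow> real) \<Rightarrow> 'a \<Rightarrow> real" where
  "partial_deriv b g x = frechet_derivative g (at x) b"

fun Ck_on :: "nat \<Rightarrow> 'a::euclidean_space set \<Rightarrow> ('a \<Rightarrow> real) \<Rightarrow> bool" where
  "Ck_on 0 S g \<longleftrightarrow> continuous_on S g"
| "Ck_on (Suc k) S g \<longleftrightarrow>
     (\<forall>x\<in>S. g differentiable (at x)) \<and> (\<forall>b\<in>Basis. Ck_on k S (partial_deriv b g))"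

definition smooth_on :: "'a::euclidean_space set \<Rightarrow> ('a \<Rightarrow> real) \<Rightarrow> bool" where
  "smooth_on S g \<longleftrightarrow> (\<forall>k. Ck_on k S g)"

definition laplacian :: "('a::euclidean_space \<Rightarrow> real) \<Rightarrow> 'a \<Rightarrow> real" where
  "laplacian g x = (\<Sum>b\<in>Basis. partial_deriv b (partial_deriv b g) x)"

text \<open>
  Smoothness of the boundary through local defining functions: near each boundary point, the set is
  the negativity set of a smooth function with nowhere vanishing gradient.
\<close>

definition smooth_boundary :: "'a::euclidean_space set \<Rightarrow> bool" where
  "smooth_boundary \<Omega> \<longleftrightarrow>
     (\<forall>p\<in>frontier \<Omega>. \<exists>U \<phi>. open U \<and> p \<in> U \<and> smooth_on U \<phi> \<and>
        (\<forall>x\<in>U. \<exists>b\<in>Basis. partial_deriv b \<phi> x \<noteq> 0) \<and>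
        \<Omega> \<inter> U = {x \<in> U. \<phi> x < 0})"

definition smooth_bounded_domain :: "'a::euclidean_space set \<Rightarrow> bool" where
  "smooth_bounded_domain \<Omega> \<longleftrightarrow>
     open \<Omega> \<and> connected \<Omega> \<and> \<Omega> \<noteq> {} \<and> bounded \<Omega> \<and> smooth_boundary \<Omega>"

text \<open>
  Classical solutions, of class \<open>C\<^sup>2\<close> in the open set \<open>\<Omega>\<close> and continuous up to the boundary.
  The nonlinearity is a function on the nonnegative reals, so that \<open>f(u)\<close> is meaningful only for
  \<open>u \<ge> 0\<close>; as functions are total here, this has to be stated.
\<close>

definition dirichlet_solution ::
    "'a::euclidean_space set \<Rightarrow> (real \<Rightarrow> real) \<Rightarrow> ('a \<Rightarrow> real) \<Rightarrow> bool" where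
  "dirichlet_solution \<Omega> f u \<longleftrightarrow>
     Ck_on 2 \<Omega> u \<and> continuous_on (closure \<Omega>) u \<and>
     (\<forall>x\<in>closure \<Omega>. 0 \<le> u x) \<and>
     (\<forall>x\<in>\<Omega>. - laplacian u x = f (u x)) \<and>
     (\<forall>x\<in>frontier \<Omega>. u x = 0)"

text \<open>
  \<open>w\<close> is the symmetric decreasing rearrangement on \<open>B\<close> of the nonnegative function \<open>u\<close> on \<open>\<Omega>\<close>.
  The monotonicity clause contains radial symmetry (take \<open>norm x = norm y\<close>). The superlevel sets are
  open balls, with \<open>ball 0 r = {}\<close> for \<open>r \<le> 0\<close>; equimeasurability alone would leave the values of
  \<open>w\<close> on null sets undetermined, such as at the origin.
\<close>

definition symmetric_decreasing_rearrangement ::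
    "'a::euclidean_space set \<Rightarrow> ('a \<Rightarrow> real) \<Rightarrow> 'a set \<Rightarrow> ('a \<Rightarrow> real) \<Rightarrow> bool" where
  "symmetric_decreasing_rearrangement \<Omega> u B w \<longleftrightarrow>
     (\<forall>x\<in>B. 0 \<le> w x) \<and>
     (\<forall>x\<in>B. \<forall>y\<in>B. norm x \<le> norm y \<longrightarrow> w y \<le> w x) \<and>
     (\<forall>t\<ge>0. \<exists>r. {x \<in> B. w x > t} = ball 0 r \<and>
        measure lebesgue (ball (0::'a) r) = measure lebesgue {x \<in> \<Omega>. u x > t})"

lemma measure_ball_strict_mono:
  assumes "0 \<le> r" "r < s"
  shows "measure lebesgue (ball (0::'a::euclidean_space) r) < measure lebesgue (ball (0::'a) s)"
proof -
  have "r ^ DIM('a) < s ^ DIM('a)"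
    using assms by (intro power_strict_mono) auto
  then show ?thesis
    using assms content_ball[of r "0::'a"] content_ball[of s "0::'a"]
      unit_ball_vol_pos[of "real DIM('a)"]
    by (simp add: measure_completion)
qed

lemma ball_eq_of_measure_eq:
  assumes "measure lebesgue (ball (0::'a::euclidean_space) r) = measure lebesgue (ball (0::'a) s)"
  shows "ball (0::'a) r = ball 0 s"
proof -
  have "ball (0::'a) r = ball 0 (max r 0)" "ball (0::'a) s = ball 0 (max s 0)"
    by (auto simp: max_def)
  moreover have "max r 0 = max s 0"
    using assms measure_ball_strict_mono[of "max r 0" "max s 0", where 'a='a]
      measure_ball_strict_mono[of "max s 0" "max r 0", where 'a='a] calculation
    by (metis linorder_neqE_linordered_idom max.cobounded2 order_less_irrefl)
  ultimately show ?thesis by simp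
qed

lemma symmetric_decreasing_rearrangement_unique:
  assumes "symmetric_decreasing_rearrangement \<Omega> u B w"
    and "symmetric_decreasing_rearrangement \<Omega> u B w'" and x: "x \<in> B"
  shows "w x = w' x"
proof -
  have eq: "{x \<in> B. w x > t} = {x \<in> B. w' x > t}" if "t \<ge> 0" for t
    using assms(1,2) that ball_eq_of_measure_eq
    unfolding symmetric_decreasing_rearrangement_def by metis
  have nn: "0 \<le> w x" "0 \<le> w' x"
    using assms unfolding symmetric_decreasing_rearrangement_def by auto
  have "w x > t \<longleftrightarrow> w' x > t" if "t \<ge> 0" for t
    using eq[OF that] x by blast
  from this[of "w x"] this[of "w' x"] nn show ?thesis by auto
qed

lemma symmetric_decreasing_rearrangement_exists:
  fixes \<Omega> :: "'a::euclidean_space set"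
  assumes \<Omega>: "open \<Omega>" "bounded \<Omega>" and u: "continuous_on \<Omega> u"
    and bdd: "\<And>x. x \<in> \<Omega> \<Longrightarrow> u x \<le> M"
    and R: "measure lebesgue (ball (0::'a) R) = measure lebesgue \<Omega>"
  shows "\<exists>w. symmetric_decreasing_rearrangement \<Omega> u (ball 0 R) w"
proof -
  define L where "L t = {x \<in> \<Omega>. u x > t}" for t
  define \<mu> where "\<mu> t = measure lebesgue (L t)" for t
  define c where "c x = measure lebesgue (ball (0::'a) (norm x))" for x :: 'a
  define A where "A x = {t. 0 \<le> t \<and> \<mu> t \<le> c x}" for x
  define w where "w x = Inf (A x)" for x
  have openL: "open (L t)" for t
  proof -
    have "L t = \<Omega> \<inter> u -` {t<..}" unfolding L_def by auto
    then show ?thesis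
      using continuous_open_preimage[OF u \<Omega>(1) open_greaterThan] by simp
  qed
  have bL: "bounded (L t)" for t
    using \<Omega>(2) unfolding L_def by (auto intro: bounded_subset)
  have Lm: "L t \<in> lmeasurable" for t
    using openL bL by (intro lmeasurable_open) auto
  have anti: "\<mu> s \<le> \<mu> t" if "t \<le> s" for s t
    unfolding \<mu>_def by (rule measure_mono_fmeasurable) (use that Lm in \<open>auto simp: L_def\<close>)
  have mle: "\<mu> t \<le> measure lebesgue (ball (0::'a) R)" for t
    unfolding R \<mu>_def
    by (rule measure_mono_fmeasurable) (use Lm \<Omega> in \<open>auto simp: L_def intro: lmeasurable_open\<close>)
  have right: "\<exists>s>t. \<mu> s > a" if "\<mu> t > a" for t a
  proof -
    have un: "(\<Union>n. L (t + 1 / real (Suc n))) = L t"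
    proof (intro equalityI subsetI)
      fix x assume "x \<in> L t"
      then have "x \<in> \<Omega>" "0 < u x - t" by (auto simp: L_def)
      moreover obtain n where "1 / real (Suc n) < u x - t"
        using reals_Archimedean[OF \<open>0 < u x - t\<close>] by (auto simp: inverse_eq_divide)
      ultimately have "x \<in> L (t + 1 / real (Suc n))" by (auto simp: L_def)
      then show "x \<in> (\<Union>n. L (t + 1 / real (Suc n)))" by blast
    next
      fix x assume "x \<in> (\<Union>n. L (t + 1 / real (Suc n)))"
      then obtain n where "x \<in> \<Omega>" "t + 1 / real (Suc n) < u x" by (auto simp: L_def)
      moreover have "0 < 1 / real (Suc n)" by simp
      ultimately have "t < u x" by linarith
      then show "x \<in> L t" using \<open>x \<in> \<Omega>\<close> unfolding L_def by simp
    qed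
    have inc: "incseq (\<lambda>n. L (t + 1 / real (Suc n)))"
    proof (rule incseq_SucI)
      fix n
      have "1 / real (Suc (Suc n)) \<le> 1 / real (Suc n)" by (simp add: frac_le)
      then show "L (t + 1 / real (Suc n)) \<le> L (t + 1 / real (Suc (Suc n)))"
        unfolding L_def by force
    qed
    have rng: "range (\<lambda>n. L (t + 1 / real (Suc n))) \<subseteq> sets lebesgue"
      using fmeasurableD[OF Lm] by blast
    have fin: "emeasure lebesgue (\<Union>n. L (t + 1 / real (Suc n))) \<noteq> \<infinity>"
      unfolding un using fmeasurableD2[OF Lm] by simp
    have "(\<lambda>n. measure lebesgue (L (t + 1 / real (Suc n)))) \<longlonglongrightarrow> measure lebesgue (L t)"
      using Lim_measure_incseq[OF rng inc fin] un by simp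
    then have "\<forall>\<^sub>F n in sequentially. a < measure lebesgue (L (t + 1 / real (Suc n)))"
      using that unfolding \<mu>_def by (rule order_tendstoD)
    then obtain n where "a < \<mu> (t + 1 / real (Suc n))"
      unfolding \<mu>_def by (auto simp: eventually_sequentially)
    then show ?thesis by (intro exI[of _ "t + 1 / real (Suc n)"]) auto
  qed
  have ne: "A x \<noteq> {}" for x
  proof -
    have "L (max M 0) = {}" using bdd by (force simp: L_def)
    then have "max M 0 \<in> A x" by (simp add: A_def \<mu>_def c_def)
    then show ?thesis by auto
  qed
  have bb: "bdd_below (A x)" for x
    by (rule bdd_belowI[of _ 0]) (auto simp: A_def)
  have level: "w x > t \<longleftrightarrow> \<mu> t > c x" if "t \<ge> 0" for x t
  proof
    assume "w x > t"
    then have "t \<notin> A x" using cInf_lower[OF _ bb, of t x] by (auto simp: w_def)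
    then show "\<mu> t > c x" using that by (auto simp: A_def)
  next
    assume "\<mu> t > c x"
    then obtain s where s: "s > t" "\<mu> s > c x" using right by blast
    have "s \<le> w x" unfolding w_def
    proof (rule cInf_greatest[OF ne])
      fix y assume "y \<in> A x"
      then have "\<mu> y \<le> c x" by (simp add: A_def)
      then show "s \<le> y" using anti[of y s] s by (meson linorder_le_cases order.trans not_le)
    qed
    then show "w x > t" using s by simp
  qed
  have nn: "0 \<le> w x" for x
    unfolding w_def by (rule cInf_greatest[OF ne]) (auto simp: A_def)
  have cmono: "c x \<le> c y" if "norm x \<le> norm y" for x y
    unfolding c_def by (rule measure_mono_fmeasurable) (use that in auto)
  have mono: "w y \<le> w x" if "norm x \<le> norm y" for x y
  proof -
    have "A x \<subseteq> A y" using cmono[OF that] by (auto simp: A_def)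
    then show ?thesis unfolding w_def by (intro cInf_superset_mono ne bb)
  qed
  have ball: "\<exists>r. {x \<in> ball 0 R. w x > t} = ball 0 r \<and>
      measure lebesgue (ball (0::'a) r) = measure lebesgue {x \<in> \<Omega>. u x > t}" if t: "t \<ge> 0" for t
  proof -
    define r where "r = root DIM('a) (\<mu> t / unit_ball_vol (real DIM('a)))"
    have vp: "unit_ball_vol (real DIM('a)) > 0" by simp
    have \<mu>0: "\<mu> t \<ge> 0" by (simp add: \<mu>_def)
    have r0: "r \<ge> 0" using \<mu>0 vp by (simp add: r_def)
    have "r ^ DIM('a) = \<mu> t / unit_ball_vol (real DIM('a))"
      unfolding r_def using \<mu>0 vp by (intro real_root_pow_pos2) auto
    then have mr: "measure lebesgue (ball (0::'a) r) = \<mu> t"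
      using content_ball[OF r0, of "0::'a"] vp by (simp add: measure_completion)
    have iff: "\<mu> t > c x \<longleftrightarrow> norm x < r" for x
      using measure_ball_strict_mono[of "norm x" r, where 'a='a]
        measure_ball_strict_mono[of r "norm x", where 'a='a] r0 mr
      unfolding c_def by (metis linorder_neqE_linordered_idom norm_ge_zero order_less_asym order_less_irrefl)
    have sub: "ball (0::'a) r \<subseteq> ball 0 R"
    proof (cases "r \<le> R")
      case True then show ?thesis by auto
    next
      case False
      then have "measure lebesgue (ball (0::'a) r) \<le> measure lebesgue (ball (0::'a) R)"
        using mr mle by simp
      moreover have "ball (0::'a) R = ball 0 (max R 0)" by (auto simp: max_def)
      ultimately have "\<not> max R 0 < r"
        using measure_ball_strict_mono[of "max R 0" r, where 'a='a] by (metis max.cobounded2 not_le)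
      then have "r = 0" using False r0 by auto
      then show ?thesis by simp
    qed
    have "{x \<in> ball 0 R. w x > t} = ball 0 r"
      using sub level[OF t] iff by auto
    then show ?thesis using mr unfolding \<mu>_def L_def by blast
  qed
  show ?thesis
    unfolding symmetric_decreasing_rearrangement_def
    using nn mono ball by (intro exI[of _ w]) blast
qed

end

theory Submission
  imports Defs
begin

text \<open>
  This is Talenti's comparison argument, arranged so that neither the coarea formula nor polar
  coordinates are needed. For levels \<open>0 < t < t'\<close>, the Brunn-Minkowski inequality applied to the
  superlevel sets of a smooth truncation of \<open>u\<close> bounds the integral of \<open>|\<nabla>u|\<close> over \<open>{t < u < t'}\<close>
  from below by the isoperimetric constant; Cauchy-Schwarz and integration by parts bound it from
  above by \<open>|{t < u \<le> t'}|\<close> and the integral of \<open>f(u)\<close> over \<open>{u > t}\<close>. In terms of the radial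
  profile \<open>U\<close> of \<open>u\<^sup>*\<close> this says that \<open>U\<close> decreases no faster than the radial solution \<open>W\<close> of
  \<open>-\<Delta>W = f(u\<^sup>*)\<close>, so \<open>u\<^sup>* \<le> W\<close>. Finally, if \<open>M = max (W - v)\<close> were positive, then
  \<open>-\<Delta>(W - v) = f(u\<^sup>*) - f(v) \<le> L M\<close> with \<open>L = sup f'\<close>, and comparison with \<open>R\<^sup>2 - |x|\<^sup>2\<close> would give
  \<open>M \<le> L M R\<^sup>2 / (2n) < M\<close>.
\<close>

section \<open>The Brunn-Minkowski inequality\<close>

text \<open>The level estimate compares two levels because beforehand neither the continuity of u*
  nor the size of the critical set of u is known. Differentiating the distribution function would
  need control of both; increments need neither. Only afterwards is the profile \<open>U\<close>
  seen to be continuous, which makes W twice differentiable away from the origin.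

  W separates two difficulties. From u to W the right side is frozen, and the estimate is the one
  for a linear equation. From W to v only monotonicity and the Lipschitz constant L matter: u* \<le>
  W \<le> v + M bounds f at u* by f(v) + L M. The threshold comes from -\<Delta>(R^2 - |x|^2) = 2n:
  if |\<Omega>| = \<omega> R^n, where \<omega> is the volume of the unit ball, the hypothesis on f'
  says exactly L R^2 < 2n.

  Brunn-Minkowski is obtained from the Prekopa-Leindler inequality with rational weights m/(m+k) and
  k/(m+k). Its hypothesis f^m g^k \<le> h^(m+k) involves natural powers only, so it makes sense for
  \<open>ennreal\<close> values, and induction on the dimension is Fubini.\<close>

lemma emeasure_lborel_inner_compact:
  fixes A :: "'a::euclidean_space set"
  assumes "A \<in> sets borel" "c < emeasure lborel A"
  shows "\<exists>K\<subseteq>A. compact K \<and> c < emeasure lborel K"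
proof -
  have A: "A \<inter> cball 0 (real N) \<in> sets lborel" for N
    using assms(1) by simp
  have inc: "incseq (\<lambda>N. A \<inter> cball 0 (real N))"
    by (rule incseq_SucI) auto
  have un: "(\<Union>N. A \<inter> cball 0 (real N)) = A"
    using real_arch_simple by (auto simp: dist_norm)
  have "(SUP N. emeasure lborel (A \<inter> cball 0 (real N))) = emeasure lborel A"
    using SUP_emeasure_incseq[OF _ inc, of lborel] A un by auto
  then obtain N where N: "c < emeasure lborel (A \<inter> cball 0 (real N))"
    using assms(2) less_SUP_iff[of c "\<lambda>N. emeasure lborel (A \<inter> cball 0 (real N))" UNIV] by auto
  \<comment> \<open>Inner regularity is applied to a finite measure, hence the restriction to a ball
    so large that the part of A in it still exceeds c.\<close>
  let ?M = "density lborel (indicator (cball 0 (real N)) :: 'a \<Rightarrow> ennreal)"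
  have eM: "emeasure ?M X = emeasure lborel (X \<inter> cball 0 (real N))" if "X \<in> sets borel" for X
    using that by (subst emeasure_restricted) (auto simp: Int_commute)
  have fin: "emeasure ?M (space ?M) \<noteq> \<infinity>"
    using eM[of UNIV] emeasure_lborel_cball_finite[of "0::'a" "real N"] by auto
  have "emeasure ?M A = (SUP K \<in> {K. K \<subseteq> A \<and> compact K}. emeasure ?M K)"
    by (rule inner_regular) (use assms(1) fin in auto)
  moreover have "c < emeasure ?M A" using N eM assms(1) by simp
  ultimately obtain K where K: "K \<subseteq> A" "compact K" "c < emeasure ?M K"
    by (auto simp: less_SUP_iff)
  have "emeasure ?M K \<le> emeasure lborel K"
    using K(2) by (subst eM) (auto intro!: emeasure_mono simp: compact_imp_closed)
  then show ?thesis using K by (meson order_less_le_trans)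
qed

lemma emeasure_lborel_image_affine:
  fixes K :: "real set"
  assumes K: "compact K" and "\<alpha> > 0"
  shows "emeasure lborel ((\<lambda>x. t + \<alpha> * x) ` K) = ennreal \<alpha> * emeasure lborel K"
proof -
  have c: "compact ((\<lambda>x. t + \<alpha> * x) ` K)"
    by (intro compact_continuous_image K continuous_intros)
  then have m: "(\<lambda>x. t + \<alpha> * x) ` K \<in> sets borel"
    by (simp add: compact_imp_closed)
  have ind: "indicator ((\<lambda>x. t + \<alpha> * x) ` K) (t + \<alpha> * x) = (indicator K x :: ennreal)" for x
    using \<open>\<alpha> > 0\<close> by (auto simp: indicator_def)
  have "emeasure lborel ((\<lambda>x. t + \<alpha> * x) ` K) = (\<integral>\<^sup>+x. indicator ((\<lambda>x. t + \<alpha> * x) ` K) x \<partial>lborel)"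
    using m by simp
  also have "\<dots> = ennreal \<alpha> * (\<integral>\<^sup>+x. indicator K x \<partial>lborel)"
    using m \<open>\<alpha> > 0\<close> by (subst nn_integral_real_affine[where c=\<alpha> and t=t]) (auto simp: ind)
  finally show ?thesis using K by (simp add: compact_imp_closed)
qed

text \<open>Shift \<alpha>A by \<beta> times the lowest point of B and \<beta>B by \<alpha> times
  the highest point of A. Both copies lie in C and meet in at most one point, so their lengths add
  up.\<close>

lemma brunn_minkowski_real_compact:
  fixes A B C :: "real set"
  assumes A: "compact A" "A \<noteq> {}" and B: "compact B" "B \<noteq> {}" and C: "C \<in> sets borel"
    and pos: "\<alpha> > 0" "\<beta> > 0"
    and sub: "\<And>x y. x \<in> A \<Longrightarrow> y \<in> B \<Longrightarrow> \<alpha> * x + \<beta> * y \<in> C"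
  shows "ennreal \<alpha> * emeasure lborel A + ennreal \<beta> * emeasure lborel B \<le> emeasure lborel C"
proof -
  obtain a where a: "a \<in> A" "\<And>x. x \<in> A \<Longrightarrow> x \<le> a"
    using compact_attains_sup[OF A] by blast
  obtain b where b: "b \<in> B" "\<And>x. x \<in> B \<Longrightarrow> b \<le> x"
    using compact_attains_inf[OF B] by blast
  define S where "S = (\<lambda>x. \<beta> * b + \<alpha> * x) ` A"
  define T where "T = (\<lambda>y. \<alpha> * a + \<beta> * y) ` B"
  have m: "S \<in> sets borel" "T \<in> sets borel"
    unfolding S_def T_def
    by (auto intro!: borel_closed compact_imp_closed compact_continuous_image continuous_intros A B)
  have "S \<inter> T \<subseteq> {\<alpha> * a + \<beta> * b}"
  proof
    fix z assume "z \<in> S \<inter> T"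
    then obtain x y where z: "x \<in> A" "y \<in> B" "z = \<beta> * b + \<alpha> * x" "z = \<alpha> * a + \<beta> * y"
      by (auto simp: S_def T_def)
    have "\<alpha> * x \<le> \<alpha> * a" "\<beta> * b \<le> \<beta> * y" using a(2) b(2) z pos by auto
    then have "z = \<alpha> * a + \<beta> * b" using z by linarith
    then show "z \<in> {\<alpha> * a + \<beta> * b}" by simp
  qed
  then have "emeasure lborel (S \<inter> T) \<le> emeasure lborel {\<alpha> * a + \<beta> * b}"
    by (intro emeasure_mono) auto
  then have 0: "emeasure lborel (S \<inter> T) = 0" by simp
  have "emeasure lborel S + emeasure lborel T = emeasure lborel (S \<union> T) + emeasure lborel (S \<inter> T)"
    using m by (intro emeasure_Un_Int) auto
  also have "\<dots> \<le> emeasure lborel C"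
    using sub a(1) b(1) C unfolding 0 by (auto intro!: emeasure_mono simp: S_def T_def add.commute)
  finally show ?thesis
    unfolding S_def T_def using A B pos by (simp add: emeasure_lborel_image_affine)
qed

text \<open>The approximating sets are kept nonempty because the compact case of Brunn-Minkowski
  picks extreme points of both sets.\<close>

lemma emeasure_lborel_eq_SUP_compact:
  fixes A :: "'a::euclidean_space set"
  assumes "A \<in> sets borel" "A \<noteq> {}"
  shows "emeasure lborel A = (SUP K\<in>{K. K \<subseteq> A \<and> compact K \<and> K \<noteq> {}}. emeasure lborel K)"
proof (rule antisym)
  show "(SUP K\<in>{K. K \<subseteq> A \<and> compact K \<and> K \<noteq> {}}. emeasure lborel K) \<le> emeasure lborel A"
    using assms by (auto intro!: SUP_least emeasure_mono)
  show "emeasure lborel A \<le> (SUP K\<in>{K. K \<subseteq> A \<and> compact K \<and> K \<noteq> {}}. emeasure lborel K)"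
  proof (rule dense_le)
    fix c assume "c < emeasure lborel A"
    then obtain K where K: "K \<subseteq> A" "compact K" "c < emeasure lborel K"
      using emeasure_lborel_inner_compact[OF assms(1)] by blast
    then have "K \<noteq> {}" by auto
    then have "emeasure lborel K \<le> (SUP K\<in>{K. K \<subseteq> A \<and> compact K \<and> K \<noteq> {}}. emeasure lborel K)"
      using K by (intro SUP_upper) auto
    then show "c \<le> (SUP K\<in>{K. K \<subseteq> A \<and> compact K \<and> K \<noteq> {}}. emeasure lborel K)"
      using K by auto
  qed
qed

lemma brunn_minkowski_real:
  fixes A B C :: "real set"
  assumes A: "A \<in> sets borel" "A \<noteq> {}" and B: "B \<in> sets borel" "B \<noteq> {}" and C: "C \<in> sets borel"
    and pos: "\<alpha> > 0" "\<beta> > 0"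
    and sub: "\<And>x y. x \<in> A \<Longrightarrow> y \<in> B \<Longrightarrow> \<alpha> * x + \<beta> * y \<in> C"
  shows "ennreal \<alpha> * emeasure lborel A + ennreal \<beta> * emeasure lborel B \<le> emeasure lborel C"
proof -
  let ?K = "\<lambda>A::real set. {K. K \<subseteq> A \<and> compact K \<and> K \<noteq> {}}"
  have ne: "?K A \<noteq> {}" "?K B \<noteq> {}"
    using A(2) B(2) by (auto intro: exI[of _ "{_}"])
  have "ennreal \<alpha> * emeasure lborel A + ennreal \<beta> * emeasure lborel B
     = (SUP K\<in>?K A. ennreal \<alpha> * emeasure lborel K) + (SUP K\<in>?K B. ennreal \<beta> * emeasure lborel K)"
    by (simp add: emeasure_lborel_eq_SUP_compact[OF A] emeasure_lborel_eq_SUP_compact[OF B] SUP_mult_left_ennreal)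
  also have "\<dots> = (SUP K\<in>?K A. SUP L\<in>?K B. ennreal \<alpha> * emeasure lborel K + ennreal \<beta> * emeasure lborel L)"
    using ne by (subst ennreal_SUP_add_left[symmetric], simp, intro SUP_cong refl)
      (simp add: ennreal_SUP_add_right)
  also have "\<dots> \<le> emeasure lborel C"
    using sub by (intro SUP_least brunn_minkowski_real_compact C pos) auto
  finally show ?thesis .
qed

section \<open>The Prekopa-Leindler inequality, on the line and in finite products\<close>

lemma nn_integral_min_one_layer_cake:
  fixes f :: "'a \<Rightarrow> ennreal"
  assumes "sigma_finite_measure M" and [measurable]: "f \<in> borel_measurable M"
  shows "(\<integral>\<^sup>+x. min (f x) 1 \<partial>M)
    = (\<integral>\<^sup>+s. indicator {0<..<1} s * emeasure M {x \<in> space M. ennreal s < f x} \<partial>lborel)"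
proof -
  interpret sigma_finite_measure M by fact
  interpret pair_sigma_finite M lborel ..
  \<comment> \<open>The truncated value is the length of the interval from 0 to it. Cutting at 1
    leaves only levels s < 1, at which a function with supremum 1 has a nonempty superlevel
    set.\<close>
  have *: "min (f x) 1 = (\<integral>\<^sup>+s. indicator {0<..<1} s * indicator {x\<in>space M. ennreal s < f x} x \<partial>lborel)"
    (is "_ = ?I") if x: "x \<in> space M" for x
  proof -
    have "min (f x) 1 \<noteq> top" by (auto simp: min_def top_unique)
    then obtain r where r: "min (f x) 1 = ennreal r" "r \<ge> 0"
      by (metis ennreal_cases top_neq_ennreal)
    have "?I = (\<integral>\<^sup>+s. indicator {0<..<r} s \<partial>lborel)"
    proof (intro nn_integral_cong)
      fix s :: real
      have "(s \<in> {0<..<1} \<and> ennreal s < f x) \<longleftrightarrow> s \<in> {0<..<r}" if "s > 0"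
      proof -
        have "s \<in> {0<..<r} \<longleftrightarrow> ennreal s < min (f x) 1"
          using that r by (simp add: ennreal_less_iff)
        also have "\<dots> \<longleftrightarrow> ennreal s < f x \<and> s < 1"
          using that by (auto simp: ennreal_less_iff simp flip: ennreal_1)
        finally show ?thesis using that by auto
      qed
      then show "(indicator {0<..<1} s * indicator {x\<in>space M. ennreal s < f x} x :: ennreal)
          = indicator {0<..<r} s"
        using x by (auto simp: indicator_def)
    qed
    also have "\<dots> = min (f x) 1"
      using r by simp
    finally show ?thesis by simp
  qed
  have "(\<integral>\<^sup>+x. min (f x) 1 \<partial>M)
     = (\<integral>\<^sup>+x. \<integral>\<^sup>+s. indicator {0<..<1} s * indicator {x\<in>space M. ennreal s < f x} x \<partial>lborel \<partial>M)"
    by (intro nn_integral_cong *)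
  also have "\<dots> = (\<integral>\<^sup>+s. \<integral>\<^sup>+x. indicator {0<..<1} s * indicator {x\<in>space M. ennreal s < f x} x \<partial>M \<partial>lborel)"
    by (rule Fubini'[symmetric]) measurable
  also have "\<dots> = (\<integral>\<^sup>+s. indicator {0<..<1} s * emeasure M {x \<in> space M. ennreal s < f x} \<partial>lborel)"
    by (intro nn_integral_cong) (simp add: nn_integral_cmult)
  finally show ?thesis .
qed

lemma weighted_amgm_nat:
  fixes x y :: real
  assumes "x \<ge> 0" "y \<ge> 0" "m > 0" "k > 0"
  shows "x ^ m * y ^ k \<le> ((m * x + k * y) / (m + k)) ^ (m + k)"
proof (cases "x = 0 \<or> y = 0")
  case True
  then have "x ^ m * y ^ k = 0" using assms by auto
  moreover have "((m * x + k * y) / (real m + real k)) ^ (m + k) \<ge> 0" using assms by simp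
  ultimately show ?thesis by linarith
next
  case False
  then have pos: "x > 0" "y > 0" using assms by auto
  define \<alpha> where "\<alpha> = real m / (m + k)"
  define \<beta> where "\<beta> = real k / (m + k)"
  have ab: "\<alpha> \<ge> 0" "\<beta> \<ge> 0" "\<alpha> + \<beta> = 1"
    using assms by (auto simp: \<alpha>_def \<beta>_def add_divide_distrib[symmetric])
  have "x powr \<alpha> * y powr \<beta> \<le> \<alpha> * x + \<beta> * y"
    by (rule Youngs_inequality_0) (use ab pos in auto)
  then have "(x powr \<alpha> * y powr \<beta>) ^ (m + k) \<le> (\<alpha> * x + \<beta> * y) ^ (m + k)"
    by (intro power_mono) auto
  moreover have "(x powr \<alpha> * y powr \<beta>) ^ (m + k) = x ^ m * y ^ k"
    using assms pos by (simp add: power_mult_distrib powr_power \<alpha>_def \<beta>_def powr_realpow)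
  moreover have "\<alpha> * x + \<beta> * y = (m * x + k * y) / (m + k)"
    by (simp add: \<alpha>_def \<beta>_def add_divide_distrib)
  ultimately show ?thesis by simp
qed

text \<open>If one argument is infinite, so is the right side, because both weights are positive;
  the left side may then be a product of 0 and infinity.\<close>

lemma weighted_amgm_ennreal:
  fixes x y :: ennreal
  assumes "m > 0" "k > 0" "\<alpha> = real m / real (m + k)" "\<beta> = real k / real (m + k)"
  shows "x ^ m * y ^ k \<le> (ennreal \<alpha> * x + ennreal \<beta> * y) ^ (m + k)"
proof -
  have pos: "\<alpha> > 0" "\<beta> > 0" using assms by auto
  consider "x = top \<or> y = top" | r s where "x = ennreal r" "r \<ge> 0" "y = ennreal s" "s \<ge> 0"
    by (metis ennreal_cases)
  then show ?thesis
  proof cases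
    case 1
    then have "ennreal \<alpha> * x + ennreal \<beta> * y = top"
      using pos by (auto simp: ennreal_mult_top)
    then show ?thesis using assms(1) by (simp only: power_top_ennreal[of "m + k"] add_gr_0 simp_thms top_greatest)
  next
    case 2
    have "ennreal \<alpha> * x + ennreal \<beta> * y = ennreal (\<alpha> * r + \<beta> * s)"
      using 2 pos by (simp add: ennreal_mult'' ennreal_plus)
    moreover have "r ^ m * s ^ k \<le> (\<alpha> * r + \<beta> * s) ^ (m + k)"
      using weighted_amgm_nat[of r s m k] 2 assms by (simp add: add_divide_distrib)
    moreover have "x ^ m * y ^ k = ennreal (r ^ m * s ^ k)"
      using 2 by (simp add: ennreal_power ennreal_mult'')
    ultimately show ?thesis
      using 2 pos by (simp only: ennreal_power ennreal_leI add_nonneg_nonneg mult_nonneg_nonneg less_imp_le)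
  qed
qed

text \<open>Normalise f and g to supremum 1. At each level s < 1 their superlevel sets are then
  nonempty and combine into that of the normalised h, so one-dimensional Brunn-Minkowski applies;
  without the normalisation one of the sets could be empty. Integration over s gives a bound by the
  weighted sum of the integrals, and the weighted arithmetic-geometric mean inequality passes to the
  product. Boundedness makes the suprema finite.\<close>

lemma prekopa_leindler_real_bounded:
  fixes f g h :: "real \<Rightarrow> ennreal"
  assumes [measurable]: "f \<in> borel_measurable borel" "g \<in> borel_measurable borel" "h \<in> borel_measurable borel"
    and mk: "m > 0" "k > 0"
    and ab: "\<alpha> = real m / real (m + k)" "\<beta> = real k / real (m + k)"
    and bd: "\<And>x. f x \<le> ennreal N" "\<And>x. g x \<le> ennreal N"
    and le: "\<And>x y. f x ^ m * g y ^ k \<le> h (\<alpha> * x + \<beta> * y) ^ (m + k)"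
  shows "(\<integral>\<^sup>+x. f x \<partial>lborel) ^ m * (\<integral>\<^sup>+x. g x \<partial>lborel) ^ k \<le> (\<integral>\<^sup>+x. h x \<partial>lborel) ^ (m + k)"
proof (cases "(SUP x. f x) = 0 \<or> (SUP x. g x) = 0")
  case True
  then have "(\<forall>x. f x = 0) \<or> (\<forall>x. g x = 0)"
    by (simp add: SUP_eq_iff[of UNIV] bot_ennreal[symmetric] SUP_bot_conv)
  then show ?thesis using mk by (auto simp: zero_power)
next
  case False
  have pos: "\<alpha> > 0" "\<beta> > 0" using ab mk by auto
  have le_N: "(SUP x. f x) \<le> ennreal N" "(SUP x. g x) \<le> ennreal N"
    using bd by (auto intro: SUP_least)
  then obtain a b where a: "(SUP x. f x) = ennreal a" "a \<ge> 0" and b: "(SUP x. g x) = ennreal b" "b \<ge> 0"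
    by (metis ennreal_cases ennreal_less_top leD)
  have a0: "a > 0" and b0: "b > 0" using False a b by (auto simp: less_le)
  \<comment> \<open>The divisor of h is the weighted geometric mean of those of f and g, so the
    pointwise hypothesis survives the normalisation.\<close>
  define c where "c = root (m + k) (a ^ m * b ^ k)"
  have c0: "c > 0" and cp: "c ^ (m + k) = a ^ m * b ^ k"
    using a0 b0 mk by (auto simp: c_def)
  let ?f = "\<lambda>x. f x / ennreal a" and ?g = "\<lambda>x. g x / ennreal b" and ?h = "\<lambda>x. h x / ennreal c"
  let ?A = "\<lambda>s. {x \<in> space lborel. ennreal s < ?f x}" and ?B = "\<lambda>s. {x \<in> space lborel. ennreal s < ?g x}"
    and ?C = "\<lambda>s. {x \<in> space lborel. ennreal s < ?h x}"
  have less_div: "ennreal s < t / ennreal r \<longleftrightarrow> ennreal (s * r) < t" if "s \<ge> 0" "r > 0" for s r t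
  proof (cases t)
    case (real u)
    then show ?thesis using that
      by (simp add: divide_ennreal ennreal_less_iff pos_less_divide_eq)
  next
    case top
    then show ?thesis using that by (simp add: ennreal_top_divide)
  qed
  have f1: "?f x \<le> 1" for x
    using a0 SUP_upper[of x UNIV f] unfolding a(1)
    by (intro divide_le_posI_ennreal) auto
  have g1: "?g x \<le> 1" for x
    using b0 SUP_upper[of x UNIV g] unfolding b(1)
    by (intro divide_le_posI_ennreal) auto
  have level: "ennreal \<alpha> * emeasure lborel (?A s) + ennreal \<beta> * emeasure lborel (?B s) \<le> emeasure lborel (?C s)"
    if s: "0 < s" "s < 1" for s
  proof (rule brunn_minkowski_real)
    show "?A s \<in> sets borel" "?B s \<in> sets borel" "?C s \<in> sets borel" by measurable
    have "ennreal (s * a) < (SUP x. f x)" using a s a0 by (simp add: ennreal_less_iff)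
    then obtain x where "ennreal (s * a) < f x" using less_SUP_iff[of _ f UNIV] by auto
    then show "?A s \<noteq> {}" using less_div s a0 by auto
    have "ennreal (s * b) < (SUP x. g x)" using b s b0 by (simp add: ennreal_less_iff)
    then obtain x where "ennreal (s * b) < g x" using less_SUP_iff[of _ g UNIV] by auto
    then show "?B s \<noteq> {}" using less_div s b0 by auto
    fix x y assume "x \<in> ?A s" "y \<in> ?B s"
    then have x: "ennreal (s * a) < f x" and y: "ennreal (s * b) < g y"
      using less_div s a0 b0 by auto
    have "ennreal (s * c) < h (\<alpha> * x + \<beta> * y)"
    proof (cases "h (\<alpha> * x + \<beta> * y)")
      case (real H)
      obtain F G where F: "f x = ennreal F" "F \<ge> 0" and G: "g y = ennreal G" "G \<ge> 0"
        using bd by (metis ennreal_cases ennreal_less_top leD)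
      have less: "s * a < F" "s * b < G" using x y F G s a0 b0 by (auto simp: ennreal_less_iff)
      moreover have "0 < s * a" "0 < s * b" using s a0 b0 by auto
      ultimately have FG: "0 < F" "0 < G" by linarith+
      have "(s * c) ^ (m + k) = (s * a) ^ m * (s * b) ^ k"
        using cp by (simp add: power_mult_distrib power_add mult_ac)
      also have "\<dots> < F ^ m * G ^ k"
        using less FG s a0 b0 mk by (intro mult_strict_mono power_strict_mono) auto
      also have "\<dots> \<le> H ^ (m + k)"
        using le[of x y] real F G by (simp add: ennreal_power flip: ennreal_mult'')
      finally have "s * c < H" using real by (meson power_less_imp_less_base)
      then show ?thesis using real s c0 by (simp add: ennreal_less_iff)
    qed simp
    then show "\<alpha> * x + \<beta> * y \<in> ?C s" using less_div s c0 by auto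
  qed (use pos in auto)
  have sf: "sigma_finite_measure (lborel :: real measure)" ..
  have lf: "(\<integral>\<^sup>+x. ?f x \<partial>lborel) = (\<integral>\<^sup>+s. indicator {0<..<1} s * emeasure lborel (?A s) \<partial>lborel)"
    using nn_integral_min_one_layer_cake[OF sf, of ?f] f1 by (simp add: min_absorb1)
  have lg: "(\<integral>\<^sup>+x. ?g x \<partial>lborel) = (\<integral>\<^sup>+s. indicator {0<..<1} s * emeasure lborel (?B s) \<partial>lborel)"
    using nn_integral_min_one_layer_cake[OF sf, of ?g] g1 by (simp add: min_absorb1)
  have mA: "(\<lambda>s. emeasure lborel (?A s)) \<in> borel_measurable lborel"
    "(\<lambda>s. emeasure lborel (?B s)) \<in> borel_measurable lborel"
    by measurable
  note [measurable] = mA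
  have "ennreal \<alpha> * (\<integral>\<^sup>+x. ?f x \<partial>lborel) + ennreal \<beta> * (\<integral>\<^sup>+x. ?g x \<partial>lborel)
     = (\<integral>\<^sup>+s. ennreal \<alpha> * (indicator {0<..<1} s * emeasure lborel (?A s))
           + ennreal \<beta> * (indicator {0<..<1} s * emeasure lborel (?B s)) \<partial>lborel)"
    unfolding lf lg by (subst nn_integral_add) (auto simp: nn_integral_cmult)
  also have "\<dots> \<le> (\<integral>\<^sup>+s. indicator {0<..<1} s * emeasure lborel (?C s) \<partial>lborel)"
    using level by (intro nn_integral_mono) (auto simp: indicator_def)
  also have "\<dots> = (\<integral>\<^sup>+x. min (?h x) 1 \<partial>lborel)"
    by (subst nn_integral_min_one_layer_cake[OF sf]) auto
  also have "\<dots> \<le> (\<integral>\<^sup>+x. ?h x \<partial>lborel)"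
    by (intro nn_integral_mono) auto
  finally have *: "ennreal \<alpha> * (\<integral>\<^sup>+x. ?f x \<partial>lborel) + ennreal \<beta> * (\<integral>\<^sup>+x. ?g x \<partial>lborel) \<le> (\<integral>\<^sup>+x. ?h x \<partial>lborel)" .
  have scale: "(\<integral>\<^sup>+x. q x \<partial>lborel) = ennreal r * (\<integral>\<^sup>+x. q x / ennreal r \<partial>lborel)"
    if "r > 0" "q \<in> borel_measurable borel" for r and q :: "real \<Rightarrow> ennreal"
  proof -
    have "ennreal r * (t / ennreal r) = t" for t
      using that(1) by (simp add: ennreal_times_divide ennreal_mult_divide_eq mult.commute)
    then show ?thesis
      using that(2) by (subst nn_integral_cmult[symmetric]) auto
  qed
  have "(\<integral>\<^sup>+x. f x \<partial>lborel) ^ m * (\<integral>\<^sup>+x. g x \<partial>lborel) ^ k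
     = (ennreal a ^ m * ennreal b ^ k) * ((\<integral>\<^sup>+x. ?f x \<partial>lborel) ^ m * (\<integral>\<^sup>+x. ?g x \<partial>lborel) ^ k)"
    using scale[of a f] scale[of b g] a0 b0 by (simp add: power_mult_distrib mult_ac)
  also have "\<dots> = ennreal c ^ (m + k) * ((\<integral>\<^sup>+x. ?f x \<partial>lborel) ^ m * (\<integral>\<^sup>+x. ?g x \<partial>lborel) ^ k)"
    using a0 b0 c0 cp by (simp add: ennreal_power flip: ennreal_mult'')
  also have "\<dots> \<le> ennreal c ^ (m + k) * (\<integral>\<^sup>+x. ?h x \<partial>lborel) ^ (m + k)"
    using order.trans[OF weighted_amgm_ennreal[OF mk ab] power_mono[OF *]]
    by (intro mult_left_mono) auto
  also have "\<dots> = (\<integral>\<^sup>+x. h x \<partial>lborel) ^ (m + k)"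
    using scale[of c h] c0 by (simp add: power_mult_distrib)
  finally show ?thesis .
qed

lemma tendsto_power_ennreal:
  fixes f :: "'b \<Rightarrow> ennreal"
  assumes "(f \<longlongrightarrow> a) F"
  shows "((\<lambda>x. f x ^ m) \<longlongrightarrow> a ^ m) F"
proof (induction m)
  case (Suc m)
  then show ?case
    using assms by (auto intro!: tendsto_mult_ennreal simp: power_eq_top_ennreal)
qed simp

lemma prekopa_leindler_real:
  fixes f g h :: "real \<Rightarrow> ennreal"
  assumes [measurable]: "f \<in> borel_measurable borel" "g \<in> borel_measurable borel" "h \<in> borel_measurable borel"
    and mk: "m > 0" "k > 0"
    and ab: "\<alpha> = real m / real (m + k)" "\<beta> = real k / real (m + k)"
    and le: "\<And>x y. f x ^ m * g y ^ k \<le> h (\<alpha> * x + \<beta> * y) ^ (m + k)"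
  shows "(\<integral>\<^sup>+x. f x \<partial>lborel) ^ m * (\<integral>\<^sup>+x. g x \<partial>lborel) ^ k \<le> (\<integral>\<^sup>+x. h x \<partial>lborel) ^ (m + k)"
proof -
  let ?t = "\<lambda>q (N::nat) x. min (q x) (of_nat N) :: ennreal"
  let ?I = "\<lambda>q N. \<integral>\<^sup>+x. ?t q N x \<partial>lborel"
  have conv: "(\<lambda>N. \<integral>\<^sup>+x. ?t q N x \<partial>lborel) \<longlonglongrightarrow> (\<integral>\<^sup>+x. q x \<partial>lborel)"
    if [measurable]: "q \<in> borel_measurable borel" for q :: "real \<Rightarrow> ennreal"
  proof (rule nn_integral_LIMSEQ)
    show "incseq (?t q)"
      by (auto simp: incseq_def le_fun_def intro: min.coboundedI2 min.mono)
    show "(\<lambda>N. ?t q N x) \<longlonglongrightarrow> q x" for x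
    proof -
      have "(\<lambda>N. min (q x) (of_nat N)) \<longlonglongrightarrow> min (q x) top"
        by (intro tendsto_min tendsto_const of_nat_tendsto_top_ennreal)
      then show ?thesis by simp
    qed
  qed measurable
  have "(\<integral>\<^sup>+x. ?t f N x \<partial>lborel) ^ m * (\<integral>\<^sup>+x. ?t g N x \<partial>lborel) ^ k \<le> (\<integral>\<^sup>+x. h x \<partial>lborel) ^ (m + k)" for N
  proof (rule prekopa_leindler_real_bounded[where N="real N", OF _ _ _ mk ab])
    show "?t f N x ^ m * ?t g N y ^ k \<le> h (\<alpha> * x + \<beta> * y) ^ (m + k)" for x y
      by (rule order.trans[OF _ le[of x y]]) (intro mult_mono power_mono, auto)
  qed (auto simp: ennreal_of_nat_eq_real_of_nat)
  then have le': "?I f N ^ m * ?I g N ^ k \<le> (\<integral>\<^sup>+x. h x \<partial>lborel) ^ (m + k)" for N by simp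
  \<comment> \<open>A vanishing integral is treated apart: multiplication of extended reals is not
    continuous where 0 meets infinity.\<close>
  show ?thesis
  proof (cases "(\<integral>\<^sup>+x. f x \<partial>lborel) = 0 \<or> (\<integral>\<^sup>+x. g x \<partial>lborel) = 0")
    case True
    then show ?thesis using mk by (auto simp: zero_power)
  next
    case False
    have "(\<lambda>N. ?I f N ^ m * ?I g N ^ k)
       \<longlonglongrightarrow> (\<integral>\<^sup>+x. f x \<partial>lborel) ^ m * (\<integral>\<^sup>+x. g x \<partial>lborel) ^ k"
      using False by (intro tendsto_mult_ennreal tendsto_power_ennreal conv) auto
    then show ?thesis by (rule LIMSEQ_le_const2) (use le' in auto)
  qed
qed

text \<open>The hypothesis reproduces itself under partial integration: the one-dimensional
  inequality in the new coordinate i says exactly that the integrals over i satisfy it on I. Only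
  extensional arguments are considered, since they are the points of the product space.\<close>

lemma prekopa_leindler_PiM:
  fixes f g h :: "('i \<Rightarrow> real) \<Rightarrow> ennreal"
  assumes "finite I"
    and "f \<in> borel_measurable (\<Pi>\<^sub>M i\<in>I. lborel)" "g \<in> borel_measurable (\<Pi>\<^sub>M i\<in>I. lborel)"
      "h \<in> borel_measurable (\<Pi>\<^sub>M i\<in>I. lborel)"
    and mk: "m > 0" "k > 0"
    and ab: "\<alpha> = real m / real (m + k)" "\<beta> = real k / real (m + k)"
    and "\<And>x y. x \<in> extensional I \<Longrightarrow> y \<in> extensional I \<Longrightarrow>
           f x ^ m * g y ^ k \<le> h (\<lambda>i\<in>I. \<alpha> * x i + \<beta> * y i) ^ (m + k)"
  shows "(\<integral>\<^sup>+x. f x \<partial>(\<Pi>\<^sub>M i\<in>I. lborel)) ^ m * (\<integral>\<^sup>+x. g x \<partial>(\<Pi>\<^sub>M i\<in>I. lborel)) ^ k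
     \<le> (\<integral>\<^sup>+x. h x \<partial>(\<Pi>\<^sub>M i\<in>I. lborel)) ^ (m + k)"
  using assms(1-4,9)
proof (induction I arbitrary: f g h rule: finite_induct)
  case empty
  have "f (\<lambda>_. undefined) ^ m * g (\<lambda>_. undefined) ^ k \<le> h (\<lambda>i\<in>{}. \<alpha> * undefined + \<beta> * undefined) ^ (m + k)"
    by (rule empty.prems(4)) (auto simp: extensional_def)
  then show ?case
    by (simp add: PiM_empty nn_integral_count_space_finite restrict_def)
next
  case (insert i I)
  interpret product_sigma_finite "\<lambda>_::'i. lborel :: real measure" ..
  note [measurable] = insert.prems(1-3)
  have sect: "(\<lambda>t. q (x(i := t))) \<in> borel_measurable borel"
    if q: "q \<in> borel_measurable (\<Pi>\<^sub>M i\<in>insert i I. lborel)" and "x \<in> extensional I" for q :: "('i \<Rightarrow> real) \<Rightarrow> ennreal" and x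
  proof -
    have "x \<in> space (\<Pi>\<^sub>M i\<in>I. lborel)" using that by (auto simp: space_PiM PiE_def)
    then have "(\<lambda>t. x(i := t)) \<in> measurable lborel (\<Pi>\<^sub>M i\<in>insert i I. lborel)"
      using insert.hyps by (intro measurable_fun_upd[where J=I]) auto
    from measurable_compose[OF this q] show ?thesis by simp
  qed
  have outer: "(\<lambda>x. \<integral>\<^sup>+t. q (x(i := t)) \<partial>lborel) \<in> borel_measurable (\<Pi>\<^sub>M i\<in>I. lborel)"
    if q[measurable]: "q \<in> borel_measurable (\<Pi>\<^sub>M i\<in>insert i I. lborel)" for q :: "('i \<Rightarrow> real) \<Rightarrow> ennreal"
    by measurable
  have step: "(\<integral>\<^sup>+t. f (x(i := t)) \<partial>lborel) ^ m * (\<integral>\<^sup>+t. g (y(i := t)) \<partial>lborel) ^ k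
     \<le> (\<integral>\<^sup>+t. h ((\<lambda>j\<in>I. \<alpha> * x j + \<beta> * y j)(i := t)) \<partial>lborel) ^ (m + k)"
    if xy: "x \<in> extensional I" "y \<in> extensional I" for x y
  proof (rule prekopa_leindler_real[OF _ _ _ mk ab])
    fix s t
    have "(\<lambda>j\<in>I. \<alpha> * x j + \<beta> * y j)(i := \<alpha> * s + \<beta> * t)
        = (\<lambda>j\<in>insert i I. \<alpha> * (x(i := s)) j + \<beta> * (y(i := t)) j)"
      using insert.hyps by (auto simp: fun_eq_iff)
    moreover have "x(i := s) \<in> extensional (insert i I)" "y(i := t) \<in> extensional (insert i I)"
      using xy by (auto simp: extensional_def)
    ultimately show "f (x(i := s)) ^ m * g (y(i := t)) ^ k
       \<le> h ((\<lambda>j\<in>I. \<alpha> * x j + \<beta> * y j)(i := \<alpha> * s + \<beta> * t)) ^ (m + k)"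
      using insert.prems(4)[of "x(i := s)" "y(i := t)"] by (simp only:)
  qed (use xy sect insert.prems in auto)
  show ?case
    unfolding product_nn_integral_insert[OF insert.hyps insert.prems(1)]
      product_nn_integral_insert[OF insert.hyps insert.prems(2)]
      product_nn_integral_insert[OF insert.hyps insert.prems(3)]
    by (rule insert.IH[OF outer[OF insert.prems(1)] outer[OF insert.prems(2)] outer[OF insert.prems(3)] step])
qed

text \<open>Prekopa-Leindler for indicator functions, in coordinates. This is the multiplicative
  form; the dimension enters only when the sets are rescaled.\<close>

lemma brunn_minkowski_powers:
  fixes A B C :: "'a::euclidean_space set"
  assumes [measurable]: "A \<in> sets borel" "B \<in> sets borel" "C \<in> sets borel"
    and mk: "m > 0" "k > 0"
    and ab: "\<alpha> = real m / real (m + k)" "\<beta> = real k / real (m + k)"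
    and sub: "\<And>x y. x \<in> A \<Longrightarrow> y \<in> B \<Longrightarrow> \<alpha> *\<^sub>R x + \<beta> *\<^sub>R y \<in> C"
  shows "emeasure lborel A ^ m * emeasure lborel B ^ k \<le> emeasure lborel C ^ (m + k)"
proof -
  let ?P = "\<Pi>\<^sub>M b\<in>(Basis::'a set). (lborel::real measure)"
  let ?T = "\<lambda>f. \<Sum>b\<in>Basis. f b *\<^sub>R b :: 'a"
  have T[measurable]: "?T \<in> measurable ?P borel" by measurable
  have e: "emeasure lborel X = (\<integral>\<^sup>+f. indicator X (?T f) \<partial>?P)" if [measurable]: "X \<in> sets borel" for X :: "'a set"
  proof -
    have "emeasure lborel X = (\<integral>\<^sup>+x. indicator X x \<partial>lborel)" by simp
    also have "\<dots> = (\<integral>\<^sup>+f. indicator X (?T f) \<partial>?P)"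
      by (subst lborel_eq, subst nn_integral_distr) auto
    finally show ?thesis .
  qed
  show ?thesis
    unfolding e[OF assms(1)] e[OF assms(2)] e[OF assms(3)]
  proof (rule prekopa_leindler_PiM[OF _ _ _ _ mk ab])
    fix x y :: "'a \<Rightarrow> real"
    have "?T (\<lambda>i\<in>Basis. \<alpha> * x i + \<beta> * y i) = \<alpha> *\<^sub>R ?T x + \<beta> *\<^sub>R ?T y"
      by (simp add: scaleR_add_left sum.distrib scaleR_sum_right)
    then show "indicator A (?T x) ^ m * indicator B (?T y) ^ k
       \<le> (indicator C (?T (\<lambda>i\<in>Basis. \<alpha> * x i + \<beta> * y i)) :: ennreal) ^ (m + k)"
      using sub mk by (auto simp: indicator_def zero_power)
  qed auto
qed

section \<open>Brunn-Minkowski for a set and a ball\<close>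

lemma emeasure_lborel_scaleR_vimage:
  fixes A :: "'a::euclidean_space set"
  assumes [measurable]: "A \<in> sets borel" and "c > 0"
  shows "emeasure lborel A = ennreal (c ^ DIM('a)) * emeasure lborel ((\<lambda>x. c *\<^sub>R x) -` A)"
proof -
  have "emeasure lborel A = emeasure (density (distr lborel borel (\<lambda>x. 0 + c *\<^sub>R x)) (\<lambda>_. \<bar>c\<bar> ^ DIM('a))) A"
    using \<open>c > 0\<close> lborel_affine[of c "0::'a"] by simp
  also have "\<dots> = ennreal (c ^ DIM('a)) * emeasure lborel ((\<lambda>x. c *\<^sub>R x) -` A)"
    using \<open>c > 0\<close> by (simp add: emeasure_density nn_integral_cmult emeasure_distr)
  finally show ?thesis .
qed

lemma emeasure_lborel_ball_unit_vol:
  fixes x :: "'a::euclidean_space"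
  assumes "r \<ge> 0"
  shows "emeasure lborel (ball x r) = ennreal (unit_ball_vol (real DIM('a)) * r ^ DIM('a))"
  using emeasure_ball[OF assms, of x] by simp

text \<open>The multiplicative form is applied to A/\<alpha> and the ball of radius r = a + a k/m.
  As \<alpha> r = a and \<beta> r = a k/m, both have volume at least that of a ball of radius r, and
  scaling them back gives A and a ball of radius a k/m. This choice already yields the sharp
  bound.\<close>

lemma brunn_minkowski_ball_rational:
  fixes A C :: "'a::euclidean_space set"
  assumes A[measurable]: "A \<in> sets borel" and C[measurable]: "C \<in> sets borel"
    and a: "a > 0" "ennreal (unit_ball_vol (real DIM('a)) * a ^ DIM('a)) \<le> emeasure lborel A"
    and mk: "m > 0" "k > 0"
    and sub: "\<And>x y. x \<in> A \<Longrightarrow> norm y < a * real k / real m \<Longrightarrow> x + y \<in> C"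
  shows "ennreal (unit_ball_vol (real DIM('a)) * (a + a * real k / real m) ^ DIM('a)) \<le> emeasure lborel C"
proof -
  let ?w = "unit_ball_vol (real DIM('a))"
  define \<alpha> where "\<alpha> = real m / real (m + k)"
  define \<beta> where "\<beta> = real k / real (m + k)"
  define r where "r = a + a * real k / real m"
  have pos: "\<alpha> > 0" "\<beta> > 0" "r > 0" using mk a by (auto simp: \<alpha>_def \<beta>_def r_def intro!: add_pos_pos)
  have r: "\<alpha> * r = a" "\<beta> * r = a * real k / real m"
  proof -
    have "r = a * real (m + k) / real m" using mk by (simp add: r_def field_simps)
    moreover have "real (m + k) > 0" "real m > 0" using mk by auto
    ultimately show "\<alpha> * r = a" "\<beta> * r = a * real k / real m"
      by (auto simp: \<alpha>_def \<beta>_def simp del: of_nat_add)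
  qed
  have "?w * a ^ DIM('a) = \<alpha> ^ DIM('a) * (?w * r ^ DIM('a))"
    by (simp add: mult_ac flip: r(1) power_mult_distrib)
  then have "ennreal (\<alpha> ^ DIM('a)) * ennreal (?w * r ^ DIM('a)) = ennreal (?w * a ^ DIM('a))"
    using pos by (simp only: ennreal_mult' zero_le_power less_imp_le)
  then have "ennreal (\<alpha> ^ DIM('a)) * ennreal (?w * r ^ DIM('a))
     \<le> ennreal (\<alpha> ^ DIM('a)) * emeasure lborel ((\<lambda>x. \<alpha> *\<^sub>R x) -` A)"
    using a(2) emeasure_lborel_scaleR_vimage[OF A pos(1)] by simp
  then have vA: "ennreal (?w * r ^ DIM('a)) \<le> emeasure lborel ((\<lambda>x. \<alpha> *\<^sub>R x) -` A)"
    using pos by (subst (asm) ennreal_mult_le_mult_iff) auto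
  have "emeasure lborel ((\<lambda>x. \<alpha> *\<^sub>R x) -` A) ^ m * emeasure lborel (ball (0::'a) r) ^ k
      \<le> emeasure lborel C ^ (m + k)"
  proof (rule brunn_minkowski_powers[OF _ _ C mk \<alpha>_def \<beta>_def])
    have "(\<lambda>x::'a. \<alpha> *\<^sub>R x) \<in> borel_measurable borel"
      by (intro borel_measurable_continuous_onI continuous_intros)
    from measurable_sets[OF this A] show "(\<lambda>x. \<alpha> *\<^sub>R x) -` A \<in> sets borel" by simp
    fix x y assume "x \<in> (\<lambda>x. \<alpha> *\<^sub>R x) -` A" "y \<in> ball (0::'a) r"
    then show "\<alpha> *\<^sub>R x + \<beta> *\<^sub>R y \<in> C"
      using sub[of "\<alpha> *\<^sub>R x" "\<beta> *\<^sub>R y"] pos r(2) mult_strict_left_mono[of "norm y" r \<beta>] by simp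
  qed simp
  moreover have "ennreal (?w * r ^ DIM('a)) ^ (m + k)
      \<le> emeasure lborel ((\<lambda>x. \<alpha> *\<^sub>R x) -` A) ^ m * emeasure lborel (ball (0::'a) r) ^ k"
    unfolding power_add using vA pos
    by (intro mult_mono power_mono) (auto simp: emeasure_lborel_ball_unit_vol)
  ultimately have le: "ennreal (?w * r ^ DIM('a)) ^ (m + k) \<le> emeasure lborel C ^ (m + k)"
    by (rule order.trans[rotated])
  show ?thesis
  proof (cases "emeasure lborel C")
    case (real c)
    have "(?w * r ^ DIM('a)) ^ (m + k) \<le> c ^ (m + k)"
      using le real pos by (simp add: ennreal_power)
    then have "?w * r ^ DIM('a) \<le> c"
      using power_le_imp_le_base[of "?w * r ^ DIM('a)" "m + k - 1" c] real mk by simp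
    then show ?thesis using real by (simp add: r_def ennreal_leI)
  qed simp
qed

lemma brunn_minkowski_ball:
  fixes A C :: "'a::euclidean_space set"
  assumes A: "A \<in> sets borel" and C: "C \<in> sets borel"
    and a: "a > 0" "ennreal (unit_ball_vol (real DIM('a)) * a ^ DIM('a)) \<le> emeasure lborel A"
    and e: "e > 0"
    and sub: "\<And>x y. x \<in> A \<Longrightarrow> norm y < e \<Longrightarrow> x + y \<in> C"
  shows "ennreal (unit_ball_vol (real DIM('a)) * (a + e) ^ DIM('a)) \<le> emeasure lborel C"
proof -
  let ?w = "unit_ball_vol (real DIM('a))"
  have below: "ennreal (?w * (a + d) ^ DIM('a)) \<le> emeasure lborel C" if d: "0 < d" "d < e" for d
  proof -
    have "d / a < e / a" using d a by (simp add: divide_strict_right_mono)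
    \<comment> \<open>The ratio of the two exponents is the ratio of the radii, so radii a and d are
      reached through a rational number slightly above d / a. Letting d tend to e removes the
      restriction.\<close>
    then obtain q where q: "q \<in> \<rat>" "d / a < q" "q < e / a" using Rats_dense_in_real by blast
    have "q > 0" using q d a by (smt (verit) divide_pos_pos)
    with q(1) obtain k m where km: "m \<noteq> 0" "\<bar>q\<bar> = real k / real m"
      by (metis Rats_abs_nat_div_natE)
    then have qe: "q = real k / real m" using \<open>q > 0\<close> by simp
    with \<open>q > 0\<close> have "k > 0" "m > 0" using km by (auto intro: Nat.gr0I)
    have aq: "a * real k / real m = a * q" by (simp add: qe)
    have lt: "d < a * q" "a * q < e" using q a by (auto simp: field_simps)
    have "ennreal (?w * (a + a * real k / real m) ^ DIM('a)) \<le> emeasure lborel C"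
      by (rule brunn_minkowski_ball_rational[OF A C a \<open>m > 0\<close> \<open>k > 0\<close>]) (use sub lt aq in auto)
    moreover have "?w * (a + d) ^ DIM('a) \<le> ?w * (a + a * q) ^ DIM('a)"
      using lt d a by (intro mult_left_mono power_mono) auto
    ultimately show ?thesis using aq by (metis ennreal_leI order.trans)
  qed
  show ?thesis
  proof (cases "emeasure lborel C")
    case (real c)
    have "((\<lambda>d. ?w * (a + d) ^ DIM('a)) \<longlongrightarrow> ?w * (a + e) ^ DIM('a)) (at_left e)"
      by (intro tendsto_intros)
    moreover have "eventually (\<lambda>d. ?w * (a + d) ^ DIM('a) \<le> c) (at_left e)"
      using eventually_at_left_real[OF e] by eventually_elim (use below real in auto)
    ultimately have "?w * (a + e) ^ DIM('a) \<le> c"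
      by (rule tendsto_upperbound) simp
    then show ?thesis using real by (simp add: ennreal_leI)
  qed simp
qed

section \<open>The sharp isoperimetric inequality for functions\<close>

lemma power_add_ge_tangent:
  fixes b e :: real
  assumes "b \<ge> 0" "e \<ge> 0"
  shows "b ^ n + real n * b ^ (n - 1) * e \<le> (b + e) ^ n"
proof (induction n)
  case (Suc n)
  show ?case
  proof (cases n)
    case (Suc m)
    have "b ^ Suc n + real (Suc n) * b ^ n * e \<le> (b + e) * (b ^ n + real n * b ^ (n - 1) * e)"
      using assms Suc by (simp add: algebra_simps)
    also have "\<dots> \<le> (b + e) ^ Suc n"
      using Suc.IH assms by (simp add: mult_left_mono)
    finally show ?thesis by simp
  qed simp
qed simp

lemma integrable_lborel_compact_support:
  fixes f :: "'a::euclidean_space \<Rightarrow> 'b::euclidean_space"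
  assumes "compact K" "continuous_on UNIV f" "\<And>x. x \<notin> K \<Longrightarrow> f x = 0"
  shows "integrable lborel f"
proof -
  have "integrable lborel (\<lambda>x. indicator K x *\<^sub>R f x)"
    using assms(1,2) by (intro borel_integrable_compact) (auto intro: continuous_on_subset)
  moreover have "(\<lambda>x. indicator K x *\<^sub>R f x) = f"
    using assms(3) by (auto simp: indicator_def)
  ultimately show ?thesis by simp
qed

text \<open>With b the exact volume radius of A, the volume gained is a multiple of (b + e)^n - b^n
  \<ge> n b^(n-1) e \<ge> n a^(n-1) e. The bound is linear in e and depends on A only through a, so
  it is uniform over all superlevel sets that contain a common set.\<close>

lemma emeasure_superlevel_neighbourhood:
  fixes A C :: "'a::euclidean_space set"
  assumes A: "A \<in> sets borel" "bounded A" and C: "C \<in> sets borel"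
    and a: "a > 0" "ennreal (unit_ball_vol (real DIM('a)) * a ^ DIM('a)) \<le> emeasure lborel A"
    and e: "e > 0"
    and sub: "\<And>x y. x \<in> A \<Longrightarrow> norm y < e \<Longrightarrow> x + y \<in> C"
  shows "emeasure lborel A + ennreal (unit_ball_vol (real DIM('a)) * (real DIM('a) * a ^ (DIM('a) - 1) * e))
     \<le> emeasure lborel C"
proof -
  let ?w = "unit_ball_vol (real DIM('a))" and ?n = "DIM('a)"
  have w: "?w > 0" by simp
  have "emeasure lborel A < \<infinity>" using emeasure_bounded_finite[OF A(2)] .
  then obtain \<mu> where \<mu>: "emeasure lborel A = ennreal \<mu>" "\<mu> \<ge> 0"
    by (metis ennreal_cases infinity_ennreal_def less_irrefl)
  define b where "b = root ?n (\<mu> / ?w)"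
  have b: "b \<ge> 0" "?w * b ^ ?n = \<mu>" using \<mu> w less_imp_neq[OF w] by (auto simp: b_def)
  have "?w * a ^ ?n \<le> ?w * b ^ ?n"
    using a \<mu> b by (auto simp: ennreal_le_iff)
  then have "a ^ ?n \<le> b ^ ?n" using w by simp
  then have ab: "a \<le> b" using a b by (simp add: power_mono_iff)
  have "ennreal (?w * (b + e) ^ ?n) \<le> emeasure lborel C"
    using b ab a \<mu> by (intro brunn_minkowski_ball[OF A(1) C _ _ e sub]) auto
  moreover have "\<mu> + ?w * (real ?n * a ^ (?n - 1) * e) \<le> ?w * (b + e) ^ ?n"
  proof -
    have "real ?n * a ^ (?n - 1) * e \<le> real ?n * b ^ (?n - 1) * e"
      using ab a e by (intro mult_right_mono mult_left_mono power_mono) auto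
    then have "b ^ ?n + real ?n * a ^ (?n - 1) * e \<le> (b + e) ^ ?n"
      using power_add_ge_tangent[of b e ?n] b e by linarith
    then have "?w * (b ^ ?n + real ?n * a ^ (?n - 1) * e) \<le> ?w * (b + e) ^ ?n"
      using w by simp
    then show ?thesis using b by (simp add: distrib_left)
  qed
  moreover have "0 \<le> ?w * (real ?n * a ^ (?n - 1) * e)" using a e by simp
  ultimately show ?thesis
    using \<mu> by (metis ennreal_leI ennreal_plus order.trans)
qed

lemma borel_measurable_emeasure_superlevel:
  fixes f :: "'a \<Rightarrow> ennreal"
  assumes "sigma_finite_measure M" and [measurable]: "f \<in> borel_measurable M"
  shows "(\<lambda>s. emeasure M {x \<in> space M. ennreal s < f x}) \<in> borel_measurable borel"
proof -
  let ?Q = "{p \<in> space (borel \<Otimes>\<^sub>M M). ennreal (fst p) < f (snd p)}"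
  have "?Q \<in> sets (borel \<Otimes>\<^sub>M M)" by measurable
  then have "(\<lambda>s. emeasure M (Pair s -` ?Q)) \<in> borel_measurable borel"
    by (rule sigma_finite_measure.measurable_emeasure_Pair[OF assms(1)])
  moreover have "Pair s -` ?Q = {x \<in> space M. ennreal s < f x}" for s
    by (auto simp: space_pair_measure)
  ultimately show ?thesis by simp
qed

lemma min_add_ennreal_le:
  fixes x y z :: ennreal
  shows "min (x + y) z \<le> min x z + y"
proof (cases "x \<le> z")
  case True
  then have "min x z = x" by (rule min_absorb1)
  then show ?thesis by (metis min.cobounded1)
next
  case False
  then have "min x z = z" by (intro min_absorb2) auto
  moreover have "z \<le> z + y" by (rule add_increasing2) auto
  ultimately show ?thesis by (metis min.cobounded2 order.trans)
qed

text \<open>Every set {g > s c} with 0 < s < 1 contains A, so its e-neighbourhood has at least P e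
  more volume. That neighbourhood lies in {g + \<psi> > s c}, where \<psi> is close to e |D|.
  Integrating over s and dividing by e bounds c P by the integral of |D| up to an error that
  vanishes with \<eta>; perimeters of level sets never occur.\<close>

lemma sharp_sobolev_L1:
  fixes g :: "'a::euclidean_space \<Rightarrow> real" and D :: "'a \<Rightarrow> 'a"
  assumes K: "compact K"
    and der: "\<And>x. (g has_derivative (\<lambda>h. D x \<bullet> h)) (at x)"
    and D: "continuous_on UNIV D"
    and g0: "\<And>x. x \<notin> K \<Longrightarrow> g x = 0" and D0: "\<And>x. x \<notin> K \<Longrightarrow> D x = 0"
    and nonneg: "\<And>x. 0 \<le> g x"
    and A: "A \<in> sets borel" and a: "a > 0" "ennreal (unit_ball_vol (real DIM('a)) * a ^ DIM('a)) \<le> emeasure lborel A"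
    and c: "c > 0" "\<And>x. x \<in> A \<Longrightarrow> c \<le> g x"
  shows "c * (unit_ball_vol (real DIM('a)) * (real DIM('a) * a ^ (DIM('a) - 1))) \<le> (\<integral>x. norm (D x) \<partial>lborel)"
proof -
  let ?w = "unit_ball_vol (real DIM('a))" and ?n = "DIM('a)"
  define P where "P = ?w * (real ?n * a ^ (?n - 1))"
  obtain r where r: "K \<subseteq> cball 0 r" "r > 0"
    using compact_imp_bounded[OF K] unfolding bounded_pos subset_iff mem_cball dist_0_norm by blast
  define S where "S = cball (0::'a) (r + 1)"
  have contg: "continuous_on UNIV g"
    using der by (auto intro!: continuous_at_imp_continuous_on has_derivative_continuous)
  then have [measurable]: "g \<in> borel_measurable borel" by (rule borel_measurable_continuous_onI)
  have [measurable]: "D \<in> borel_measurable borel" using D by (rule borel_measurable_continuous_onI)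
  have intD: "integrable lborel (\<lambda>x. norm (D x))"
    using D D0 by (intro integrable_lborel_compact_support[OF K]) (auto intro!: continuous_intros)
  have approx: "c * P \<le> (\<integral>x. norm (D x) \<partial>lborel) + \<eta> * measure lborel S" if \<eta>: "\<eta> > 0" for \<eta>
  proof -
    have "uniformly_continuous_on (cball 0 (r + 2)) D"
      by (intro compact_uniformly_continuous continuous_on_subset[OF D]) auto
    then obtain \<delta> where \<delta>: "\<delta> > 0"
      "\<And>x y. x \<in> cball 0 (r + 2) \<Longrightarrow> y \<in> cball 0 (r + 2) \<Longrightarrow> dist y x < \<delta> \<Longrightarrow> dist (D y) (D x) < \<eta>"
      unfolding uniformly_continuous_on_def using \<eta> by metis
    define e where "e = min \<delta> 1"
    have e: "e > 0" "e \<le> \<delta>" "e \<le> 1" using \<delta> by (auto simp: e_def)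
    \<comment> \<open>By uniform continuity of D, this bounds the oscillation of g within distance e
      of x. The extra 1 in the radius of S covers the points within e of the support, and the ball
      of radius r + 2 covers the balls of radius e around points of S.\<close>
    define \<psi> where "\<psi> x = e * (norm (D x) + \<eta>) * indicator S x" for x
    have [measurable]: "S \<in> sets borel" by (simp add: S_def)
    have [measurable]: "\<psi> \<in> borel_measurable borel"
      unfolding \<psi>_def[abs_def] by measurable
    have psi0: "\<psi> x \<ge> 0" for x using e \<eta> by (auto simp: \<psi>_def)
    have near: "g y \<le> g x + \<psi> x" if xy: "dist x y < e" for x y
    proof (cases "x \<in> S")
      case True
      have ball: "z \<in> cball 0 (r + 2)" if "z \<in> ball x e" for z
        using that True e norm_triangle_ineq2[of z x] by (auto simp: S_def dist_norm norm_minus_commute)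
      have "norm (g y - g x) \<le> (norm (D x) + \<eta>) * norm (y - x)"
      proof (rule differentiable_bound[of "ball x e" g "\<lambda>z h. D z \<bullet> h"])
        show "(g has_derivative (\<bullet>) (D z)) (at z within ball x e)" for z
          using der by (rule has_derivative_at_withinI)
        show "onorm ((\<bullet>) (D z)) \<le> norm (D x) + \<eta>" if z: "z \<in> ball x e" for z
        proof (rule onorm_bound)
          have "dist (D z) (D x) < \<eta>"
            using z e ball[OF z] ball[of x] by (intro \<delta>(2)) (auto simp: dist_commute)
          then have "norm (D z) \<le> norm (D x) + \<eta>"
            using norm_triangle_ineq2[of "D z" "D x"] by (simp add: dist_norm)
          then show "norm (D z \<bullet> h) \<le> (norm (D x) + \<eta>) * norm h" for h
            using Cauchy_Schwarz_ineq2[of "D z" h] by (smt (verit) mult_right_mono norm_ge_zero real_norm_def)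
        qed (use \<eta> in auto)
      qed (use xy e in auto)
      also have "\<dots> \<le> (norm (D x) + \<eta>) * e"
        using xy \<eta> by (intro mult_left_mono) (auto simp: dist_norm norm_minus_commute)
      finally show ?thesis using True by (simp add: \<psi>_def mult_ac)
    next
      case False
      then have "y \<notin> K"
        using r xy e norm_triangle_ineq2[of x y] by (force simp: S_def dist_norm)
      then show ?thesis using g0 nonneg psi0 by (simp add: add_nonneg_nonneg)
    qed
    let ?f = "\<lambda>x. ennreal (g x / c)" and ?h = "\<lambda>x. ennreal ((g x + \<psi> x) / c)"
    have level: "emeasure lborel {x \<in> space lborel. ennreal s < ?f x} + ennreal (P * e)
        \<le> emeasure lborel {x \<in> space lborel. ennreal s < ?h x}" if s: "0 < s" "s < 1" for s
    proof -
      let ?A = "{x \<in> space lborel. ennreal s < ?f x}" and ?C = "{x \<in> space lborel. ennreal s < ?h x}"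
      have A': "?A = {x. s * c < g x}" and C': "?C = {x. s * c < g x + \<psi> x}"
        using s c nonneg psi0 by (auto simp: ennreal_less_iff field_simps)
      have m: "?A \<in> sets borel" "?C \<in> sets borel" by measurable
      have "?A \<subseteq> K" unfolding A' using g0 s c by (auto simp: not_less) (metis less_asym mult_pos_pos)
      then have bA: "bounded ?A" using K by (meson bounded_subset compact_imp_bounded)
      have "A \<subseteq> ?A"
      proof
        fix x assume "x \<in> A"
        then have "c \<le> g x" by (rule c)
        moreover have "s * c < c" using s c by simp
        ultimately have "s * c < g x" by linarith
        then show "x \<in> ?A" unfolding A' by simp
      qed
      then have "emeasure lborel A \<le> emeasure lborel ?A" using m by (intro emeasure_mono) auto
      then have "ennreal (?w * a ^ ?n) \<le> emeasure lborel ?A" using a by simp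
      then have "emeasure lborel ?A + ennreal (?w * (real ?n * a ^ (?n - 1) * e)) \<le> emeasure lborel ?C"
      proof (rule emeasure_superlevel_neighbourhood[OF m(1) bA m(2) a(1) _ e(1)])
        fix x y :: 'a assume "x \<in> ?A" "norm y < e"
        then show "x + y \<in> ?C"
          unfolding A' C' using near[of "x + y" x] by (simp add: dist_norm)
      qed
      then show ?thesis by (simp add: P_def mult_ac)
    qed
    have sf: "sigma_finite_measure (lborel :: 'a measure)" ..
    have P0: "P \<ge> 0" using a by (simp add: P_def)
    have [measurable]: "(\<lambda>s. emeasure lborel {x \<in> space lborel. ennreal s < ?f x}) \<in> borel_measurable borel"
      by (rule borel_measurable_emeasure_superlevel[OF sf]) measurable
    have "(\<integral>\<^sup>+x. min (?f x) 1 \<partial>lborel) + ennreal (P * e)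
        = (\<integral>\<^sup>+s. indicator {0<..<1} s * emeasure lborel {x \<in> space lborel. ennreal s < ?f x}
            + ennreal (P * e) * indicator {0<..<1} (s::real) \<partial>lborel)"
      by (subst nn_integral_add) (auto simp: nn_integral_min_one_layer_cake[OF sf] nn_integral_cmult)
    also have "\<dots> \<le> (\<integral>\<^sup>+s. indicator {0<..<1} s * emeasure lborel {x \<in> space lborel. ennreal s < ?h x} \<partial>lborel)"
      using level by (intro nn_integral_mono) (auto simp: indicator_def)
    also have "\<dots> = (\<integral>\<^sup>+x. min (?h x) 1 \<partial>lborel)"
      by (subst nn_integral_min_one_layer_cake[OF sf]) auto
    also have "\<dots> \<le> (\<integral>\<^sup>+x. min (?f x) 1 + ennreal (\<psi> x / c) \<partial>lborel)"
    proof (intro nn_integral_mono)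
      fix x
      have "?h x = ?f x + ennreal (\<psi> x / c)"
        using c nonneg psi0 by (simp add: add_divide_distrib flip: ennreal_plus)
      then show "min (?h x) 1 \<le> min (?f x) 1 + ennreal (\<psi> x / c)"
        using min_add_ennreal_le by metis
    qed
    also have "\<dots> = (\<integral>\<^sup>+x. min (?f x) 1 \<partial>lborel) + (\<integral>\<^sup>+x. ennreal (\<psi> x / c) \<partial>lborel)"
      by (subst nn_integral_add) auto
    finally have main: "(\<integral>\<^sup>+x. min (?f x) 1 \<partial>lborel) + ennreal (P * e)
       \<le> (\<integral>\<^sup>+x. min (?f x) 1 \<partial>lborel) + (\<integral>\<^sup>+x. ennreal (\<psi> x / c) \<partial>lborel)" .
    \<comment> \<open>The common term is finite, being at most the volume of K, and can therefore be
      cancelled in \<open>main\<close>.\<close>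
    have "(\<integral>\<^sup>+x. min (?f x) 1 \<partial>lborel) \<le> (\<integral>\<^sup>+x. indicator K x \<partial>lborel)"
      using g0 by (intro nn_integral_mono) (auto simp: indicator_def)
    also have "\<dots> < top"
      using emeasure_compact_finite[OF K] K by (simp add: compact_imp_closed)
    finally have "ennreal (P * e) \<le> (\<integral>\<^sup>+x. ennreal (\<psi> x / c) \<partial>lborel)"
      using main unfolding ennreal_add_left_cancel_le by auto
    moreover have intS: "integrable lborel (\<lambda>x. \<eta> * indicator S x)"
      by (intro integrable_mult_right integrable_real_indicator) (use emeasure_lborel_cball_finite in \<open>auto simp: S_def less_top\<close>)
    moreover have psi_eq: "\<psi> x / c = (e / c) * (norm (D x) + \<eta> * indicator S x)" for x
    proof (cases "x \<in> S")
      case False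
      then have "x \<notin> K" using r by (auto simp: S_def)
      then show ?thesis using False by (simp add: \<psi>_def D0)
    qed (simp add: \<psi>_def)
    moreover have "(\<integral>\<^sup>+x. ennreal (\<psi> x / c) \<partial>lborel) = ennreal (\<integral>x. \<psi> x / c \<partial>lborel)"
      using intD intS psi0 c unfolding psi_eq
      by (intro nn_integral_eq_integral) (use e \<eta> in \<open>auto intro!: AE_I2\<close>)
    moreover have "(\<integral>x. \<psi> x / c \<partial>lborel) = (e / c) * ((\<integral>x. norm (D x) \<partial>lborel) + \<eta> * measure lborel S)"
      unfolding psi_eq using intD intS by (simp add: S_def)
    ultimately have "ennreal (P * e) \<le> ennreal ((e / c) * ((\<integral>x. norm (D x) \<partial>lborel) + \<eta> * measure lborel S))"
      by (simp only:)
    then have "P * e \<le> (e / c) * ((\<integral>x. norm (D x) \<partial>lborel) + \<eta> * measure lborel S)"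
      using e c \<eta> by (subst (asm) ennreal_le_iff) (auto intro!: mult_nonneg_nonneg add_nonneg_nonneg)
    then have "e * (c * P) \<le> e * ((\<integral>x. norm (D x) \<partial>lborel) + \<eta> * measure lborel S)"
      using c by (simp add: field_simps)
    then show ?thesis using e by simp
  qed
  have "((\<lambda>\<eta>. (\<integral>x. norm (D x) \<partial>lborel) + \<eta> * measure lborel S) \<longlongrightarrow> (\<integral>x. norm (D x) \<partial>lborel) + 0 * measure lborel S) (at_right 0)"
    by (intro tendsto_intros)
  moreover have "eventually (\<lambda>\<eta>. c * P \<le> (\<integral>x. norm (D x) \<partial>lborel) + \<eta> * measure lborel S) (at_right 0)"
    using approx by (auto simp: eventually_at_filter)
  ultimately have "c * P \<le> (\<integral>x. norm (D x) \<partial>lborel) + 0 * measure lborel S"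
    by (rule tendsto_lowerbound) simp
  then show ?thesis by (simp add: P_def)
qed

section \<open>Integration by parts\<close>

lemma integral_lborel_translation:
  fixes f :: "'a::euclidean_space \<Rightarrow> real"
  assumes "f \<in> borel_measurable borel"
  shows "(\<integral>x. f (t + x) \<partial>lborel) = (\<integral>x. f x \<partial>lborel)"
  using assms by (subst lborel_distr_plus[symmetric, of t], subst integral_distr) auto

text \<open>By translation invariance the difference quotients have integral \<open>0\<close>, and they converge
  uniformly.\<close>

lemma integral_partial_derivative_compact_support:
  fixes F :: "'a::euclidean_space \<Rightarrow> real"
  assumes K: "compact K" and b: "norm b = 1"
    and der: "\<And>x. ((\<lambda>s. F (x + s *\<^sub>R b)) has_real_derivative F' x) (at 0)"
    and F: "continuous_on UNIV F" "\<And>x. x \<notin> K \<Longrightarrow> F x = 0"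
    and F': "continuous_on UNIV F'" "\<And>x. x \<notin> K \<Longrightarrow> F' x = 0"
  shows "(\<integral>x. F' x \<partial>lborel) = 0"
proof -
  obtain r where r: "K \<subseteq> cball 0 r" "r > 0"
    using compact_imp_bounded[OF K] unfolding bounded_pos subset_iff mem_cball dist_0_norm by blast
  define S where "S = cball (0::'a) (r + 1)"
  have intF: "integrable lborel F" "integrable lborel F'"
    using F F' by (auto intro: integrable_lborel_compact_support[OF K])
  have approx: "\<bar>\<integral>x. F' x \<partial>lborel\<bar> \<le> \<eta> * measure lborel S" if \<eta>: "\<eta> > 0" for \<eta>
  proof -
    have "uniformly_continuous_on (cball 0 (r + 2)) F'"
      by (intro compact_uniformly_continuous continuous_on_subset[OF F'(1)]) auto
    then obtain \<delta> where \<delta>: "\<delta> > 0"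
      "\<And>x y. x \<in> cball 0 (r + 2) \<Longrightarrow> y \<in> cball 0 (r + 2) \<Longrightarrow> dist y x < \<delta> \<Longrightarrow> dist (F' y) (F' x) < \<eta>"
      unfolding uniformly_continuous_on_def using \<eta> by metis
    define e where "e = min (\<delta> / 2) 1"
    have e: "e > 0" "e < \<delta>" "e \<le> 1" using \<delta> by (auto simp: e_def)
    define q where "q x = (F (e *\<^sub>R b + x) - F x) / e" for x
    have intT: "integrable lborel (\<lambda>x. F (e *\<^sub>R b + x))"
    proof (rule integrable_lborel_compact_support[where K="cball 0 (r + 1)"])
      show "F (e *\<^sub>R b + x) = 0" if "x \<notin> cball 0 (r + 1)" for x
      proof -
        have "norm (e *\<^sub>R b + x) \<ge> norm x - e"
          using norm_triangle_ineq2[of x "- (e *\<^sub>R b)"] b e by (simp add: add.commute)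
        then have "e *\<^sub>R b + x \<notin> K" using r that e by auto
        then show ?thesis by (rule F(2))
      qed
    qed (auto intro!: continuous_on_compose2[OF F(1)] continuous_intros)
    have "(\<integral>x. F (e *\<^sub>R b + x) \<partial>lborel) = (\<integral>x. F x \<partial>lborel)"
      using F(1) by (intro integral_lborel_translation borel_measurable_continuous_onI)
    then have q0: "(\<integral>x. q x \<partial>lborel) = 0"
      unfolding q_def using intT intF by simp
    have intq: "integrable lborel q"
      unfolding q_def[abs_def] using intT intF by auto
    have near: "\<bar>q x - F' x\<bar> \<le> \<eta> * indicator S x" for x
    proof (cases "x \<in> S")
      case True
      have "((\<lambda>s. F (x + s *\<^sub>R b)) has_real_derivative F' (x + s *\<^sub>R b)) (at s)" for s
      proof -
        have "((\<lambda>h. F (x + s *\<^sub>R b + h *\<^sub>R b)) has_real_derivative F' (x + s *\<^sub>R b)) (at 0)"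
          by (rule der)
        then have "((\<lambda>h. F (x + (s + h) *\<^sub>R b)) has_real_derivative F' (x + s *\<^sub>R b)) (at 0)"
          by (simp add: scaleR_add_left add.assoc)
        then show ?thesis
          using DERIV_shift[of "\<lambda>s. F (x + s *\<^sub>R b)" "F' (x + s *\<^sub>R b)" 0 s] by (simp add: add.commute)
      qed
      then obtain s where s: "0 < s" "s < e" "F (x + e *\<^sub>R b) - F (x + 0 *\<^sub>R b) = (e - 0) * F' (x + s *\<^sub>R b)"
        using MVT2[of 0 e "\<lambda>s. F (x + s *\<^sub>R b)" "\<lambda>s. F' (x + s *\<^sub>R b)"] e by blast
      then have "q x = F' (x + s *\<^sub>R b)" using e by (simp add: q_def add.commute)
      moreover have "dist (F' (x + s *\<^sub>R b)) (F' x) < \<eta>"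
      proof (rule \<delta>(2))
        show "x \<in> cball 0 (r + 2)" using True by (simp add: S_def)
        show "x + s *\<^sub>R b \<in> cball 0 (r + 2)"
          using True s e b norm_triangle_ineq[of x "s *\<^sub>R b"] by (simp add: S_def)
        show "dist (x + s *\<^sub>R b) x < \<delta>" using s e b by (simp add: dist_norm)
      qed
      ultimately show ?thesis using True by (simp add: dist_real_def)
    next
      case False
      have "norm (e *\<^sub>R b + x) \<ge> norm x - e"
        using norm_triangle_ineq2[of x "- (e *\<^sub>R b)"] b e by (simp add: add.commute)
      then have "e *\<^sub>R b + x \<notin> K" "x \<notin> K" using r False e by (auto simp: S_def)
      then show ?thesis using F F' False by (simp add: q_def)
    qed
    have intS: "integrable lborel (\<lambda>x. \<eta> * indicator S x)"
      by (intro integrable_mult_right integrable_real_indicator) (use emeasure_lborel_cball_finite in \<open>auto simp: S_def less_top\<close>)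
    have "\<bar>\<integral>x. F' x \<partial>lborel\<bar> = \<bar>\<integral>x. q x - F' x \<partial>lborel\<bar>"
      using intq intF q0 by simp
    also have "\<dots> \<le> (\<integral>x. \<bar>q x - F' x\<bar> \<partial>lborel)"
      by (rule integral_abs_bound)
    also have "\<dots> \<le> (\<integral>x. \<eta> * indicator S x \<partial>lborel)"
      using near intq intF intS by (intro integral_mono) auto
    also have "\<dots> = \<eta> * measure lborel S" by (simp add: S_def)
    finally show ?thesis .
  qed
  have "((\<lambda>\<eta>. \<eta> * measure lborel S) \<longlongrightarrow> 0 * measure lborel S) (at_right 0)"
    by (intro tendsto_intros)
  moreover have "eventually (\<lambda>\<eta>. \<bar>\<integral>x. F' x \<partial>lborel\<bar> \<le> \<eta> * measure lborel S) (at_right 0)"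
    using approx by (auto simp: eventually_at_filter)
  ultimately have "\<bar>\<integral>x. F' x \<partial>lborel\<bar> \<le> 0 * measure lborel S"
    by (rule tendsto_lowerbound) simp
  then show ?thesis by simp
qed

lemma has_real_derivative_max_zero_sq:
  "((\<lambda>s::real. (max 0 s)\<^sup>2 / 2) has_real_derivative max 0 s) (at s)"
proof -
  consider "s > 0" | "s < 0" | "s = 0" by linarith
  then show ?thesis
  proof cases
    case 1
    have "((\<lambda>s::real. s\<^sup>2 / 2) has_real_derivative max 0 s) (at s)"
      using 1 by (auto intro!: derivative_eq_intros)
    then show ?thesis
      by (rule has_field_derivative_transform_within_open[where S="{0<..}"]) (use 1 in auto)
  next
    case 2
    have "((\<lambda>s::real. 0) has_real_derivative max 0 s) (at s)"
      using 2 by (auto intro!: derivative_eq_intros)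
    then show ?thesis
      by (rule has_field_derivative_transform_within_open[where S="{..<0}"]) (use 2 in auto)
  next
    case 3
    have "((\<lambda>h. ((max 0 h)\<^sup>2 / 2) / h) \<longlongrightarrow> 0) (at (0::real))"
    proof (rule tendsto_0_le[where K=1 and f="\<lambda>h. h"])
      show "\<forall>\<^sub>F h in at (0::real). norm ((max 0 h)\<^sup>2 / 2 / h) \<le> norm h * 1"
        by (rule always_eventually) (auto simp: max_def power2_eq_square)
    qed (rule tendsto_ident_at)
    then show ?thesis using 3 by (simp add: DERIV_def)
  qed
qed

text \<open>The antiderivative of a trapezoid of height \<open>1\<close> over \<open>[t, t']\<close>: a \<open>C\<^sup>1\<close> approximation of the
  truncation \<open>min (max (s - t) 0) (t' - t)\<close>.\<close>

lemma smooth_truncation_exists: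
  fixes t t' \<delta> :: real
  assumes "0 < \<delta>" "2 * \<delta> \<le> t' - t"
  obtains G p where "\<And>s. (G has_real_derivative p s) (at s)" "continuous_on UNIV p"
    "\<And>s. 0 \<le> p s" "\<And>s. p s \<le> 1" "\<And>s. s \<le> t \<or> t' \<le> s \<Longrightarrow> p s = 0"
    "\<And>s. s \<le> t \<Longrightarrow> G s = 0" "\<And>s. t' \<le> s \<Longrightarrow> G s = t' - t - \<delta>"
    "\<And>s. 0 \<le> G s" "\<And>s. G s \<le> t' - t - \<delta>"
proof -
  define Q where "Q s = (max 0 s)\<^sup>2 / 2" for s :: real
  define p where "p s = (max 0 (s - t) - max 0 (s - t - \<delta>) - max 0 (s - t' + \<delta>) + max 0 (s - t')) / \<delta>" for s
  define G where "G s = (Q (s - t) - Q (s - t - \<delta>) - Q (s - t' + \<delta>) + Q (s - t')) / \<delta>" for s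
  have Q: "(Q has_real_derivative max 0 s) (at s)" for s
    unfolding Q_def[abs_def] by (rule has_real_derivative_max_zero_sq)
  have Q': "((\<lambda>s. Q (s + c)) has_real_derivative max 0 (s + c)) (at s)" for s c
    using DERIV_shift[of Q "max 0 (s + c)" s c] Q by simp
  have der: "(G has_real_derivative p s) (at s)" for s
  proof -
    have "((\<lambda>s. (Q (s + (- t)) - Q (s + (- t - \<delta>)) - Q (s + (- t' + \<delta>)) + Q (s + (- t'))) / \<delta>)
        has_real_derivative (max 0 (s + (- t)) - max 0 (s + (- t - \<delta>)) - max 0 (s + (- t' + \<delta>)) + max 0 (s + (- t'))) / \<delta>) (at s)"
      by (intro DERIV_cdivide DERIV_add DERIV_diff Q')
    then show ?thesis by (simp add: G_def[abs_def] p_def algebra_simps)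
  qed
  have p0: "0 \<le> p s" for s
    using assms unfolding p_def by (intro divide_nonneg_pos) (auto simp: max_def)
  have p1: "p s \<le> 1" for s
  proof -
    have "max 0 (s - t) - max 0 (s - t - \<delta>) - max 0 (s - t' + \<delta>) + max 0 (s - t') \<le> \<delta>"
      using assms by (auto simp: max_def)
    then show ?thesis using assms by (simp add: p_def)
  qed
  have pz: "s \<le> t \<or> t' \<le> s \<Longrightarrow> p s = 0" for s
    using assms unfolding p_def by (auto simp: max_def)
  have Gz: "s \<le> t \<Longrightarrow> G s = 0" for s
    using assms unfolding G_def Q_def by (auto simp: max_def)
  have Gc: "t' \<le> s \<Longrightarrow> G s = t' - t - \<delta>" for s
  proof -
    assume "t' \<le> s"
    then have "G s = ((s - t)\<^sup>2 - (s - t - \<delta>)\<^sup>2 - (s - t' + \<delta>)\<^sup>2 + (s - t')\<^sup>2) / (2 * \<delta>)"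
      using assms unfolding G_def Q_def by (simp add: max_def field_simps)
    also have "\<dots> = t' - t - \<delta>"
      using assms by (simp add: field_simps power2_eq_square)
    finally show ?thesis .
  qed
  have mono: "G r \<le> G s" if "r \<le> s" for r s
    by (rule DERIV_nonneg_imp_nondecreasing[OF that]) (use der p0 in blast)
  have "0 \<le> G s" for s using mono[of "min s t" s] Gz[of "min s t"] by simp
  moreover have "G s \<le> t' - t - \<delta>" for s using mono[of s "max s t'"] Gc[of "max s t'"] by simp
  moreover have "continuous_on UNIV p" unfolding p_def using assms by (intro continuous_intros) auto
  ultimately show ?thesis using that der p0 p1 pz Gz Gc by blast
qed

lemma continuous_on_extend_by_zero:
  fixes \<phi> :: "'a::metric_space \<Rightarrow> 'b::real_normed_vector"
  assumes "open \<Omega>" "closed K" "K \<subseteq> \<Omega>" "continuous_on \<Omega> \<phi>" "\<And>x. x \<in> \<Omega> \<Longrightarrow> x \<notin> K \<Longrightarrow> \<phi> x = 0"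
  shows "continuous_on UNIV (\<lambda>x. if x \<in> \<Omega> then \<phi> x else 0)"
proof -
  let ?g = "\<lambda>x. if x \<in> \<Omega> then \<phi> x else 0"
  have "continuous_on (\<Omega> \<union> - K) ?g"
  proof (rule continuous_on_open_Un)
    show "continuous_on \<Omega> ?g" using assms(4) by (simp cong: continuous_on_cong)
    have "continuous_on (- K) (\<lambda>_. 0 :: 'b)" by simp
    then show "continuous_on (- K) ?g"
      using assms(5) by (subst continuous_on_cong[OF refl, of _ _ "\<lambda>_. 0"]) auto
  qed (use assms in auto)
  moreover have "\<Omega> \<union> - K = UNIV" using assms(3) by auto
  ultimately show ?thesis by simp
qed

text \<open>The discriminant argument, which gives Cauchy-Schwarz with a weight but without square
  roots of it. The optimal choice is l = X/P; if P were 0, l = (Q + 1)/X would give 2(Q + 1) \<le>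
  Q.\<close>

lemma square_le_of_quadratic_nonneg:
  fixes X P Q :: real
  assumes "\<And>l. l > 0 \<Longrightarrow> 2 * l * X \<le> l\<^sup>2 * P + Q" "X \<ge> 0" "P \<ge> 0" "Q \<ge> 0"
  shows "X\<^sup>2 \<le> P * Q"
proof (cases "X = 0")
  case False
  then have X: "X > 0" using assms by simp
  have "P > 0"
  proof (rule ccontr)
    assume "\<not> P > 0"
    then have "P = 0" using assms by simp
    then have "2 * ((Q + 1) / X) * X \<le> Q" using assms(1)[of "(Q + 1) / X"] X assms by simp
    then show False using X assms by simp
  qed
  then have "2 * (X / P) * X \<le> (X / P)\<^sup>2 * P + Q" using assms(1)[of "X / P"] X by simp
  then have "2 * X\<^sup>2 / P \<le> X\<^sup>2 / P + Q" using \<open>P > 0\<close> by (simp add: power2_eq_square)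
  then show ?thesis using \<open>P > 0\<close> by (simp add: field_simps)
qed (use assms in simp)

section \<open>Gradients and the estimate between two levels\<close>

definition gradient :: "('a::euclidean_space \<Rightarrow> real) \<Rightarrow> 'a \<Rightarrow> 'a" where
  "gradient u x = (\<Sum>b\<in>Basis. partial_deriv b u x *\<^sub>R b)"

lemma has_derivative_gradient:
  assumes "u differentiable (at x)"
  shows "(u has_derivative (\<lambda>h. gradient u x \<bullet> h)) (at x)"
proof -
  have d: "(u has_derivative frechet_derivative u (at x)) (at x)"
    using assms by (simp add: frechet_derivative_works)
  then have lin: "linear (frechet_derivative u (at x))" by (rule has_derivative_linear)
  have "frechet_derivative u (at x) h = gradient u x \<bullet> h" for h
  proof -
    have "frechet_derivative u (at x) h = frechet_derivative u (at x) (\<Sum>b\<in>Basis. (h \<bullet> b) *\<^sub>R b)"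
      by (simp add: euclidean_representation)
    also have "\<dots> = (\<Sum>b\<in>Basis. (h \<bullet> b) * frechet_derivative u (at x) b)"
      using lin by (simp add: linear_sum linear_scale)
    also have "\<dots> = gradient u x \<bullet> h"
      by (simp add: gradient_def partial_deriv_def inner_sum_left inner_sum_right inner_commute mult.commute)
    finally show ?thesis .
  qed
  then have "frechet_derivative u (at x) = (\<lambda>h. gradient u x \<bullet> h)" by (rule ext)
  then show ?thesis using d by simp
qed

lemma has_real_derivative_partial:
  assumes "u differentiable (at (x + s *\<^sub>R b))"
  shows "((\<lambda>s. u (x + s *\<^sub>R b)) has_real_derivative partial_deriv b u (x + s *\<^sub>R b)) (at s)"
proof -
  let ?L = "frechet_derivative u (at (x + s *\<^sub>R b))"
  have d: "(u has_derivative ?L) (at (x + s *\<^sub>R b))"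
    using assms by (simp add: frechet_derivative_works)
  have "((\<lambda>s. x + s *\<^sub>R b) has_derivative (\<lambda>h. h *\<^sub>R b)) (at s)"
    by (auto intro!: derivative_eq_intros)
  from has_derivative_compose[OF this d]
  have "((\<lambda>s. u (x + s *\<^sub>R b)) has_derivative (\<lambda>h. ?L (h *\<^sub>R b))) (at s)" .
  moreover have "?L (h *\<^sub>R b) = partial_deriv b u (x + s *\<^sub>R b) * h" for h
    using linear_scale[OF has_derivative_linear[OF d], of h b] by (simp add: partial_deriv_def)
  ultimately show ?thesis by (simp only: has_field_derivative_def)
qed

lemma norm_gradient_sq: "(norm (gradient u x))\<^sup>2 = (\<Sum>b\<in>Basis. (partial_deriv b u x)\<^sup>2)"
proof -
  have "gradient u x \<bullet> b = partial_deriv b u x" if "b \<in> Basis" for b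
    using that by (simp add: gradient_def inner_sum_left_Basis)
  moreover have "(norm (gradient u x))\<^sup>2 = (\<Sum>b\<in>Basis. (gradient u x \<bullet> b) * (gradient u x \<bullet> b))"
    by (simp add: power2_norm_eq_inner euclidean_inner[of "gradient u x" "gradient u x"])
  ultimately show ?thesis by (simp add: power2_eq_square)
qed

lemma Ck_on_2D:
  assumes "Ck_on 2 \<Omega> u"
  shows "\<And>x. x \<in> \<Omega> \<Longrightarrow> u differentiable (at x)"
    and "\<And>x b. x \<in> \<Omega> \<Longrightarrow> b \<in> Basis \<Longrightarrow> partial_deriv b u differentiable (at x)"
    and "\<And>b. b \<in> Basis \<Longrightarrow> continuous_on \<Omega> (partial_deriv b (partial_deriv b u))"
  using assms by (auto simp: numeral_2_eq_2)

text \<open>The test function is G(u), with G the smooth truncation of height c = t' - t - \<delta>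
  and slope p. It equals c on {u > t'}, so the Sobolev inequality gives c E \<le> \<integral> p
  |\<nabla>u|. The weighted Cauchy-Schwarz inequality and \<integral> p |\<nabla>u|^2 = \<integral>
  G(u) (-\<Delta>u) \<le> c I bound the square of this by m c I. One factor c cancels, so the result
  is linear in t' - t once \<delta> tends to 0.\<close>

lemma level_set_inequality:
  fixes \<Omega> :: "'a::euclidean_space set"
  assumes \<Omega>: "open \<Omega>" "bounded \<Omega>" and C2: "Ck_on 2 \<Omega> u" and cont: "continuous_on (closure \<Omega>) u"
    and bd: "\<And>x. x \<in> frontier \<Omega> \<Longrightarrow> u x = 0"
    and super: "\<And>x. x \<in> \<Omega> \<Longrightarrow> laplacian u x \<le> 0"
    and t: "0 < t" "t < t'"
    and a: "a > 0" "ennreal (unit_ball_vol (real DIM('a)) * a ^ DIM('a)) \<le> emeasure lborel {x\<in>\<Omega>. t' < u x}"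
  shows "(t' - t) * (unit_ball_vol (real DIM('a)) * (real DIM('a) * a ^ (DIM('a) - 1)))\<^sup>2
     \<le> measure lborel {x\<in>\<Omega>. t < u x \<and> u x \<le> t'}
        * (\<integral>x. indicator {x\<in>\<Omega>. t < u x} x * (- laplacian u x) \<partial>lborel)"
proof -
  define E where "E = unit_ball_vol (real DIM('a)) * (real DIM('a) * a ^ (DIM('a) - 1))"
  \<comment> \<open>As u vanishes on the frontier and t > 0, this is a compact subset of \<Omega>.
    Everything built from G(u) and p(u) vanishes off it and extends by zero, so no boundary term
    arises.\<close>
  define K where "K = {x \<in> closure \<Omega>. t \<le> u x}"
  define m where "m = measure lborel {x\<in>\<Omega>. t < u x \<and> u x \<le> t'}"
  define I where "I = (\<integral>x. indicator {x\<in>\<Omega>. t < u x} x * (- laplacian u x) \<partial>lborel)"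
  note d1 = Ck_on_2D(1)[OF C2] and d2 = Ck_on_2D(2)[OF C2] and c2 = Ck_on_2D(3)[OF C2]
  have fr: "closure \<Omega> = \<Omega> \<union> frontier \<Omega>"
    using \<Omega>(1) by (auto simp: frontier_def interior_open closure_def interior_open)
  have K_sub: "K \<subseteq> \<Omega>" using bd t unfolding K_def fr by force
  have "closed K"
    unfolding K_def by (intro continuous_on_closed_Collect_le cont) auto
  moreover have "bounded K" using \<Omega>(2) K_sub bounded_subset by blast
  ultimately have K: "compact K" "closed K" by (auto simp: compact_eq_bounded_closed)
  have cu: "continuous_on \<Omega> u" using cont by (rule continuous_on_subset) (rule closure_subset)
  have cb: "continuous_on \<Omega> (partial_deriv b u)" if "b \<in> Basis" for b
    using d2 that by (intro continuous_at_imp_continuous_on ballI differentiable_imp_continuous_within) auto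
  have cg: "continuous_on \<Omega> (gradient u)"
    unfolding gradient_def[abs_def] by (intro continuous_intros cb)
  have cl: "continuous_on \<Omega> (laplacian u)"
    unfolding laplacian_def[abs_def] by (intro continuous_intros c2)
  have openT: "open {x\<in>\<Omega>. s < u x}" for s
    using continuous_open_preimage[OF cu \<Omega>(1) open_greaterThan, of s]
    by (simp add: vimage_def Int_def)
  have m_set: "{x\<in>\<Omega>. t < u x \<and> u x \<le> t'} \<in> sets borel"
  proof -
    have "{x\<in>\<Omega>. t < u x \<and> u x \<le> t'} = {x\<in>\<Omega>. t < u x} - {x\<in>\<Omega>. t' < u x}" by auto
    then show ?thesis using openT by auto
  qed
  have fin: "emeasure lborel X < \<infinity>" if "X \<subseteq> \<Omega>" for X
    using that \<Omega>(2) by (intro emeasure_bounded_finite bounded_subset[OF \<Omega>(2)])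
  have intI: "integrable lborel (\<lambda>x. indicator {x\<in>\<Omega>. t < u x} x * (- laplacian u x))"
  proof -
    have "integrable lborel (\<lambda>x. indicator K x *\<^sub>R (- laplacian u x))"
      using cl K K_sub by (intro borel_integrable_compact continuous_intros) (auto intro: continuous_on_subset)
    then have "integrable lborel (\<lambda>x. indicator {x\<in>\<Omega>. t < u x} x *\<^sub>R (indicator K x *\<^sub>R (- laplacian u x)))"
      by (rule integrable_mult_indicator[rotated]) (use openT in auto)
    moreover have "(\<lambda>x. indicator {x\<in>\<Omega>. t < u x} x *\<^sub>R (indicator K x *\<^sub>R (- laplacian u x)))
       = (\<lambda>x. indicator {x\<in>\<Omega>. t < u x} x * (- laplacian u x))"
      using closure_subset[of \<Omega>] by (auto simp: fun_eq_iff K_def indicator_def)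
    ultimately show ?thesis by (simp only:)
  qed
  have I0: "0 \<le> I" unfolding I_def
    using super by (intro integral_nonneg_AE AE_I2) (auto simp: indicator_def)
  have approx: "(t' - t - \<delta>) * E\<^sup>2 \<le> m * I" if \<delta>: "0 < \<delta>" "2 * \<delta> \<le> t' - t" for \<delta>
  proof -
    define c where "c = t' - t - \<delta>"
    have c: "c > 0" using \<delta> t by (simp add: c_def)
    obtain G p where G: "\<And>s. (G has_real_derivative p s) (at s)" and p: "continuous_on UNIV p"
      "\<And>s. 0 \<le> p s" "\<And>s. p s \<le> 1" "\<And>s. s \<le> t \<or> t' \<le> s \<Longrightarrow> p s = 0"
      and Gv: "\<And>s. s \<le> t \<Longrightarrow> G s = 0" "\<And>s. t' \<le> s \<Longrightarrow> G s = c" "\<And>s. 0 \<le> G s" "\<And>s. G s \<le> c"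
      unfolding c_def using smooth_truncation_exists[OF \<delta>] by metis
    have contG: "continuous_on UNIV G"
      using G by (auto intro!: continuous_at_imp_continuous_on DERIV_isCont)
    have cGu: "continuous_on \<Omega> (\<lambda>x. G (u x))" and cpu: "continuous_on \<Omega> (\<lambda>x. p (u x))"
      using continuous_on_compose2[OF contG cu] continuous_on_compose2[OF p(1) cu] by auto
    have outK: "u x \<le> t" if "x \<in> \<Omega>" "x \<notin> K" for x
      using that closure_subset by (force simp: K_def)
    define ext where "ext \<phi> x = (if x \<in> \<Omega> then \<phi> x else 0)" for \<phi> :: "'a \<Rightarrow> real" and x
    have c_ext: "continuous_on UNIV (ext \<phi>)" if "continuous_on \<Omega> \<phi>" "\<And>x. x \<in> \<Omega> \<Longrightarrow> u x \<le> t \<Longrightarrow> \<phi> x = 0" for \<phi>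
      unfolding ext_def using that outK by (intro continuous_on_extend_by_zero[OF \<Omega>(1) K(2) K_sub]) auto
    have int_ext: "integrable lborel (ext \<phi>)" if "continuous_on \<Omega> \<phi>" "\<And>x. x \<in> \<Omega> \<Longrightarrow> u x \<le> t \<Longrightarrow> \<phi> x = 0" for \<phi>
      using that outK by (intro integrable_lborel_compact_support[OF K(1)] c_ext) (auto simp: ext_def)
    have ext_zero_near: "(ext \<phi> has_derivative (\<lambda>_. 0)) (at x)"
      if "x \<notin> \<Omega>" "\<And>x. x \<in> \<Omega> \<Longrightarrow> u x \<le> t \<Longrightarrow> \<phi> x = 0" for \<phi> x
    proof (rule has_derivative_transform_within_open[where s="- K" and f="\<lambda>_. 0"])
      show "x \<in> - K" using that(1) K_sub by auto
      show "0 = ext \<phi> y" if "y \<in> - K" for y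
        using that outK \<open>\<And>x. x \<in> \<Omega> \<Longrightarrow> u x \<le> t \<Longrightarrow> \<phi> x = 0\<close> by (auto simp: ext_def)
    qed (use K in auto)
    have ext_near: "(ext \<phi> has_derivative L) (at x)" if "x \<in> \<Omega>" "(\<phi> has_derivative L) (at x)" for \<phi> x L
      by (rule has_derivative_transform_within_open[OF that(2) \<Omega>(1) that(1)]) (simp add: ext_def)
    let ?D = "\<lambda>x. if x \<in> \<Omega> then p (u x) *\<^sub>R gradient u x else 0"
    have Gu: "((\<lambda>x. G (u x)) has_derivative (\<lambda>h. p (u x) * (gradient u x \<bullet> h))) (at x)" if "x \<in> \<Omega>" for x
      using has_derivative_compose[OF has_derivative_gradient[OF d1[OF that]], of G "\<lambda>h. p (u x) * h"] G
      by (simp add: has_field_derivative_def)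
    have X: "c * E \<le> (\<integral>x. norm (?D x) \<partial>lborel)"
      unfolding E_def
    proof (rule sharp_sobolev_L1[OF K(1), where g="ext (\<lambda>x. G (u x))" and A="{x\<in>\<Omega>. t' < u x}"])
      show "(ext (\<lambda>x. G (u x)) has_derivative (\<bullet>) (?D x)) (at x)" for x
      proof (cases "x \<in> \<Omega>")
        case True
        have "(\<lambda>h. p (u x) * (gradient u x \<bullet> h)) = (\<bullet>) (?D x)" using True by (auto simp: fun_eq_iff)
        then show ?thesis using ext_near[OF True Gu[OF True]] by (simp only:)
      next
        case False
        then have "(\<lambda>_. 0) = (\<bullet>) (?D x)" by (auto simp: fun_eq_iff)
        then show ?thesis using ext_zero_near[OF False, of "\<lambda>x. G (u x)"] Gv(1) by (simp only:)
      qed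
      show "continuous_on UNIV ?D"
        using outK p(4) by (intro continuous_on_extend_by_zero[OF \<Omega>(1) K(2) K_sub] continuous_intros cpu cg) auto
      show "0 \<le> ext (\<lambda>x. G (u x)) x" for x using Gv by (simp add: ext_def)
    qed (use outK p(4) Gv openT a c in \<open>auto simp: ext_def\<close>)
    define P where "P = (\<integral>x. ext (\<lambda>x. p (u x)) x \<partial>lborel)"
    define Q where "Q = (\<integral>x. ext (\<lambda>x. p (u x) * (norm (gradient u x))\<^sup>2) x \<partial>lborel)"
    have iP: "integrable lborel (ext (\<lambda>x. p (u x)))"
      using p(4) by (intro int_ext cpu) auto
    have iQ: "integrable lborel (ext (\<lambda>x. p (u x) * (norm (gradient u x))\<^sup>2))"
      using p(4) by (intro int_ext continuous_intros cpu cg) auto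
    have iG: "integrable lborel (ext (\<lambda>x. G (u x) * (- laplacian u x)))"
      using Gv by (intro int_ext continuous_intros cGu cl) auto
    have nD: "norm (?D x) = ext (\<lambda>x. p (u x) * norm (gradient u x)) x" for x
      using p(2) by (simp add: ext_def)
    have iD: "integrable lborel (ext (\<lambda>x. p (u x) * norm (gradient u x)))"
      using p(4) by (intro int_ext continuous_intros cpu cg) auto
    \<comment> \<open>The quadratic in l comes from integrating p(u) (l - |\<nabla>u|)^2 \<ge>
      0.\<close>
    have CS: "(\<integral>x. norm (?D x) \<partial>lborel)\<^sup>2 \<le> P * Q"
    proof (rule square_le_of_quadratic_nonneg)
      fix l :: real assume l: "l > 0"
      have "2 * l * (\<integral>x. norm (?D x) \<partial>lborel) = (\<integral>x. 2 * l * ext (\<lambda>x. p (u x) * norm (gradient u x)) x \<partial>lborel)"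
        unfolding nD by simp
      also have "\<dots> \<le> (\<integral>x. l\<^sup>2 * ext (\<lambda>x. p (u x)) x + ext (\<lambda>x. p (u x) * (norm (gradient u x))\<^sup>2) x \<partial>lborel)"
      proof (intro integral_mono)
        fix x
        have "p (u x) * (2 * l * norm (gradient u x)) \<le> p (u x) * (l\<^sup>2 + (norm (gradient u x))\<^sup>2)"
          using p(2) by (intro mult_left_mono sum_squares_bound) auto
        then show "2 * l * ext (\<lambda>x. p (u x) * norm (gradient u x)) x
            \<le> l\<^sup>2 * ext (\<lambda>x. p (u x)) x + ext (\<lambda>x. p (u x) * (norm (gradient u x))\<^sup>2) x"
          by (simp add: ext_def algebra_simps)
      qed (use iP iQ iD in auto)
      also have "\<dots> = l\<^sup>2 * P + Q" unfolding P_def Q_def using iP iQ by simp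
      finally show "2 * l * (\<integral>x. norm (?D x) \<partial>lborel) \<le> l\<^sup>2 * P + Q" .
    qed (use p(2) in \<open>auto simp: P_def Q_def ext_def intro!: integral_nonneg_AE AE_I2\<close>)
    have Pm: "P \<le> m"
    proof -
      have "P \<le> (\<integral>x. indicator {x\<in>\<Omega>. t < u x \<and> u x \<le> t'} x \<partial>lborel)"
        unfolding P_def
      proof (intro integral_mono iP)
        show "integrable lborel (indicat_real {x \<in> \<Omega>. t < u x \<and> u x \<le> t'})"
          using m_set fin[of "{x \<in> \<Omega>. t < u x \<and> u x \<le> t'}"] by (intro integrable_real_indicator) auto
        show "ext (\<lambda>x. p (u x)) x \<le> indicat_real {x \<in> \<Omega>. t < u x \<and> u x \<le> t'} x" for x
          using p(3)[of "u x"] p(4)[of "u x"] by (auto simp: ext_def indicator_def not_less not_le)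
      qed
      then show ?thesis using m_set by (simp add: m_def)
    qed
    have green: "Q = (\<integral>x. ext (\<lambda>x. G (u x) * (- laplacian u x)) x \<partial>lborel)"
    proof -
      \<comment> \<open>The derivative of G(u) \<partial>u in direction b; summed over the basis it
        becomes p(u) |\<nabla>u|^2 + G(u) \<Delta>u.\<close>
      let ?F = "\<lambda>b x. p (u x) * (partial_deriv b u x)\<^sup>2 + G (u x) * partial_deriv b (partial_deriv b u) x"
      have cF: "continuous_on \<Omega> (?F b)" if "b \<in> Basis" for b
        using that by (intro continuous_intros cpu cGu cb c2)
      have "(\<integral>x. ext (?F b) x \<partial>lborel) = 0" if b: "b \<in> Basis" for b
      proof (rule integral_partial_derivative_compact_support[OF K(1), where F="ext (\<lambda>x. G (u x) * partial_deriv b u x)" and b=b])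
        show "((\<lambda>s. ext (\<lambda>x. G (u x) * partial_deriv b u x) (x + s *\<^sub>R b)) has_real_derivative ext (?F b) x) (at 0)" for x
        proof (cases "x \<in> \<Omega>")
          case True
          have 1: "((\<lambda>s. u (x + s *\<^sub>R b)) has_real_derivative partial_deriv b u x) (at 0)"
            using has_real_derivative_partial[of u x 0 b] d1[OF True] by simp
          have 2: "((\<lambda>s. partial_deriv b u (x + s *\<^sub>R b)) has_real_derivative partial_deriv b (partial_deriv b u) x) (at 0)"
            using has_real_derivative_partial[of "partial_deriv b u" x 0 b] d2[OF True b] by simp
          have 3: "((\<lambda>s. G (u (x + s *\<^sub>R b))) has_real_derivative p (u x) * partial_deriv b u x) (at 0)"
            using DERIV_chain2[OF _ 1, of G "p (u x)"] G by simp
          have "((\<lambda>s. G (u (x + s *\<^sub>R b)) * partial_deriv b u (x + s *\<^sub>R b)) has_real_derivative ?F b x) (at 0)"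
            by (rule DERIV_cong[OF DERIV_mult[OF 3 2]]) (simp add: power2_eq_square)
          moreover have "open ((\<lambda>s::real. x + s *\<^sub>R b) -` \<Omega>)"
            by (rule continuous_open_vimage[OF \<Omega>(1)]) (intro continuous_intros)
          moreover have "ext (?F b) x = ?F b x" using True by (simp add: ext_def)
          ultimately show ?thesis
            unfolding \<open>ext (?F b) x = ?F b x\<close>
            apply -
            apply (rule has_field_derivative_transform_within_open[where S="(\<lambda>s::real. x + s *\<^sub>R b) -` \<Omega>"
                and f="\<lambda>s. G (u (x + s *\<^sub>R b)) * partial_deriv b u (x + s *\<^sub>R b)"])
            using True by (auto simp: ext_def)
        next
          case False
          have "((\<lambda>s::real. x + s *\<^sub>R b) has_derivative (\<lambda>h. h *\<^sub>R b)) (at 0)"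
            by (auto intro!: derivative_eq_intros)
          moreover have "(ext (\<lambda>x. G (u x) * partial_deriv b u x) has_derivative (\<lambda>_. 0)) (at (x + 0 *\<^sub>R b))"
            using ext_zero_near[OF False, of "\<lambda>x. G (u x) * partial_deriv b u x"] Gv(1) by simp
          ultimately have "((\<lambda>s. ext (\<lambda>x. G (u x) * partial_deriv b u x) (x + s *\<^sub>R b)) has_derivative (\<lambda>_. 0)) (at 0)"
            by (rule has_derivative_compose)
          moreover have "(\<lambda>_. 0) = (*) (ext (?F b) x)" using False by (auto simp: ext_def)
          ultimately show ?thesis by (simp only: has_field_derivative_def)
        qed
        show "continuous_on UNIV (ext (\<lambda>x. G (u x) * partial_deriv b u x))"
          using Gv b by (intro c_ext continuous_intros cGu cb) auto
        show "continuous_on UNIV (ext (?F b))"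
          using Gv p b by (intro c_ext cF) auto
      qed (use b outK Gv p in \<open>auto simp: ext_def\<close>)
      moreover have iF: "integrable lborel (ext (?F b))" if "b \<in> Basis" for b
        using Gv p that by (intro int_ext cF) auto
      ultimately have "0 = (\<integral>x. (\<Sum>b\<in>Basis. ext (?F b) x) \<partial>lborel)"
        by (subst Bochner_Integration.integral_sum) auto
      also have "\<dots> = (\<integral>x. ext (\<lambda>x. p (u x) * (norm (gradient u x))\<^sup>2) x - ext (\<lambda>x. G (u x) * (- laplacian u x)) x \<partial>lborel)"
        by (intro Bochner_Integration.integral_cong refl)
          (simp add: ext_def norm_gradient_sq laplacian_def sum.distrib sum_distrib_left)
      also have "\<dots> = Q - (\<integral>x. ext (\<lambda>x. G (u x) * (- laplacian u x)) x \<partial>lborel)"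
        unfolding Q_def using iQ iG by simp
      finally show ?thesis by simp
    qed
    have QI: "Q \<le> c * I"
    proof -
      have "Q \<le> (\<integral>x. c * (indicator {x\<in>\<Omega>. t < u x} x * (- laplacian u x)) \<partial>lborel)"
        unfolding green
      proof (intro integral_mono iG integrable_mult_right intI)
        show "ext (\<lambda>x. G (u x) * (- laplacian u x)) x \<le> c * (indicator {x\<in>\<Omega>. t < u x} x * (- laplacian u x))" for x
          using Gv(1,4)[of "u x"] super[of x] mult_right_mono[of "G (u x)" c "- laplacian u x"]
          by (auto simp: ext_def indicator_def not_less)
      qed
      then show ?thesis unfolding I_def by simp
    qed
    have E0: "E \<ge> 0" using a by (simp add: E_def)
    have P0: "P \<ge> 0" unfolding P_def using p(2) by (intro integral_nonneg_AE AE_I2) (simp add: ext_def)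
    have Q0: "Q \<ge> 0" unfolding Q_def using p(2) by (intro integral_nonneg_AE AE_I2) (simp add: ext_def)
    have "(c * E)\<^sup>2 \<le> (\<integral>x. norm (?D x) \<partial>lborel)\<^sup>2"
      using X c E0 by (intro power_mono) auto
    also have "\<dots> \<le> P * Q" by (rule CS)
    also have "\<dots> \<le> m * (c * I)"
      using Pm QI P0 Q0 by (intro mult_mono) auto
    finally have "c * (c * E\<^sup>2) \<le> c * (m * I)" by (simp add: power_mult_distrib power2_eq_square mult_ac)
    then show ?thesis using c by (simp add: c_def)
  qed
  have "((\<lambda>\<delta>. (t' - t - \<delta>) * E\<^sup>2) \<longlongrightarrow> (t' - t - 0) * E\<^sup>2) (at_right 0)"
    by (intro tendsto_intros)
  moreover have "eventually (\<lambda>\<delta>. (t' - t - \<delta>) * E\<^sup>2 \<le> m * I) (at_right 0)"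
  proof -
    have "eventually (\<lambda>\<delta>. \<delta> \<in> {0<..<(t' - t) / 2}) (at_right 0)"
      using t by (intro eventually_at_right_real) auto
    then show ?thesis by eventually_elim (use approx in auto)
  qed
  ultimately have "(t' - t - 0) * E\<^sup>2 \<le> m * I"
    by (rule tendsto_upperbound) simp
  then show ?thesis unfolding E_def m_def I_def by simp
qed

section \<open>The rearrangement of a solution\<close>

lemma integral_density_indicator:
  fixes g :: "'a::euclidean_space \<Rightarrow> real"
  assumes [measurable]: "A \<in> sets borel" "g \<in> borel_measurable borel"
  shows "integral\<^sup>L (density lborel (indicator A)) g = (\<integral>x. indicator A x * g x \<partial>lborel)"
proof -
  have "density lborel (indicator A) = density lborel (\<lambda>x. ennreal (indicator A x))"
    by (simp add: ennreal_indicator)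
  then have "integral\<^sup>L (density lborel (indicator A)) g = integral\<^sup>L (density lborel (\<lambda>x. ennreal (indicator A x))) g"
    by (simp only:)
  also have "\<dots> = (\<integral>x. indicator A x * g x \<partial>lborel)"
    by (subst integral_density) auto
  finally show ?thesis .
qed

locale rearranged_solution =
  fixes \<Omega> :: "'a::euclidean_space set" and f :: "real \<Rightarrow> real" and u us :: "'a \<Rightarrow> real" and R :: real
  assumes \<Omega>: "open \<Omega>" "bounded \<Omega>"
    and u: "dirichlet_solution \<Omega> f u"
    and f_pos: "\<And>t. 0 \<le> t \<Longrightarrow> 0 < f t"
    and f_mono: "\<And>s t. 0 \<le> s \<Longrightarrow> s \<le> t \<Longrightarrow> f s \<le> f t"
    and f_cont: "continuous_on {0..} f"
    and R: "R > 0"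
    and us: "symmetric_decreasing_rearrangement \<Omega> u (ball 0 R) us"
begin

text \<open>The radial profile, read off along one fixed unit vector. It is continued by 0 from R
  on, where \<open>us\<close> is unspecified.\<close>

definition U :: "real \<Rightarrow> real" where
  "U r = (if r < R then us (r *\<^sub>R (SOME b. b \<in> Basis)) else 0)"

definition q :: "real \<Rightarrow> real" where "q r = f (U r)"

definition us_ext :: "'a \<Rightarrow> real" where "us_ext x = (if norm x < R then us x else 0)"

definition mass :: "real \<Rightarrow> real" where
  "mass s = (\<integral>x. indicator (ball 0 s) x * f (us_ext x) \<partial>lborel)"

lemma unit_vol_pos: "unit_ball_vol (real DIM('a)) > 0" by simp

lemma norm_SOME_Basis: "norm (SOME b::'a. b \<in> Basis) = 1"
  by (rule norm_Basis) (rule someI_ex, use nonempty_Basis in blast)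

lemma us_nonneg: "norm x < R \<Longrightarrow> 0 \<le> us x"
  using us by (simp add: symmetric_decreasing_rearrangement_def)

lemma us_antimono: "norm x \<le> norm y \<Longrightarrow> norm y < R \<Longrightarrow> us y \<le> us x"
  using us by (simp add: symmetric_decreasing_rearrangement_def)

lemma us_ext_eq: "us_ext x = U (norm x)"
proof (cases "norm x < R")
  case True
  let ?y = "norm x *\<^sub>R (SOME b::'a. b \<in> Basis)"
  have "norm ?y = norm x" by (simp add: norm_SOME_Basis)
  then have "us ?y = us x" using us_antimono[of x ?y] us_antimono[of ?y x] True by simp
  then show ?thesis using True by (simp add: us_ext_def U_def)
qed (simp add: us_ext_def U_def)

lemma U_nonneg: "0 \<le> r \<Longrightarrow> 0 \<le> U r"
  unfolding U_def using us_nonneg by (simp add: norm_SOME_Basis)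

lemma U_antimono: "0 \<le> r \<Longrightarrow> r \<le> s \<Longrightarrow> U s \<le> U r"
  unfolding U_def using us_nonneg us_antimono by (simp add: norm_SOME_Basis)

lemma q_pos: "0 \<le> r \<Longrightarrow> 0 < q r"
  unfolding q_def using U_nonneg f_pos by simp

lemma q_antimono: "0 \<le> r \<Longrightarrow> r \<le> s \<Longrightarrow> q s \<le> q r"
  unfolding q_def using U_nonneg U_antimono f_mono by simp

lemma u_nonneg: "x \<in> \<Omega> \<Longrightarrow> 0 \<le> u x"
  using u closure_subset[of \<Omega>] by (auto simp: dirichlet_solution_def)

lemma u_cont: "continuous_on \<Omega> u"
proof -
  have "continuous_on (closure \<Omega>) u" using u by (simp add: dirichlet_solution_def)
  then show ?thesis by (rule continuous_on_subset) (rule closure_subset)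
qed

lemma open_superlevel: "open {x\<in>\<Omega>. t < u x}"
  using continuous_open_preimage[OF u_cont \<Omega>(1) open_greaterThan, of t]
  by (simp add: vimage_def Int_def)

text \<open>One radius describes a level on both sides: through the volume of the superlevel set of
  u, and as the endpoint of the interval on which the profile exceeds t. It plays the role of a
  generalised inverse of \<open>U\<close> and works across jumps and flat parts.\<close>

lemma level_radius:
  assumes "0 \<le> t"
  obtains \<rho> where "0 \<le> \<rho>" "\<rho> \<le> R" "emeasure lborel {x\<in>\<Omega>. t < u x} = ennreal (unit_ball_vol (real DIM('a)) * \<rho> ^ DIM('a))"
    "{x. norm x < R \<and> t < us x} = ball 0 \<rho>" "\<And>r. 0 \<le> r \<Longrightarrow> t < U r \<longleftrightarrow> r < \<rho>"
proof -
  obtain r where r: "{x \<in> ball 0 R. us x > t} = ball 0 r"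
    "measure lebesgue (ball (0::'a) r) = measure lebesgue {x \<in> \<Omega>. u x > t}"
    using us assms unfolding symmetric_decreasing_rearrangement_def by blast
  \<comment> \<open>For an empty superlevel set the radius obtained may be negative.\<close>
  define \<rho> where "\<rho> = max 0 r"
  have b: "ball (0::'a) r = ball 0 \<rho>" by (auto simp: \<rho>_def max_def)
  have set_eq: "{x. norm x < R \<and> t < us x} = ball 0 \<rho>" using r(1) b by auto
  have \<rho>0: "0 \<le> \<rho>" by (simp add: \<rho>_def)
  have \<rho>R: "\<rho> \<le> R"
  proof (rule ccontr)
    assume "\<not> \<rho> \<le> R"
    then have "R *\<^sub>R (SOME b::'a. b \<in> Basis) \<in> ball 0 \<rho>" using R by (simp add: norm_SOME_Basis)
    then show False using R unfolding set_eq[symmetric] by (simp add: norm_SOME_Basis)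
  qed
  have "emeasure lborel {x\<in>\<Omega>. t < u x} < \<infinity>"
    using \<Omega>(2) by (intro emeasure_bounded_finite) (auto intro: bounded_subset)
  then have "emeasure lborel {x\<in>\<Omega>. t < u x} = ennreal (measure lborel {x\<in>\<Omega>. t < u x})"
    by (intro emeasure_eq_ennreal_measure) auto
  also have "measure lborel {x\<in>\<Omega>. t < u x} = measure lebesgue (ball (0::'a) \<rho>)"
    using r(2) b open_superlevel by (simp add: measure_completion)
  also have "\<dots> = unit_ball_vol (real DIM('a)) * \<rho> ^ DIM('a)"
    using content_ball[OF \<rho>0, of "0::'a"] by (simp add: measure_completion)
  finally have m: "emeasure lborel {x\<in>\<Omega>. t < u x} = ennreal (unit_ball_vol (real DIM('a)) * \<rho> ^ DIM('a))" .
  have "t < U s \<longleftrightarrow> s < \<rho>" if s: "0 \<le> s" for s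
  proof -
    have "s < \<rho> \<longleftrightarrow> s *\<^sub>R (SOME b::'a. b \<in> Basis) \<in> ball 0 \<rho>"
      using s by (simp add: norm_SOME_Basis)
    also have "\<dots> \<longleftrightarrow> s < R \<and> t < U s"
      using s unfolding set_eq[symmetric] by (auto simp: norm_SOME_Basis U_def)
    also have "\<dots> \<longleftrightarrow> t < U s" using assms by (auto simp: U_def)
    finally show ?thesis by simp
  qed
  then show ?thesis using that \<rho>0 \<rho>R m set_eq by blast
qed

lemma us_ext_measurable [measurable]: "us_ext \<in> borel_measurable borel"
proof (rule borel_measurableI_greater)
  fix t :: real
  show "{x \<in> space borel. t < us_ext x} \<in> sets borel"
  proof (cases "t < 0")
    case True
    have "{x \<in> space borel. t < us_ext x} = UNIV"
      using True us_nonneg by (force simp: us_ext_def)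
    then show ?thesis by simp
  next
    case False
    then have "0 \<le> t" by simp
    then obtain \<rho> where "0 \<le> \<rho>" "\<rho> \<le> R" "emeasure lborel {x\<in>\<Omega>. t < u x} = ennreal (unit_ball_vol (real DIM('a)) * \<rho> ^ DIM('a))"
      "{x. norm x < R \<and> t < us x} = ball 0 \<rho>" "\<And>r. 0 \<le> r \<Longrightarrow> t < U r \<longleftrightarrow> r < \<rho>"
      by (rule level_radius) blast
    moreover have "{x \<in> space borel. t < us_ext x} = {x. norm x < R \<and> t < us x}"
      using False by (auto simp: us_ext_def)
    ultimately show ?thesis by simp
  qed
qed

lemma us_ext_nonneg: "0 \<le> us_ext x"
  using us_nonneg by (simp add: us_ext_def)

text \<open>Only the values of f on the nonnegative reals are controlled. Composition with max 0
  gives a function that is continuous, hence measurable, on the whole line and agrees with f at all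
  values of u and of its rearrangement.\<close>

lemma f_max_cont: "continuous_on UNIV (\<lambda>y. f (max 0 y))"
  by (rule continuous_on_compose2[OF f_cont]) (auto intro!: continuous_intros)

lemma f_us_ext_measurable [measurable]: "(\<lambda>x. f (us_ext x)) \<in> borel_measurable borel"
proof -
  have "(\<lambda>y. f (max 0 y)) \<in> borel_measurable borel"
    by (rule borel_measurable_continuous_onI[OF f_max_cont])
  then have "(\<lambda>x. f (max 0 (us_ext x))) \<in> borel_measurable borel" by measurable
  then show ?thesis using us_ext_nonneg by (simp add: max_absorb2)
qed

text \<open>Equimeasurability as an identity of image measures: Lebesgue measure on {u > t} pushed
  forward by u, and on the ball pushed forward by \<open>us_ext\<close>, give every half-line above
  s the same mass, namely the volume of the level max s t. Hence all functions of the values have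
  equal integrals.\<close>

lemma integral_superlevel_eq:
  assumes t: "0 \<le> t" and \<rho>: "0 \<le> \<rho>" "{x. norm x < R \<and> t < us x} = ball 0 \<rho>"
  shows "(\<integral>x. indicator {x\<in>\<Omega>. t < u x} x * f (u x) \<partial>lborel) = mass \<rho>"
proof -
  define u0 where "u0 x = (if x \<in> \<Omega> then u x else 0)" for x
  have u0m[measurable]: "u0 \<in> borel_measurable borel"
  proof (rule borel_measurableI_greater)
    fix s :: real
    have "{x \<in> space borel. s < u0 x} = {x\<in>\<Omega>. s < u x} \<union> (if s < 0 then - \<Omega> else {})"
      by (auto simp: u0_def)
    then show "{x \<in> space borel. s < u0 x} \<in> sets borel"
      using open_superlevel[of s] \<Omega>(1) by auto
  qed
  have fm[measurable]: "(\<lambda>y. f (max 0 y)) \<in> borel_measurable borel"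
    by (rule borel_measurable_continuous_onI[OF f_max_cont])
  let ?A = "{x\<in>\<Omega>. t < u x}" and ?B = "ball (0::'a) \<rho>"
  have A[measurable]: "?A \<in> sets borel" using open_superlevel by auto
  let ?M = "distr (density lborel (indicator ?A)) borel u0"
  let ?N = "distr (density lborel (indicator ?B)) borel us_ext"
  have M: "emeasure ?M {s<..} = emeasure lborel {x\<in>\<Omega>. max s t < u x}" for s
  proof -
    have "emeasure ?M {s<..} = emeasure (density lborel (indicator ?A)) (u0 -` {s<..})"
      by (subst emeasure_distr) auto
    also have "\<dots> = emeasure lborel (?A \<inter> u0 -` {s<..})"
      using measurable_sets[OF u0m, of "{s<..}"] by (subst emeasure_restricted) auto
    also have "?A \<inter> u0 -` {s<..} = {x\<in>\<Omega>. max s t < u x}" by (auto simp: u0_def)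
    finally show ?thesis .
  qed
  have N: "emeasure ?N {s<..} = emeasure lborel {x. norm x < R \<and> max s t < us x}" for s
  proof -
    have "emeasure ?N {s<..} = emeasure (density lborel (indicator ?B)) (us_ext -` {s<..})"
      by (subst emeasure_distr) auto
    also have "\<dots> = emeasure lborel (?B \<inter> us_ext -` {s<..})"
      using measurable_sets[OF us_ext_measurable, of "{s<..}"] by (subst emeasure_restricted) auto
    also have "?B \<inter> us_ext -` {s<..} = {x. norm x < R \<and> max s t < us x}"
      unfolding \<rho>(2)[symmetric] by (auto simp: us_ext_def)
    finally show ?thesis .
  qed
  have "?M = ?N"
  proof (rule measure_eqI_lessThan)
    fix s
    have "0 \<le> max s t" using t by simp
    then obtain \<sigma> where "0 \<le> \<sigma>" "\<sigma> \<le> R" "emeasure lborel {x\<in>\<Omega>. max s t < u x} = ennreal (unit_ball_vol (real DIM('a)) * \<sigma> ^ DIM('a))"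
      "{x. norm x < R \<and> max s t < us x} = ball 0 \<sigma>" "\<And>r. 0 \<le> r \<Longrightarrow> max s t < U r \<longleftrightarrow> r < \<sigma>"
      by (rule level_radius) blast
    then show "emeasure ?M {s<..} = emeasure ?N {s<..}" "emeasure ?M {s<..} < \<infinity>"
      unfolding M N by (simp_all add: emeasure_lborel_ball_unit_vol)
  qed auto
  then have "integral\<^sup>L ?M (\<lambda>y. f (max 0 y)) = integral\<^sup>L ?N (\<lambda>y. f (max 0 y))" by simp
  moreover have "integral\<^sup>L ?M (\<lambda>y. f (max 0 y)) = (\<integral>x. indicator ?A x * f (max 0 (u0 x)) \<partial>lborel)"
  proof -
    have "integral\<^sup>L ?M (\<lambda>y. f (max 0 y)) = integral\<^sup>L (density lborel (indicator ?A)) (\<lambda>x. f (max 0 (u0 x)))"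
      by (rule integral_distr) auto
    also have "\<dots> = (\<integral>x. indicator ?A x * f (max 0 (u0 x)) \<partial>lborel)"
      by (rule integral_density_indicator) auto
    finally show ?thesis .
  qed
  moreover have "integral\<^sup>L ?N (\<lambda>y. f (max 0 y)) = (\<integral>x. indicator ?B x * f (max 0 (us_ext x)) \<partial>lborel)"
  proof -
    have "integral\<^sup>L ?N (\<lambda>y. f (max 0 y)) = integral\<^sup>L (density lborel (indicator ?B)) (\<lambda>x. f (max 0 (us_ext x)))"
      by (rule integral_distr) auto
    also have "\<dots> = (\<integral>x. indicator ?B x * f (max 0 (us_ext x)) \<partial>lborel)"
      by (rule integral_density_indicator) auto
    finally show ?thesis .
  qed
  moreover have "(\<lambda>x. indicator ?A x * f (max 0 (u0 x))) = (\<lambda>x. indicator ?A x * f (u x) :: real)"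
    using u_nonneg by (auto simp: fun_eq_iff u0_def indicator_def max_absorb2)
  moreover have "(\<lambda>x. indicator ?B x * f (max 0 (us_ext x))) = (\<lambda>x. indicator ?B x * f (us_ext x) :: real)"
    using us_ext_nonneg by (simp add: max_absorb2)
  ultimately show ?thesis unfolding mass_def by metis
qed

section \<open>The mass of balls and the decrease of the profile\<close>

lemma f_us_ext_bounds:
  assumes "0 \<le> r" "r \<le> norm x" "norm x \<le> s"
  shows "q s \<le> f (us_ext x)" "f (us_ext x) \<le> q r"
  using q_antimono[of "norm x" s] q_antimono[of r "norm x"] assms by (auto simp: us_ext_eq q_def)

lemma integrable_f_us_ext:
  "integrable lborel (\<lambda>x. indicator (ball 0 s) x * f (us_ext x))"
proof (rule Bochner_Integration.integrable_bound[where f="\<lambda>x. q 0 * indicator (ball 0 s) x"])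
  show "integrable lborel (\<lambda>x::'a. q 0 * indicator (ball 0 s) x)"
    by (intro integrable_mult_right integrable_real_indicator)
      (use emeasure_lborel_ball_finite in \<open>auto simp: less_top\<close>)
  show "AE x in lborel. norm (indicator (ball 0 s) x * f (us_ext x)) \<le> norm (q 0 * indicator (ball 0 s) x)"
    using f_us_ext_bounds(2)[of 0] f_pos[OF us_ext_nonneg] q_pos[of 0]
    by (intro AE_I2) (auto simp: indicator_def less_imp_le)
  have "(\<lambda>x. f (us_ext x)) \<in> borel_measurable lborel" using f_us_ext_measurable by simp
  then show "(\<lambda>x. indicator (ball 0 s) x * f (us_ext x)) \<in> borel_measurable lborel"
    by (intro borel_measurable_times borel_measurable_indicator) auto
qed

text \<open>On the shell between the radii r and s the integrand lies between q s and q r, by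
  monotonicity of the profile. These two bounds stand in for integration in polar
  coordinates.\<close>

lemma mass_diff_bounds:
  assumes "0 \<le> r" "r \<le> s"
  shows "unit_ball_vol (real DIM('a)) * (s ^ DIM('a) - r ^ DIM('a)) * q s \<le> mass s - mass r"
    and "mass s - mass r \<le> unit_ball_vol (real DIM('a)) * (s ^ DIM('a) - r ^ DIM('a)) * q r"
proof -
  let ?I = "\<lambda>x::'a. indicator (ball 0 s) x - indicator (ball 0 r) x :: real"
  have int: "integrable lborel (indicator (ball 0 s) :: 'a \<Rightarrow> real)" for s
    by (intro integrable_real_indicator) (use emeasure_lborel_ball_finite in \<open>auto simp: less_top\<close>)
  have vol: "measure lborel (ball (0::'a) s) = unit_ball_vol (real DIM('a)) * s ^ DIM('a)" if "0 \<le> s" for s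
    using content_ball[OF that, of "0::'a"] by simp
  have F: "mass s - mass r = (\<integral>x. ?I x * f (us_ext x) \<partial>lborel)"
    unfolding mass_def using integrable_f_us_ext[of s] integrable_f_us_ext[of r] by (simp add: left_diff_distrib)
  have I: "(\<integral>x. ?I x * c \<partial>lborel) = unit_ball_vol (real DIM('a)) * (s ^ DIM('a) - r ^ DIM('a)) * c" for c
    using int[of s] int[of r] assms by (simp add: vol algebra_simps)
  have i1: "integrable lborel (\<lambda>x. ?I x * c)" for c
    using int by (intro integrable_mult_left) auto
  have i2: "integrable lborel (\<lambda>x. ?I x * f (us_ext x))"
    using integrable_f_us_ext[of s] integrable_f_us_ext[of r] by (simp add: left_diff_distrib)
  have pw: "?I x * q s \<le> ?I x * f (us_ext x)" "?I x * f (us_ext x) \<le> ?I x * q r" for x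
    using f_us_ext_bounds[of r x s] assms by (auto simp: indicator_def)
  show "unit_ball_vol (real DIM('a)) * (s ^ DIM('a) - r ^ DIM('a)) * q s \<le> mass s - mass r"
    unfolding F I[symmetric] by (intro integral_mono i1 i2 pw)
  show "mass s - mass r \<le> unit_ball_vol (real DIM('a)) * (s ^ DIM('a) - r ^ DIM('a)) * q r"
    unfolding F I[symmetric] by (intro integral_mono i1 i2 pw)
qed

lemma mass_0: "mass 0 = 0" by (simp add: mass_def)

lemma mass_mono: "0 \<le> r \<Longrightarrow> r \<le> s \<Longrightarrow> mass r \<le> mass s"
proof -
  assume "0 \<le> r" "r \<le> s"
  moreover then have "0 \<le> unit_ball_vol (real DIM('a)) * (s ^ DIM('a) - r ^ DIM('a)) * q s"
    using q_pos[of s] by (intro mult_nonneg_nonneg) (auto simp: power_mono)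
  ultimately show ?thesis using mass_diff_bounds(1)[of r s] by linarith
qed

lemma mass_nonneg: "0 \<le> s \<Longrightarrow> 0 \<le> mass s"
  using mass_mono[of 0 s] mass_0 by simp

lemma mass_le: "0 \<le> s \<Longrightarrow> mass s \<le> unit_ball_vol (real DIM('a)) * s ^ DIM('a) * q 0"
  using mass_diff_bounds(2)[of 0 s] mass_0 by (simp add: zero_power)

text \<open>For levels U s < t < t' < U r, the superlevel set at t' has volume radius above r and
  the one at t has volume radius at most s. In the level estimate the isoperimetric constant, the
  volume between the levels and the integral of f(u) are thus all controlled by r and s. Then t
  decreases to U s and t' increases to U r; a jump of \<open>U\<close> does no harm.\<close>

lemma U_diff_le:
  assumes r: "0 < r" "r < s" "s \<le> R"
  shows "(U r - U s) * ((real DIM('a))\<^sup>2 * unit_ball_vol (real DIM('a)) * (r ^ (DIM('a) - 1))\<^sup>2) \<le> (s ^ DIM('a) - r ^ DIM('a)) * mass s"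
proof (cases "U s < U r")
  case True
  have F0: "0 \<le> mass s" using mass_nonneg r by simp
  have level: "(t' - t) * ((real DIM('a))\<^sup>2 * unit_ball_vol (real DIM('a)) * (r ^ (DIM('a) - 1))\<^sup>2) \<le> (s ^ DIM('a) - r ^ DIM('a)) * mass s"
    if t: "U s < t" "t < t'" "t' < U r" for t t'
  proof -
    have t0: "0 < t" using U_nonneg[of s] r t by simp
    have "0 \<le> t" "0 \<le> t'" using t t0 by auto
    from this(1) obtain \<rho> where \<rho>: "0 \<le> \<rho>" "\<rho> \<le> R" "emeasure lborel {x\<in>\<Omega>. t < u x} = ennreal (unit_ball_vol (real DIM('a)) * \<rho> ^ DIM('a))"
      "{x. norm x < R \<and> t < us x} = ball 0 \<rho>" "\<And>r. 0 \<le> r \<Longrightarrow> t < U r \<longleftrightarrow> r < \<rho>"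
      by (rule level_radius) blast
    from \<open>0 \<le> t'\<close> obtain \<rho>' where \<rho>': "0 \<le> \<rho>'" "\<rho>' \<le> R" "emeasure lborel {x\<in>\<Omega>. t' < u x} = ennreal (unit_ball_vol (real DIM('a)) * \<rho>' ^ DIM('a))"
      "{x. norm x < R \<and> t' < us x} = ball 0 \<rho>'" "\<And>r. 0 \<le> r \<Longrightarrow> t' < U r \<longleftrightarrow> r < \<rho>'"
      by (rule level_radius) blast
    have \<rho>s: "\<rho> \<le> s" using \<rho>(5)[of s] t r by auto
    have r\<rho>: "r < \<rho>'" using \<rho>'(5)[of r] t r by auto
    have le: "laplacian u x \<le> 0" if "x \<in> \<Omega>" for x
      using u that f_pos[OF u_nonneg[OF that]] unfolding dirichlet_solution_def by force
    have "(t' - t) * (unit_ball_vol (real DIM('a)) * (real DIM('a) * \<rho>' ^ (DIM('a) - 1)))\<^sup>2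
       \<le> measure lborel {x\<in>\<Omega>. t < u x \<and> u x \<le> t'}
          * (\<integral>x. indicator {x\<in>\<Omega>. t < u x} x * (- laplacian u x) \<partial>lborel)"
      using u r\<rho> r \<rho>'(3) le t t0 \<Omega> unfolding dirichlet_solution_def
      by (intro level_set_inequality) auto
    also have "(\<lambda>x. indicator {x\<in>\<Omega>. t < u x} x * (- laplacian u x)) = (\<lambda>x. indicator {x\<in>\<Omega>. t < u x} x * f (u x))"
      using u unfolding dirichlet_solution_def by (auto simp: fun_eq_iff indicator_def)
    also have "(\<integral>x. indicator {x\<in>\<Omega>. t < u x} x * f (u x) \<partial>lborel) = mass \<rho>"
      using t0 \<rho> by (intro integral_superlevel_eq) auto
    also have "measure lborel {x\<in>\<Omega>. t < u x \<and> u x \<le> t'} = unit_ball_vol (real DIM('a)) * (\<rho> ^ DIM('a) - \<rho>' ^ DIM('a))"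
    proof -
      have "{x\<in>\<Omega>. t < u x \<and> u x \<le> t'} = {x\<in>\<Omega>. t < u x} - {x\<in>\<Omega>. t' < u x}" by auto
      moreover have "measure lborel ({x\<in>\<Omega>. t < u x} - {x\<in>\<Omega>. t' < u x})
         = measure lborel {x\<in>\<Omega>. t < u x} - measure lborel {x\<in>\<Omega>. t' < u x}"
        using t \<rho>(3) open_superlevel by (intro measure_Diff) auto
      ultimately show ?thesis
        using \<rho>(1,3) \<rho>'(1,3) by (simp add: measure_def right_diff_distrib)
    qed
    finally have "(t' - t) * (unit_ball_vol (real DIM('a)) * (real DIM('a) * \<rho>' ^ (DIM('a) - 1)))\<^sup>2 \<le> unit_ball_vol (real DIM('a)) * (\<rho> ^ DIM('a) - \<rho>' ^ DIM('a)) * mass \<rho>" .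
    also have "\<dots> \<le> unit_ball_vol (real DIM('a)) * (s ^ DIM('a) - r ^ DIM('a)) * mass s"
    proof (rule mult_mono)
      have "\<rho> ^ DIM('a) \<le> s ^ DIM('a)" "r ^ DIM('a) \<le> \<rho>' ^ DIM('a)"
        using \<rho>s \<rho>(1) r\<rho> r by (auto intro: power_mono)
      then show "unit_ball_vol (real DIM('a)) * (\<rho> ^ DIM('a) - \<rho>' ^ DIM('a)) \<le> unit_ball_vol (real DIM('a)) * (s ^ DIM('a) - r ^ DIM('a))"
        by (intro mult_left_mono) auto
      show "mass \<rho> \<le> mass s" using \<rho>s \<rho>(1) by (rule mass_mono[rotated])
      have "r ^ DIM('a) \<le> s ^ DIM('a)" using r by (auto intro: power_mono)
      then show "0 \<le> unit_ball_vol (real DIM('a)) * (s ^ DIM('a) - r ^ DIM('a))" by simp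
    qed (use mass_nonneg \<rho> in auto)
    finally have A: "(t' - t) * (unit_ball_vol (real DIM('a)) * (real DIM('a) * \<rho>' ^ (DIM('a) - 1)))\<^sup>2 \<le> unit_ball_vol (real DIM('a)) * (s ^ DIM('a) - r ^ DIM('a)) * mass s" .
    have "r ^ (DIM('a) - 1) \<le> \<rho>' ^ (DIM('a) - 1)" using r\<rho> r by (intro power_mono) auto
    then have "(t' - t) * (unit_ball_vol (real DIM('a)) * (real DIM('a) * r ^ (DIM('a) - 1)))\<^sup>2 \<le> (t' - t) * (unit_ball_vol (real DIM('a)) * (real DIM('a) * \<rho>' ^ (DIM('a) - 1)))\<^sup>2"
      using r r\<rho> t by (intro mult_left_mono power_mono mult_nonneg_nonneg) auto
    from order.trans[OF this A] have "unit_ball_vol (real DIM('a)) * ((t' - t) * ((real DIM('a))\<^sup>2 * unit_ball_vol (real DIM('a)) * (r ^ (DIM('a) - 1))\<^sup>2)) \<le> unit_ball_vol (real DIM('a)) * ((s ^ DIM('a) - r ^ DIM('a)) * mass s)"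
      by (simp add: power_mult_distrib power2_eq_square mult_ac)
    then show ?thesis using unit_vol_pos by simp
  qed
  let ?C = "(real DIM('a))\<^sup>2 * unit_ball_vol (real DIM('a)) * (r ^ (DIM('a) - 1))\<^sup>2"
  have "((\<lambda>\<delta>. ((U r - \<delta>) - (U s + \<delta>)) * ?C) \<longlongrightarrow> ((U r - 0) - (U s + 0)) * ?C) (at_right 0)"
    by (intro tendsto_intros)
  moreover have "eventually (\<lambda>\<delta>. ((U r - \<delta>) - (U s + \<delta>)) * ?C \<le> (s ^ DIM('a) - r ^ DIM('a)) * mass s) (at_right 0)"
  proof -
    have "eventually (\<lambda>\<delta>. \<delta> \<in> {0<..<(U r - U s) / 2}) (at_right 0)"
      using True by (intro eventually_at_right_real) auto
    then show ?thesis
    proof eventually_elim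
      case (elim \<delta>)
      then show ?case by (intro level) auto
    qed
  qed
  ultimately have "((U r - 0) - (U s + 0)) * ?C \<le> (s ^ DIM('a) - r ^ DIM('a)) * mass s"
    by (rule tendsto_upperbound) simp
  then show ?thesis by simp
next
  case False
  then have "(U r - U s) * ((real DIM('a))\<^sup>2 * unit_ball_vol (real DIM('a)) * (r ^ (DIM('a) - 1))\<^sup>2) \<le> 0"
    by (intro mult_nonpos_nonneg) auto
  also have "0 \<le> (s ^ DIM('a) - r ^ DIM('a)) * mass s"
    using r mass_nonneg[of s] by (intro mult_nonneg_nonneg) (auto simp: power_mono)
  finally show ?thesis .
qed

end

section \<open>The radial comparison function\<close>

text \<open>If c were positive, h' would vanish at 0 and be positive just to the right of it, so h
  would exceed h 0 there. The derivative h' has to be differentiable at the single point 0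
  only.\<close>

lemma second_derivative_nonpos_at_max:
  fixes h h' :: "real \<Rightarrow> real"
  assumes "\<delta> > 0" and max: "\<And>s. \<bar>s\<bar> < \<delta> \<Longrightarrow> h s \<le> h 0"
    and h: "\<And>s. \<bar>s\<bar> < \<delta> \<Longrightarrow> (h has_real_derivative h' s) (at s)"
    and h': "(h' has_real_derivative c) (at 0)"
  shows "c \<le> 0"
proof (rule ccontr)
  assume "\<not> c \<le> 0"
  have 0: "h' 0 = 0"
    by (rule DERIV_local_max[OF h[of 0] \<open>\<delta> > 0\<close>]) (use max \<open>\<delta> > 0\<close> in auto)
  obtain d where d: "d > 0" "\<And>s. 0 < s \<Longrightarrow> s < d \<Longrightarrow> h' 0 < h' (0 + s)"
    using DERIV_pos_inc_right[OF h'] \<open>\<not> c \<le> 0\<close> by auto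
  define e where "e = min d \<delta> / 2"
  have e: "0 < e" "e < d" "e < \<delta>" using d \<open>\<delta> > 0\<close> by (auto simp: e_def)
  obtain z where z: "0 < z" "z < e" "h e - h 0 = (e - 0) * h' z"
    using MVT2[of 0 e h h'] h e by auto
  have "h' z > 0" using d(2)[of z] z e 0 by simp
  then have "h e > h 0" using z e by (smt (verit) mult_pos_pos)
  then show False using max[of e] e by simp
qed

lemma has_real_derivative_norm_line:
  fixes x b :: "'a::euclidean_space"
  assumes "x + s *\<^sub>R b \<noteq> 0"
  shows "((\<lambda>s. norm (x + s *\<^sub>R b)) has_real_derivative ((x + s *\<^sub>R b) \<bullet> b) / norm (x + s *\<^sub>R b)) (at s)"
proof -
  have "((\<lambda>s. x + s *\<^sub>R b) has_derivative (\<lambda>h. h *\<^sub>R b)) (at s)"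
    by (auto intro!: derivative_eq_intros)
  from has_derivative_compose[OF this has_derivative_norm[OF assms]]
  have "((\<lambda>s. norm (x + s *\<^sub>R b)) has_derivative (\<lambda>h. (h *\<^sub>R b) \<bullet> sgn (x + s *\<^sub>R b))) (at s)" .
  moreover have "(\<lambda>h. (h *\<^sub>R b) \<bullet> sgn (x + s *\<^sub>R b)) = (*) (((x + s *\<^sub>R b) \<bullet> b) / norm (x + s *\<^sub>R b))"
    by (simp add: fun_eq_iff sgn_div_norm inner_commute divide_inverse mult_ac)
  ultimately show ?thesis by (simp only: has_field_derivative_def)
qed

lemma power_diff_le_tangent:
  fixes r s :: real
  assumes "0 \<le> r" "r \<le> s"
  shows "s ^ m - r ^ m \<le> real m * s ^ (m - 1) * (s - r)"
proof (induction m)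
  case (Suc m)
  have "s ^ Suc m - r ^ Suc m = s * (s ^ m - r ^ m) + (s - r) * r ^ m" by (simp add: algebra_simps)
  also have "\<dots> \<le> s * (real m * s ^ (m - 1) * (s - r)) + (s - r) * s ^ m"
    using Suc assms by (intro add_mono mult_left_mono power_mono) auto
  also have "\<dots> = real (Suc m) * s ^ (Suc m - 1) * (s - r)"
    by (cases m) (auto simp: algebra_simps)
  finally show ?case .
qed simp

context rearranged_solution begin

text \<open>\<open>mass s\<close> is the integral of \<open>f(u\<^sup>*)\<close> over the ball of radius \<open>s\<close>, so \<open>-g\<close> is the radial derivative of
  the solution \<open>W\<close> of \<open>-\<Delta>W = f(u\<^sup>*)\<close>. Division by zero gives \<open>g 0 = 0\<close>, its continuous extension.\<close>

definition g :: "real \<Rightarrow> real" where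
  "g s = mass s / (real DIM('a) * unit_ball_vol (real DIM('a)) * s ^ (DIM('a) - 1))"

definition W :: "real \<Rightarrow> real" where
  "W r = integral {0..R} g - integral {0..r} g"

lemma g_nonneg: "0 \<le> s \<Longrightarrow> 0 \<le> g s"
  unfolding g_def using mass_nonneg by simp

text \<open>Replacing the right side by its maximal value \<open>q 0\<close> gives a linear bound.
  It yields continuity of g at the origin and the paraboloid below W.\<close>

lemma g_le: "0 \<le> s \<Longrightarrow> g s \<le> q 0 * s / real DIM('a)"
proof (cases "s = 0")
  case False
  assume "0 \<le> s"
  with False have s: "s > 0" by simp
  have "s ^ DIM('a) = s * s ^ (DIM('a) - 1)" by (simp add: power_eq_if)
  then show ?thesis
    using mass_le[of s] s by (simp add: g_def field_simps)
qed (simp add: g_def mass_0)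

lemma mass_continuous: "continuous_on {0..R} mass"
proof -
  have "\<bar>mass s - mass r\<bar> \<le> unit_ball_vol (real DIM('a)) * q 0 * \<bar>s ^ DIM('a) - r ^ DIM('a)\<bar>"
    if "0 \<le> r" "r \<le> s" for r s
  proof -
    have "r ^ DIM('a) \<le> s ^ DIM('a)" using that by (auto intro: power_mono)
    moreover have "unit_ball_vol (real DIM('a)) * (s ^ DIM('a) - r ^ DIM('a)) * q r \<le> unit_ball_vol (real DIM('a)) * (s ^ DIM('a) - r ^ DIM('a)) * q 0"
      using q_antimono[of 0 r] that calculation by (intro mult_left_mono) auto
    moreover have "mass s - mass r \<le> unit_ball_vol (real DIM('a)) * (s ^ DIM('a) - r ^ DIM('a)) * q r"
      by (rule mass_diff_bounds(2)[OF that])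
    ultimately have "mass s - mass r \<le> unit_ball_vol (real DIM('a)) * (s ^ DIM('a) - r ^ DIM('a)) * q 0"
      by linarith
    then show ?thesis
      using mass_mono[OF that] \<open>r ^ DIM('a) \<le> s ^ DIM('a)\<close> by (simp add: mult_ac)
  qed
  then have lip: "\<bar>mass s - mass r\<bar> \<le> unit_ball_vol (real DIM('a)) * q 0 * \<bar>s ^ DIM('a) - r ^ DIM('a)\<bar>"
    if "0 \<le> r" "0 \<le> s" for r s
    using that by (metis abs_minus_commute linear)
  show ?thesis
    unfolding continuous_on_def
  proof
    fix r assume "r \<in> {0..R}"
    have "((\<lambda>s. unit_ball_vol (real DIM('a)) * q 0 * \<bar>s ^ DIM('a) - r ^ DIM('a)\<bar>) \<longlongrightarrow>
         unit_ball_vol (real DIM('a)) * q 0 * \<bar>r ^ DIM('a) - r ^ DIM('a)\<bar>) (at r within {0..R})"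
      by (intro tendsto_intros)
    then have "((\<lambda>s. unit_ball_vol (real DIM('a)) * q 0 * \<bar>s ^ DIM('a) - r ^ DIM('a)\<bar>) \<longlongrightarrow> 0) (at r within {0..R})"
      by simp
    moreover have "eventually (\<lambda>s. norm (mass s - mass r) \<le> norm (unit_ball_vol (real DIM('a)) * q 0 * \<bar>s ^ DIM('a) - r ^ DIM('a)\<bar>) * 1) (at r within {0..R})"
      unfolding eventually_at_filter
    proof (intro always_eventually allI impI)
      fix s assume "s \<in> {0..R}"
      then have "\<bar>mass s - mass r\<bar> \<le> unit_ball_vol (real DIM('a)) * q 0 * \<bar>s ^ DIM('a) - r ^ DIM('a)\<bar>"
        using \<open>r \<in> {0..R}\<close> by (intro lip) auto
      from order.trans[OF this abs_ge_self]
      show "norm (mass s - mass r) \<le> norm (unit_ball_vol (real DIM('a)) * q 0 * \<bar>s ^ DIM('a) - r ^ DIM('a)\<bar>) * 1"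
        by simp
    qed
    ultimately have "((\<lambda>s. mass s - mass r) \<longlongrightarrow> 0) (at r within {0..R})"
      by (rule tendsto_0_le)
    then show "(mass \<longlongrightarrow> mass r) (at r within {0..R})"
      by (rule LIM_zero_cancel)
  qed
qed

lemma g_continuous: "continuous_on {0..R} g"
  unfolding continuous_on_eq_continuous_within
proof
  fix s assume s: "s \<in> {0..R}"
  show "continuous (at s within {0..R}) g"
  proof (cases "s = 0")
    case True
    have "((\<lambda>s. q 0 * s / real DIM('a)) \<longlongrightarrow> q 0 * 0 / real DIM('a)) (at 0 within {0..R})"
      by (intro tendsto_intros) auto
    then have "(g \<longlongrightarrow> 0) (at 0 within {0..R})"
      by (intro tendsto_sandwich[of "\<lambda>_. 0" g _ "\<lambda>s. q 0 * s / real DIM('a)"])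
        (auto simp: eventually_at_filter g_nonneg g_le)
    then show ?thesis using True by (simp add: continuous_within g_def mass_0)
  next
    case False
    have "continuous (at s within {0..R}) mass"
      using mass_continuous s by (simp add: continuous_on_eq_continuous_within)
    then show ?thesis
      unfolding g_def[abs_def] using False s less_imp_neq[OF unit_vol_pos] by (intro continuous_intros) auto
  qed
qed

lemma W_deriv_within: "r \<in> {0..R} \<Longrightarrow> (W has_real_derivative - g r) (at r within {0..R})"
  unfolding W_def[abs_def]
  using integral_has_real_derivative[OF g_continuous, of r]
  by (auto intro!: derivative_eq_intros)

lemma W_deriv: "0 < r \<Longrightarrow> r < R \<Longrightarrow> (W has_real_derivative - g r) (at r)"
  using W_deriv_within[of r] at_within_interior[of r "{0..R}"] by simp

lemma W_continuous: "continuous_on {0..R} W"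
  unfolding continuous_on_eq_continuous_within
  using DERIV_continuous[OF W_deriv_within] by blast

lemma W_diff_MVT:
  assumes "0 \<le> r" "r < s" "s \<le> R"
  obtains z where "r < z" "z < s" "W r - W s = (s - r) * g z"
proof -
  have "continuous_on {r..s} W" using W_continuous assms by (auto intro: continuous_on_subset)
  moreover have "(W has_derivative (\<lambda>h. - g z * h)) (at z)" if "r < z" "z < s" for z
  proof -
    have "(W has_real_derivative - g z) (at z)" using that assms by (intro W_deriv) auto
    then show ?thesis by (simp only: has_field_derivative_def)
  qed
  ultimately obtain z where "r < z" "z < s" "W s - W r = - g z * (s - r)"
    using mvt[OF assms(2), of W "\<lambda>z h. - g z * h"] by blast
  then show ?thesis using that[of z] by (simp add: algebra_simps)
qed

lemma W_R: "W R = 0" by (simp add: W_def)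

lemma W_antimono: "0 \<le> r \<Longrightarrow> r \<le> s \<Longrightarrow> s \<le> R \<Longrightarrow> W s \<le> W r"
proof (cases "r = s")
  case False
  assume a: "0 \<le> r" "r \<le> s" "s \<le> R"
  with False obtain z where z: "r < z" "z < s" "W r - W s = (s - r) * g z" using W_diff_MVT[of r s] by auto
  then have "0 \<le> (s - r) * g z" using g_nonneg[of z] a by simp
  then show ?thesis using z by linarith
qed simp

text \<open>The paraboloid has -\<Delta> equal to \<open>q 0\<close>, and its slope q 0 r / n
  dominates g, so W falls no faster.\<close>

lemma W_lower_at_0: "0 \<le> r \<Longrightarrow> r \<le> R \<Longrightarrow> W 0 - q 0 / (2 * real DIM('a)) * r\<^sup>2 \<le> W r"
proof -
  assume r: "0 \<le> r" "r \<le> R"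
  let ?h = "\<lambda>s. W s + q 0 / (2 * real DIM('a)) * s\<^sup>2"
  have "?h 0 \<le> ?h r"
  proof (cases "r = 0")
    case False
    have cont: "continuous_on {0..r} ?h"
      using W_continuous r by (intro continuous_intros) (auto intro: continuous_on_subset)
    have "(?h has_real_derivative (- g z + q 0 * z / real DIM('a))) (at z)" if "0 < z" "z < r" for z
      using W_deriv[of z] that r by (auto intro!: derivative_eq_intros simp: field_simps)
    moreover have "0 \<le> - g z + q 0 * z / real DIM('a)" if "0 < z" for z
      using g_le[of z] that by simp
    ultimately show ?thesis
      by (intro DERIV_nonneg_imp_increasing_open[OF r(1) _ cont]) blast
  qed simp
  then show ?thesis by simp
qed

section \<open>Comparison of the profile with W\<close>

lemma U_R: "U R = 0" by (simp add: U_def)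

text \<open>\<open>U_diff_le\<close> says that \<open>U\<close> decreases no faster than \<open>W\<close> infinitesimally; the Bolzano
  induction on intervals turns this into an inequality between increments without any continuity
  of \<open>U\<close>.\<close>

lemma U_le_W_pos:
  assumes r0: "0 < r0" "r0 \<le> R"
  shows "U r0 \<le> W r0"
proof -
  define c where "c = real DIM('a) * unit_ball_vol (real DIM('a))"
  have c: "c > 0" by (simp add: c_def)
  \<comment> \<open>The bound of \<open>U_diff_le\<close> per unit of s - r, after s^n - r^n \<le> n
    s^(n-1) (s - r). Unlike that bound it is a continuous function of both radii, and on the
    diagonal it is g.\<close>
  define H where "H p = snd p ^ (DIM('a) - 1) * mass (snd p) / (c * (fst p ^ (DIM('a) - 1))\<^sup>2)" for p
  have H_diag: "H (x, x) = g x" if "x > 0" for x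
    using that c by (simp add: H_def g_def c_def power2_eq_square)
  have H_cont: "continuous_on ({r0..R} \<times> {r0..R}) H"
  proof -
    have "continuous_on ({r0..R} \<times> {r0..R}) (\<lambda>p. mass (snd p))"
      using r0 by (intro continuous_on_compose2[OF mass_continuous] continuous_intros) auto
    then show ?thesis
      unfolding H_def[abs_def] using c r0 by (intro continuous_intros) auto
  qed
  have step: "U r - U s \<le> (s - r) * H (r, s)" if "r0 \<le> r" "r < s" "s \<le> R" for r s
  proof -
    let ?A = "real DIM('a) * (c * (r ^ (DIM('a) - 1))\<^sup>2)"
    have A: "?A > 0" using c that r0 by simp
    have "(U r - U s) * ?A \<le> (s ^ DIM('a) - r ^ DIM('a)) * mass s"
      using U_diff_le[of r s] that r0 by (simp add: c_def power2_eq_square mult_ac)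
    also have "\<dots> \<le> (real DIM('a) * s ^ (DIM('a) - 1) * (s - r)) * mass s"
      using that r0 mass_nonneg[of s] by (intro mult_right_mono power_diff_le_tangent) auto
    also have "\<dots> = (s - r) * H (r, s) * ?A"
      using c that r0 by (simp add: H_def power2_eq_square)
    finally show ?thesis using A by (rule mult_right_le_imp_le)
  qed
  have main: "U r0 - U R \<le> W r0 - W R + \<epsilon> * (R - r0)" if \<epsilon>: "\<epsilon> > 0" for \<epsilon>
  proof -
    \<comment> \<open>The increments are additive over adjacent intervals, so Bolzano only asks for
      short ones. There \<epsilon> is shared between the deviation of H from its diagonal value and
      that of g at the mean value point. The inequality is conditional because the short intervals
      may stick out of [r0, R].\<close>
    define P where "P r s \<longleftrightarrow> (r0 \<le> r \<longrightarrow> r \<le> s \<longrightarrow> s \<le> R \<longrightarrow> U r - U s \<le> W r - W s + \<epsilon> * (s - r))" for r s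
    have "P r0 R" using r0(2)
    proof (induction rule: Bolzano)
      case (trans a b d)
      then show ?case unfolding P_def by (auto simp: algebra_simps)
    next
      case (local x)
      then have x: "x \<in> {r0..R}" "x > 0" using r0 by auto
      obtain d1 where d1: "d1 > 0" "\<And>p. p \<in> {r0..R} \<times> {r0..R} \<Longrightarrow> dist p (x, x) < d1 \<Longrightarrow> dist (H p) (H (x, x)) < \<epsilon> / 2"
        using H_cont x \<epsilon> unfolding continuous_on_iff by (metis half_gt_zero mem_Sigma_iff)
      obtain d2 where d2: "d2 > 0" "\<And>z. z \<in> {0..R} \<Longrightarrow> dist z x < d2 \<Longrightarrow> dist (g z) (g x) < \<epsilon> / 2"
        using g_continuous x \<epsilon> unfolding continuous_on_iff by (metis half_gt_zero atLeastAtMost_iff less_imp_le)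
      show ?case
      proof (intro exI[of _ "min (d1 / 2) d2"] conjI allI impI)
        show "0 < min (d1 / 2) d2" using d1 d2 by simp
        fix a b assume ab: "a \<le> x \<and> x \<le> b \<and> b - a < min (d1 / 2) d2"
        show "P a b"
          unfolding P_def
        proof (intro impI)
          assume *: "r0 \<le> a" "a \<le> b" "b \<le> R"
          show "U a - U b \<le> W a - W b + \<epsilon> * (b - a)"
          proof (cases "a = b")
            case False
            then have ab': "a < b" using * by simp
            obtain z where z: "a < z" "z < b" "W a - W b = (b - a) * g z"
              using W_diff_MVT[of a b] ab' * r0 by auto
            have "dist (a, b) (x, x) \<le> \<bar>a - x\<bar> + \<bar>b - x\<bar>"
              unfolding dist_Pair_Pair dist_real_def by (rule sqrt_sum_squares_le_sum) auto
            then have "dist (a, b) (x, x) < d1" using ab by auto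
            then have 1: "H (a, b) < g x + \<epsilon> / 2"
            proof -
              have "\<bar>H (a, b) - g x\<bar> < \<epsilon> / 2"
                using d1(2)[of "(a, b)"] \<open>dist (a, b) (x, x) < d1\<close> * ab H_diag[OF x(2)] by (simp add: dist_real_def)
              then show ?thesis by linarith
            qed
            have 2: "g z > g x - \<epsilon> / 2"
            proof -
              have "\<bar>z - x\<bar> < d2" using z ab by (simp add: abs_if)
              then have "\<bar>g z - g x\<bar> < \<epsilon> / 2"
                using d2(2)[of z] z ab * r0 by (simp add: dist_real_def)
              then show ?thesis by linarith
            qed
            have "U a - U b \<le> (b - a) * H (a, b)" using step[of a b] * ab' by simp
            also have "\<dots> \<le> (b - a) * (g z + \<epsilon>)" using 1 2 ab' by (intro mult_left_mono) auto
            also have "\<dots> = W a - W b + \<epsilon> * (b - a)" using z by (simp add: algebra_simps)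
            finally show ?thesis .
          qed simp
        qed
      qed
    qed
    then show ?thesis unfolding P_def using r0 by simp
  qed
  have "((\<lambda>\<epsilon>. W r0 - W R + \<epsilon> * (R - r0)) \<longlongrightarrow> W r0 - W R + 0 * (R - r0)) (at_right 0)"
    by (intro tendsto_intros)
  moreover have "eventually (\<lambda>\<epsilon>. U r0 - U R \<le> W r0 - W R + \<epsilon> * (R - r0)) (at_right 0)"
    using main by (auto simp: eventually_at_filter)
  ultimately have "U r0 - U R \<le> W r0 - W R + 0 * (R - r0)"
    by (rule tendsto_lowerbound) simp
  then show ?thesis by (simp add: U_R W_R)
qed

text \<open>The increment estimate excludes the origin, where \<open>U\<close> might still be too
  large. But {U > W 0} is an interval [0, \<rho>); if it contains 0, it contains \<rho>/2, where the
  estimate holds and W is at most W 0.\<close>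

lemma U_le_W:
  assumes "0 \<le> r" "r \<le> R"
  shows "U r \<le> W r"
proof (cases "r = 0")
  case True
  show ?thesis
  proof (rule ccontr)
    assume "\<not> U r \<le> W r"
    then have less: "W 0 < U 0" using True by simp
    have W0: "0 \<le> W 0" using W_antimono[of 0 R] W_R R by simp
    obtain \<rho> where \<rho>: "0 \<le> \<rho>" "\<rho> \<le> R" "emeasure lborel {x\<in>\<Omega>. W 0 < u x} = ennreal (unit_ball_vol (real DIM('a)) * \<rho> ^ DIM('a))"
      "{x. norm x < R \<and> W 0 < us x} = ball 0 \<rho>" "\<And>r. 0 \<le> r \<Longrightarrow> W 0 < U r \<longleftrightarrow> r < \<rho>"
      using W0 by (rule level_radius) blast
    then have "0 < \<rho>" using less by blast
    then have "W 0 < U (\<rho> / 2)" using \<rho>(5)[of "\<rho> / 2"] by simp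
    moreover have "U (\<rho> / 2) \<le> W (\<rho> / 2)" using \<open>0 < \<rho>\<close> \<rho> by (intro U_le_W_pos) auto
    moreover have "W (\<rho> / 2) \<le> W 0" using \<open>0 < \<rho>\<close> \<rho> by (intro W_antimono) auto
    ultimately show False by simp
  qed
next
  case False
  then show ?thesis using U_le_W_pos assms by simp
qed

text \<open>Keeping both radii above x/2 bounds the factor r^(n-1) in \<open>U_diff_le\<close> away
  from 0, so the increments of \<open>U\<close> are controlled by those of r^n. Through
  \<open>q\<close> this makes the mass differentiable, which the second derivatives of W
  require.\<close>

lemma U_continuous:
  assumes "0 < x" "x < R"
  shows "isCont U x"
proof -
  define c where "c = (real DIM('a))\<^sup>2 * unit_ball_vol (real DIM('a)) * ((x / 2) ^ (DIM('a) - 1))\<^sup>2"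
  have c: "c > 0" using assms by (simp add: c_def)
  have lip0: "\<bar>U s - U r\<bar> \<le> \<bar>s ^ DIM('a) - r ^ DIM('a)\<bar> * mass R / c" if "x / 2 < r" "r < s" "s < R" for r s
  proof -
    have r: "r > 0" using that assms by simp
    have UU: "0 \<le> U r - U s" using U_antimono[of r s] that r by simp
    have pw: "r ^ DIM('a) \<le> s ^ DIM('a)" using that r by (auto intro: power_mono)
    have "(U r - U s) * c \<le> (U r - U s) * ((real DIM('a))\<^sup>2 * unit_ball_vol (real DIM('a)) * (r ^ (DIM('a) - 1))\<^sup>2)"
      unfolding c_def using UU that assms by (intro mult_left_mono power_mono) auto
    also have "\<dots> \<le> (s ^ DIM('a) - r ^ DIM('a)) * mass s" using that r by (intro U_diff_le) auto
    also have "\<dots> \<le> (s ^ DIM('a) - r ^ DIM('a)) * mass R"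
      using that r pw by (intro mult_left_mono mass_mono) auto
    finally show ?thesis using c UU pw by (simp add: pos_le_divide_eq)
  qed
  have lip: "\<bar>U s - U x\<bar> \<le> \<bar>s ^ DIM('a) - x ^ DIM('a)\<bar> * mass R / c" if "x / 2 < s" "s < R" for s
    using lip0[of x s] lip0[of s x] that assms
    by (cases s x rule: linorder_cases) (auto simp: abs_minus_commute)
  have "((\<lambda>s. \<bar>s ^ DIM('a) - x ^ DIM('a)\<bar> * mass R / c) \<longlongrightarrow> \<bar>x ^ DIM('a) - x ^ DIM('a)\<bar> * mass R / c) (at x)"
    using c by (intro tendsto_intros) auto
  then have "((\<lambda>s. \<bar>s ^ DIM('a) - x ^ DIM('a)\<bar> * mass R / c) \<longlongrightarrow> 0) (at x)" by simp
  moreover have "eventually (\<lambda>s. s \<in> {x/2<..<R}) (at x)"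
    using assms by (intro eventually_at_in_open') auto
  then have "eventually (\<lambda>s. norm (U s - U x) \<le> norm (\<bar>s ^ DIM('a) - x ^ DIM('a)\<bar> * mass R / c) * 1) (at x)"
  proof eventually_elim
    case (elim s)
    then have "\<bar>U s - U x\<bar> \<le> \<bar>s ^ DIM('a) - x ^ DIM('a)\<bar> * mass R / c" by (intro lip) auto
    from order.trans[OF this abs_ge_self] show ?case by (simp only: real_norm_def mult_1_right)
  qed
  ultimately have "((\<lambda>s. U s - U x) \<longlongrightarrow> 0) (at x)"
    by (rule tendsto_0_le)
  then show ?thesis unfolding isCont_def by (rule LIM_zero_cancel)
qed

lemma q_continuous:
  assumes "0 < x" "x < R"
  shows "isCont q x"
proof -
  have "isCont (\<lambda>y. f (max 0 y)) (U x)"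
    using f_max_cont continuous_on_eq_continuous_at[OF open_UNIV] by blast
  then have c: "isCont (\<lambda>s. f (max 0 (U s))) x"
    by (rule isCont_o2[OF U_continuous[OF assms]])
  have e: "eventually (\<lambda>s. f (max 0 (U s)) = q s) (nhds x)"
  proof -
    have "eventually (\<lambda>s. s \<in> {0<..}) (nhds x)"
      using assms by (intro eventually_nhds_in_open) auto
    then show ?thesis
      by eventually_elim (simp add: q_def max_absorb2 U_nonneg)
  qed
  show ?thesis using c isCont_cong[OF e] by simp
qed

text \<open>The shell bounds place the increment of mass within |N b - N s| |q b - q s| of q s (N b
  - N s), where N is the volume of the ball. Continuity of q makes this error of smaller order than
  b - s.\<close>

lemma mass_deriv:
  assumes s: "0 < s" "s < R"
  shows "(mass has_real_derivative unit_ball_vol (real DIM('a)) * (real DIM('a) * s ^ (DIM('a) - 1)) * q s) (at s)"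
proof -
  define N where "N r = unit_ball_vol (real DIM('a)) * r ^ DIM('a)" for r :: real
  define N' where "N' = unit_ball_vol (real DIM('a)) * (real DIM('a) * s ^ (DIM('a) - 1))"
  have N: "(N has_real_derivative N') (at s)"
    unfolding N_def[abs_def] N'_def by (auto intro!: derivative_eq_intros)
  have key: "\<bar>mass b - mass s - q s * (N b - N s)\<bar> \<le> \<bar>N b - N s\<bar> * \<bar>q b - q s\<bar>" if b: "0 < b" for b
  proof (cases "b \<ge> s")
    case True
    have "s ^ DIM('a) \<le> b ^ DIM('a)" using True s by (auto intro: power_mono)
    then have "N s \<le> N b" by (simp add: N_def)
    then show ?thesis
      using mass_diff_bounds[of s b] True s q_antimono[of s b]
      by (simp add: N_def right_diff_distrib left_diff_distrib mult_ac)
  next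
    case False
    have "b ^ DIM('a) \<le> s ^ DIM('a)" using False b by (auto intro: power_mono)
    then have "N b \<le> N s" by (simp add: N_def)
    then show ?thesis
      using mass_diff_bounds[of b s] False b q_antimono[of b s]
      by (simp add: N_def right_diff_distrib left_diff_distrib mult_ac)
  qed
  have qN: "((\<lambda>b. (N b - N s) / (b - s)) \<longlongrightarrow> N') (at s)"
    using N by (simp add: has_field_derivative_iff)
  have q0: "((\<lambda>b. q b - q s) \<longlongrightarrow> 0) (at s)"
    using q_continuous[OF s] unfolding isCont_def by (rule LIM_zero)
  have "((\<lambda>b. (N b - N s) / (b - s) * (q b - q s)) \<longlongrightarrow> N' * 0) (at s)"
    by (intro tendsto_mult qN q0)
  then have "((\<lambda>b. (N b - N s) / (b - s) * (q b - q s)) \<longlongrightarrow> 0) (at s)" by simp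
  moreover have "eventually (\<lambda>b. b \<in> {0<..}) (at s)"
    using s by (intro eventually_at_in_open') auto
  then have "eventually (\<lambda>b. norm ((mass b - mass s) / (b - s) - q s * ((N b - N s) / (b - s)))
     \<le> norm ((N b - N s) / (b - s) * (q b - q s)) * 1) (at s)"
  proof eventually_elim
    case (elim b)
    have "(mass b - mass s) / (b - s) - q s * ((N b - N s) / (b - s)) = (mass b - mass s - q s * (N b - N s)) / (b - s)"
      by (simp add: diff_divide_distrib[symmetric])
    then show ?case
      using key[of b] elim by (simp add: abs_mult divide_right_mono)
  qed
  ultimately have "((\<lambda>b. (mass b - mass s) / (b - s) - q s * ((N b - N s) / (b - s))) \<longlongrightarrow> 0) (at s)"
    by (rule tendsto_0_le)
  from tendsto_add[OF this tendsto_mult[OF tendsto_const[of "q s"] qN]]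
  have "((\<lambda>b. (mass b - mass s) / (b - s)) \<longlongrightarrow> q s * N') (at s)" by simp
  then show ?thesis by (simp add: has_field_derivative_iff N'_def mult.commute)
qed

end

section \<open>The maximum principle\<close>

lemma norm_sq_line:
  fixes x b :: "'a::euclidean_space"
  assumes "b \<in> Basis"
  shows "(norm (x + s *\<^sub>R b))\<^sup>2 = (norm x)\<^sup>2 + 2 * s * (x \<bullet> b) + s\<^sup>2"
proof -
  have "(norm (x + s *\<^sub>R b))\<^sup>2 = x \<bullet> x + 2 * s * (x \<bullet> b) + s * (s * (b \<bullet> b))"
    by (simp add: power2_norm_eq_inner inner_add_left inner_add_right inner_commute)
  then show ?thesis using assms by (simp add: power2_norm_eq_inner[of x] power2_eq_square[of s])
qed

context rearranged_solution begin

text \<open>The mean of the right side over the ball of radius r, divided by n. It equals g r / r,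
  so the gradient of W(|x|) is -k(|x|) x, which is simpler to differentiate again than g(|x|) times
  a unit vector.\<close>

definition k :: "real \<Rightarrow> real" where
  "k r = mass r / (real DIM('a) * unit_ball_vol (real DIM('a)) * r ^ DIM('a))"

lemma g_eq_k: "0 < r \<Longrightarrow> g r = r * k r"
  by (simp add: g_def k_def power_eq_if)

lemma k_deriv:
  assumes r: "0 < r" "r < R"
  shows "(k has_real_derivative (q r - real DIM('a) * k r) / r) (at r)"
proof -
  define w where "w = unit_ball_vol (real DIM('a))"
  define p where "p = r ^ (DIM('a) - 1)"
  define m where "m = real DIM('a)"
  have pos: "w > 0" "p > 0" "m > 0" using r by (auto simp: w_def p_def m_def)
  have pow: "r ^ DIM('a) = r * p" by (simp add: p_def power_eq_if)
  have "((\<lambda>r. mass r / (m * w * r ^ DIM('a))) has_real_derivative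
      (w * (m * p) * q r * (m * w * r ^ DIM('a)) - mass r * (m * w * (m * p))) / (m * w * r ^ DIM('a) * (m * w * r ^ DIM('a)))) (at r)"
  proof (rule DERIV_divide)
    show "(mass has_real_derivative w * (m * p) * q r) (at r)"
      using mass_deriv[OF r] by (simp add: w_def m_def p_def)
    show "((\<lambda>r. m * w * r ^ DIM('a)) has_real_derivative m * w * (m * p)) (at r)"
      unfolding m_def p_def by (auto intro!: derivative_eq_intros)
  qed (use pos r in auto)
  moreover have "(w * (m * p) * q r * (m * w * r ^ DIM('a)) - mass r * (m * w * (m * p))) / (m * w * r ^ DIM('a) * (m * w * r ^ DIM('a)))
      = (q r - m * (mass r / (m * w * r ^ DIM('a)))) / r"
    unfolding pow using pos r by (simp add: field_simps)
  ultimately show ?thesis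
    unfolding k_def[abs_def] w_def m_def by simp
qed

lemma W_line_deriv:
  fixes x b :: 'a
  assumes "x + s *\<^sub>R b \<noteq> 0" "norm (x + s *\<^sub>R b) < R"
  shows "((\<lambda>s. W (norm (x + s *\<^sub>R b))) has_real_derivative
    - (k (norm (x + s *\<^sub>R b)) * ((x + s *\<^sub>R b) \<bullet> b))) (at s)"
proof -
  let ?r = "norm (x + s *\<^sub>R b)"
  have r: "0 < ?r" using assms by simp
  have "((\<lambda>s. W (norm (x + s *\<^sub>R b))) has_real_derivative - g ?r * (((x + s *\<^sub>R b) \<bullet> b) / ?r)) (at s)"
    using DERIV_chain2[OF W_deriv[OF r assms(2)] has_real_derivative_norm_line[OF assms(1)]] .
  moreover have "- g ?r * (((x + s *\<^sub>R b) \<bullet> b) / ?r) = - (k ?r * ((x + s *\<^sub>R b) \<bullet> b))"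
    using r by (simp add: g_eq_k)
  ultimately show ?thesis by simp
qed

text \<open>Summed over the basis, the squares (x \<bullet> b)^2 give |x|^2 and the terms n k
  cancel, which leaves -\<Delta>W = q(|x|).\<close>

lemma W_line_deriv2:
  fixes x b :: 'a
  assumes b: "b \<in> Basis" and x: "x \<noteq> 0" "norm x < R"
  shows "((\<lambda>s. - (k (norm (x + s *\<^sub>R b)) * ((x + s *\<^sub>R b) \<bullet> b))) has_real_derivative
    - ((q (norm x) - real DIM('a) * k (norm x)) / (norm x)\<^sup>2 * (x \<bullet> b)\<^sup>2 + k (norm x))) (at 0)"
proof -
  have r: "0 < norm x" using x by simp
  have "((\<lambda>s. norm (x + s *\<^sub>R b)) has_real_derivative (x \<bullet> b) / norm x) (at 0)"
    using has_real_derivative_norm_line[of x 0 b] x by simp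
  moreover have "(k has_real_derivative (q (norm x) - real DIM('a) * k (norm x)) / norm x) (at (norm (x + 0 *\<^sub>R b)))"
    using k_deriv[OF r x(2)] by simp
  ultimately have 1: "((\<lambda>s. k (norm (x + s *\<^sub>R b))) has_real_derivative
      (q (norm x) - real DIM('a) * k (norm x)) / norm x * ((x \<bullet> b) / norm x)) (at 0)"
    by (rule DERIV_chain2[rotated])
  have "((\<lambda>s. x \<bullet> b + s) has_real_derivative 1) (at 0)" by (auto intro!: derivative_eq_intros)
  then have 2: "((\<lambda>s. (x + s *\<^sub>R b) \<bullet> b) has_real_derivative 1) (at 0)"
    using b by (simp add: inner_add_left)
  show ?thesis
    by (rule DERIV_cong[OF DERIV_minus[OF DERIV_mult[OF 1 2]]]) (simp add: power2_eq_square)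
qed

text \<open>Adding \<kappa>|x|^2 to W - v moves the maximum off the sphere, on which W and v vanish.
  At an interior maximum the second derivatives along the basis vectors are at most 0, yet they sum
  to -q + f(v) + 2n\<kappa>, which \<open>q_le\<close> makes positive.\<close>

lemma W_le_solution:
  fixes v :: "'a \<Rightarrow> real"
  assumes v: "dirichlet_solution (ball 0 R) f v"
    and L: "0 \<le> L" "L * R\<^sup>2 < 2 * real DIM('a)"
    and lip: "\<And>s t. 0 \<le> s \<Longrightarrow> s \<le> t \<Longrightarrow> f t - f s \<le> L * (t - s)"
    and x: "norm x \<le> R"
  shows "W (norm x) \<le> v x"
proof (rule ccontr)
  assume neg: "\<not> W (norm x) \<le> v x"
  define m where "m = real DIM('a)"
  have m: "m > 0" by (simp add: m_def)
  have C2: "Ck_on 2 (ball 0 R) v" and cv: "continuous_on (cball 0 R) v"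
    and v0: "\<And>x. norm x \<le> R \<Longrightarrow> 0 \<le> v x" and veq: "\<And>x. norm x < R \<Longrightarrow> - laplacian v x = f (v x)"
    and vb: "\<And>x. norm x = R \<Longrightarrow> v x = 0"
    using v R by (auto simp: dirichlet_solution_def)
  note d1 = Ck_on_2D(1)[OF C2] and d2 = Ck_on_2D(2)[OF C2]
  have cW: "continuous_on (cball (0::'a) R) (\<lambda>x. W (norm x))"
    by (rule continuous_on_compose2[OF W_continuous]) (auto intro: continuous_intros)
  have ne: "cball (0::'a) R \<noteq> {}" using R by auto
  have "continuous_on (cball 0 R) (\<lambda>x. W (norm x) - v x)" using cW cv by (rule continuous_on_diff)
  then obtain x1 where x1: "norm x1 \<le> R" "\<And>y. norm y \<le> R \<Longrightarrow> W (norm y) - v y \<le> W (norm x1) - v x1"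
    using continuous_attains_sup[OF compact_cball ne] unfolding mem_cball_0 Ball_def Bex_def by blast
  define M where "M = W (norm x1) - v x1"
  have M: "M > 0" using neg x1(2)[OF x] by (simp add: M_def)
  have "L * M / (2 * m) < M / R\<^sup>2"
    using mult_strict_right_mono[OF L(2) M] m R by (simp add: m_def field_simps)
  \<comment> \<open>The lower bound makes 2n\<kappa> exceed L M, the possible surplus of the right
    side; the upper bound keeps the boundary value \<kappa>R^2 below M. Both are possible because L
    R^2 < 2n.\<close>
  then obtain \<kappa> where \<kappa>: "L * M / (2 * m) < \<kappa>" "\<kappa> < M / R\<^sup>2" using dense by blast
  have \<kappa>1: "L * M < 2 * m * \<kappa>" using \<kappa>(1) m by (simp add: field_simps)
  have \<kappa>2: "\<kappa> * R\<^sup>2 < M" using \<kappa>(2) R by (simp add: field_simps)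
  have "0 \<le> L * M / (2 * m)" using L M m by simp
  then have \<kappa>0: "\<kappa> > 0" using \<kappa>(1) by linarith
  define z where "z y = W (norm y) - v y + \<kappa> * (norm y)\<^sup>2" for y
  have "continuous_on (cball 0 R) z" unfolding z_def
    by (intro continuous_on_add continuous_on_diff cW cv) (intro continuous_intros)
  then obtain x0 where x0: "norm x0 \<le> R" "\<And>y. norm y \<le> R \<Longrightarrow> z y \<le> z x0"
    using continuous_attains_sup[OF compact_cball ne] unfolding mem_cball_0 Ball_def Bex_def by blast
  have "M \<le> z x1" using \<kappa>0 by (simp add: z_def M_def)
  also have "\<dots> \<le> z x0" using x0 x1 by simp
  finally have Mz: "M \<le> z x0" .
  have lt: "norm x0 < R"
  proof (rule ccontr)
    assume "\<not> norm x0 < R"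
    then have eq: "norm x0 = R" using x0 by simp
    then have "z x0 = \<kappa> * R\<^sup>2" using vb[OF eq] by (simp add: z_def W_R)
    then show False using Mz \<kappa>2 by simp
  qed
  \<comment> \<open>The global bound W - v \<le> M enters here, not merely the value at x0: x0
    maximises z, whereas M is attained at x1.\<close>
  have q_le: "q (norm x0) < f (v x0) + 2 * m * \<kappa>"
  proof -
    have "U (norm x0) \<le> W (norm x0)" using lt by (intro U_le_W) auto
    also have "\<dots> \<le> v x0 + M" using x1(2)[OF x0(1)] by (simp add: M_def)
    finally have "f (U (norm x0)) \<le> f (v x0 + M)" by (intro f_mono U_nonneg) auto
    also have "\<dots> \<le> f (v x0) + L * M" using lip[of "v x0" "v x0 + M"] v0[OF x0(1)] M by simp
    finally show ?thesis using \<kappa>1 by (simp add: q_def)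
  qed
  have v1: "((\<lambda>s. v (x0 + s *\<^sub>R b)) has_real_derivative partial_deriv b v (x0 + s *\<^sub>R b)) (at s)"
    if "norm (x0 + s *\<^sub>R b) < R" for s b
    using d1[of "x0 + s *\<^sub>R b"] that by (intro has_real_derivative_partial) auto
  have v2: "((\<lambda>s. partial_deriv b v (x0 + s *\<^sub>R b)) has_real_derivative partial_deriv b (partial_deriv b v) x0) (at 0)"
    if "b \<in> Basis" for b
    using has_real_derivative_partial[of "partial_deriv b v" x0 0 b] d2[of x0 b] lt that by simp
  have n1: "((\<lambda>s. (norm (x0 + s *\<^sub>R b))\<^sup>2) has_real_derivative 2 * (x0 \<bullet> b) + 2 * s) (at s)" if "b \<in> Basis" for s b
    unfolding norm_sq_line[OF that] by (auto intro!: derivative_eq_intros)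
  have near: "norm (x0 + s *\<^sub>R b) < R" if "b \<in> Basis" "\<bar>s\<bar> < R - norm x0" for s b
    using norm_triangle_ineq[of x0 "s *\<^sub>R b"] that by simp
  show False
  proof (cases "x0 = 0")
    case False
    define r where "r = norm x0"
    have r: "r > 0" using False by (simp add: r_def)
    define c where "c b = - ((q r - m * k r) / r\<^sup>2 * (x0 \<bullet> b)\<^sup>2 + k r) - partial_deriv b (partial_deriv b v) x0 + \<kappa> * 2" for b
    have "c b \<le> 0" if b: "b \<in> Basis" for b
    \<comment> \<open>Within this distance the line through x0 meets neither the origin, where the
      norm is not differentiable, nor the sphere.\<close>
    proof (rule second_derivative_nonpos_at_max[where \<delta>="min (norm x0) (R - norm x0)" and h="\<lambda>s. z (x0 + s *\<^sub>R b)"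
        and h'="\<lambda>s. - (k (norm (x0 + s *\<^sub>R b)) * ((x0 + s *\<^sub>R b) \<bullet> b)) - partial_deriv b v (x0 + s *\<^sub>R b) + \<kappa> * (2 * (x0 \<bullet> b) + 2 * s)"])
      fix s assume s: "\<bar>s\<bar> < min (norm x0) (R - norm x0)"
      have nr: "norm (x0 + s *\<^sub>R b) < R" using near[OF b] s by simp
      have "x0 + s *\<^sub>R b \<noteq> 0"
      proof
        assume "x0 + s *\<^sub>R b = 0"
        then have "x0 = - (s *\<^sub>R b)" by (simp add: eq_neg_iff_add_eq_0)
        then have "norm x0 = \<bar>s\<bar>" using b by simp
        then show False using s by simp
      qed
      then show "((\<lambda>s. z (x0 + s *\<^sub>R b)) has_real_derivative
          - (k (norm (x0 + s *\<^sub>R b)) * ((x0 + s *\<^sub>R b) \<bullet> b)) - partial_deriv b v (x0 + s *\<^sub>R b) + \<kappa> * (2 * (x0 \<bullet> b) + 2 * s)) (at s)"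
        unfolding z_def using nr b
        by (intro DERIV_add DERIV_diff DERIV_cmult W_line_deriv v1 n1)
      show "z (x0 + s *\<^sub>R b) \<le> z (x0 + 0 *\<^sub>R b)" using x0(2) nr by simp
    next
      have "((\<lambda>s. 2 * (x0 \<bullet> b) + 2 * s) has_real_derivative 2) (at 0)" by (auto intro!: derivative_eq_intros)
      then show "((\<lambda>s. - (k (norm (x0 + s *\<^sub>R b)) * ((x0 + s *\<^sub>R b) \<bullet> b)) - partial_deriv b v (x0 + s *\<^sub>R b) + \<kappa> * (2 * (x0 \<bullet> b) + 2 * s))
          has_real_derivative c b) (at 0)"
        unfolding c_def r_def m_def using b False lt
        by (intro DERIV_add DERIV_diff DERIV_cmult W_line_deriv2 v2)
    qed (use r lt r_def in auto)
    then have "(\<Sum>b\<in>Basis. c b) \<le> 0" by (intro sum_nonpos)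
    moreover have "(\<Sum>b\<in>Basis. c b) = - ((q r - m * k r) / r\<^sup>2 * (\<Sum>b\<in>Basis. (x0 \<bullet> b)\<^sup>2) + m * k r) - laplacian v x0 + m * (\<kappa> * 2)"
      by (simp add: c_def m_def laplacian_def sum.distrib sum_subtractf sum_negf sum_distrib_left)
    moreover have "(\<Sum>b\<in>Basis. (x0 \<bullet> b)\<^sup>2) = r\<^sup>2"
      unfolding r_def power2_norm_eq_inner by (simp add: euclidean_inner[of x0 x0] power2_eq_square)
    ultimately show False using q_le veq[OF lt] r by (simp add: r_def)
  next
    case True
    txt \<open>The second derivative of \<open>W\<close> is not available at the origin, so \<open>W\<close> is replaced by a
      paraboloid touching it from below there.\<close>
    define a where "a = q 0 / (2 * m)"
    define y where "y s b = W 0 - a * (norm (x0 + s *\<^sub>R b))\<^sup>2 - v (x0 + s *\<^sub>R b) + \<kappa> * (norm (x0 + s *\<^sub>R b))\<^sup>2" for s b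
    define c where "c b = - (a * 2) - partial_deriv b (partial_deriv b v) x0 + \<kappa> * 2" for b
    have "c b \<le> 0" if b: "b \<in> Basis" for b
    proof (rule second_derivative_nonpos_at_max[where \<delta>="R" and h="\<lambda>s. y s b"
        and h'="\<lambda>s. 0 - a * (2 * (x0 \<bullet> b) + 2 * s) - partial_deriv b v (x0 + s *\<^sub>R b) + \<kappa> * (2 * (x0 \<bullet> b) + 2 * s)"])
      fix s assume s: "\<bar>s\<bar> < R"
      have nr: "norm (x0 + s *\<^sub>R b) < R" using near[OF b, of s] s True by simp
      then show "((\<lambda>s. y s b) has_real_derivative
          0 - a * (2 * (x0 \<bullet> b) + 2 * s) - partial_deriv b v (x0 + s *\<^sub>R b) + \<kappa> * (2 * (x0 \<bullet> b) + 2 * s)) (at s)"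
        unfolding y_def using b
        by (intro DERIV_add DERIV_diff DERIV_cmult DERIV_const v1 n1)
      have "y s b \<le> z (x0 + s *\<^sub>R b)"
        using W_lower_at_0[of "norm (x0 + s *\<^sub>R b)"] nr by (simp add: y_def z_def a_def m_def)
      also have "\<dots> \<le> z x0" using x0(2) nr by simp
      also have "\<dots> = y 0 b" using True by (simp add: y_def z_def)
      finally show "y s b \<le> y 0 b" .
    next
      have 1: "((\<lambda>s. 2 * (x0 \<bullet> b) + 2 * s) has_real_derivative 2) (at 0)" by (auto intro!: derivative_eq_intros)
      have "((\<lambda>s. 0 - a * (2 * (x0 \<bullet> b) + 2 * s) - partial_deriv b v (x0 + s *\<^sub>R b) + \<kappa> * (2 * (x0 \<bullet> b) + 2 * s))
          has_real_derivative 0 - a * 2 - partial_deriv b (partial_deriv b v) x0 + \<kappa> * 2) (at 0)"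
        using 1 b by (intro DERIV_add DERIV_diff DERIV_cmult DERIV_const v2)
      then show "((\<lambda>s. 0 - a * (2 * (x0 \<bullet> b) + 2 * s) - partial_deriv b v (x0 + s *\<^sub>R b) + \<kappa> * (2 * (x0 \<bullet> b) + 2 * s))
          has_real_derivative c b) (at 0)"
        by (simp add: c_def)
    qed (use R in auto)
    then have "(\<Sum>b\<in>Basis. c b) \<le> 0" by (intro sum_nonpos)
    moreover have "(\<Sum>b\<in>Basis. c b) = - (m * (a * 2)) - laplacian v x0 + m * (\<kappa> * 2)"
      by (simp add: c_def m_def laplacian_def sum.distrib sum_subtractf)
    moreover have "m * (a * 2) = q 0" using m by (simp add: a_def)
    ultimately show False using q_le veq[OF lt] True by simp
  qed
qed

lemma rearrangement_le_solution:
  fixes v :: "'a \<Rightarrow> real"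
  assumes v: "dirichlet_solution (ball 0 R) f v"
    and L: "0 \<le> L" "L * R\<^sup>2 < 2 * real DIM('a)"
    and lip: "\<And>s t. 0 \<le> s \<Longrightarrow> s \<le> t \<Longrightarrow> f t - f s \<le> L * (t - s)"
    and x: "x \<in> ball 0 R"
  shows "us x \<le> v x"
proof -
  have "us x = U (norm x)" using x us_ext_eq[of x] by (simp add: us_ext_def)
  also have "\<dots> \<le> W (norm x)" using x by (intro U_le_W) auto
  also have "\<dots> \<le> v x" using x by (intro W_le_solution[OF v L lip]) auto
  finally show ?thesis .
qed

end

theorem theorem2:
  fixes \<Omega> :: "(real ^ 'n) set" and f f' :: "real \<Rightarrow> real"
    and u v ustar :: "real ^ 'n \<Rightarrow> real" and R :: real
  assumes "smooth_bounded_domain \<Omega>"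
    and "\<And>t. t \<ge> 0 \<Longrightarrow> f t > 0"
    and "\<And>t. t \<ge> 0 \<Longrightarrow> (f has_real_derivative f' t) (at t within {0..})"
    and "\<And>t. t \<ge> 0 \<Longrightarrow> f' t \<ge> 0"
    and "bdd_above (f' ` {0<..})"
    and "(SUP t\<in>{0<..}. f' t) <
           2 * real CARD('n) * unit_ball_vol (real CARD('n)) powr (2 / real CARD('n)) /
             measure lebesgue \<Omega> powr (2 / real CARD('n))"
    and "dirichlet_solution \<Omega> f u"
    and "measure lebesgue (ball (0 :: real ^ 'n) R) = measure lebesgue \<Omega>"
    and "dirichlet_solution (ball 0 R) f v"
    and "symmetric_decreasing_rearrangement \<Omega> u (ball 0 R) ustar"
  shows "\<forall>x\<in>ball 0 R. ustar x \<le> v x"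
proof -
  define L where "L = (SUP t\<in>{0<..}. f' t)"
  define N where "N = real CARD('n)"
  have N: "N > 0" by (simp add: N_def)
  have \<Omega>: "open \<Omega>" "\<Omega> \<noteq> {}" "bounded \<Omega>"
    using assms(1) by (auto simp: smooth_bounded_domain_def)
  have f'_le: "f' t \<le> L" if "0 < t" for t
    unfolding L_def using assms(5) that by (intro cSUP_upper) auto
  have L0: "0 \<le> L" using f'_le[of 1] assms(4)[of 1] by simp
  have f_cont: "continuous_on {0..} f"
    unfolding continuous_on_eq_continuous_within using DERIV_continuous[OF assms(3)] by auto
  \<comment> \<open>The mean value point lies strictly between s and t, hence is positive even if s
    = 0, and the supremum over positive arguments applies to it.\<close>
  have incr: "\<exists>z>0. f t - f s = (t - s) * f' z" if st: "0 \<le> s" "s < t" for s t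
  proof -
    have "continuous_on {s..t} f" using st by (intro continuous_on_subset[OF f_cont]) auto
    moreover have "(f has_derivative (\<lambda>h. f' z * h)) (at z)" if "s < z" "z < t" for z
    proof -
      have "(f has_real_derivative f' z) (at z)"
        using assms(3)[of z] at_within_interior[of z "{0..}"] that \<open>0 \<le> s\<close> by simp
      then show ?thesis by (simp only: has_field_derivative_def)
    qed
    ultimately obtain z where "s < z" "z < t" "f t - f s = f' z * (t - s)"
      using mvt[OF st(2), of f "\<lambda>z h. f' z * h"] by blast
    then show ?thesis using st by (intro exI[of _ z]) auto
  qed
  have f_mono: "f s \<le> f t" if "0 \<le> s" "s \<le> t" for s t
  proof (cases "s = t")
    case False
    with that obtain z where z: "z > 0" "f t - f s = (t - s) * f' z" using incr[of s t] by auto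
    then have "0 \<le> (t - s) * f' z" using assms(4)[of z] that by simp
    then show ?thesis using z by linarith
  qed simp
  have lip: "f t - f s \<le> L * (t - s)" if "0 \<le> s" "s \<le> t" for s t
  proof (cases "s = t")
    case False
    with that obtain z where z: "z > 0" "f t - f s = (t - s) * f' z" using incr[of s t] by auto
    then show ?thesis using mult_left_mono[OF f'_le[OF z(1)], of "t - s"] that by (simp add: mult.commute)
  qed simp
  have "\<not> negligible \<Omega>" using \<Omega> by (simp add: open_not_negligible)
  then have mpos: "measure lebesgue \<Omega> > 0"
    using \<Omega> by (simp add: lmeasurable_open negligible_iff_measure zero_less_measure_iff)
  have R: "R > 0"
  proof (rule ccontr)
    assume "\<not> R > 0"
    then have "ball (0 :: real ^ 'n) R = {}" by simp
    then have "measure lebesgue (ball (0 :: real ^ 'n) R) = 0" by (simp only: measure_empty)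
    then show False using assms(8) mpos by linarith
  qed
  have vol: "measure lebesgue \<Omega> = unit_ball_vol N * R ^ CARD('n)"
    using content_ball[of R "0 :: real ^ 'n"] R assms(8) by (simp add: measure_completion N_def)
  \<comment> \<open>The unit ball volume cancels in the hypothesis on f', whose right side becomes
    2n / R^2.\<close>
  have "measure lebesgue \<Omega> powr (2 / N) = unit_ball_vol N powr (2 / N) * R\<^sup>2"
  proof -
    have "(R ^ CARD('n)) powr (2 / N) = R\<^sup>2"
    proof -
      have "R ^ CARD('n) = R powr N" using R by (simp add: powr_realpow N_def)
      moreover have "(R powr N) powr (2 / N) = R powr 2" using N by (simp add: powr_powr)
      moreover have "R powr 2 = R\<^sup>2" using R by simp
      ultimately show ?thesis by (simp only:)
    qed
    then show ?thesis unfolding vol using R by (simp add: powr_mult N_def)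
  qed
  moreover have "unit_ball_vol N \<noteq> 0" using N by (metis less_imp_le less_irrefl unit_ball_vol_pos)
  ultimately have "L < 2 * N / R\<^sup>2"
    using assms(6) N by (simp add: L_def N_def)
  then have LR: "L * R\<^sup>2 < 2 * real DIM(real ^ 'n)"
    using R by (simp add: pos_less_divide_eq N_def)
  interpret rearranged_solution \<Omega> f u ustar R
    by unfold_locales (use \<Omega> assms f_mono f_cont R in auto)
  show ?thesis
    using rearrangement_le_solution[OF assms(9) L0 LR lip] by blast
qed

end
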